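(* There is a constant $C$ such that for every axis-parallel rectangle $M$ with side lengths $h_x$ (in $x$-direction) and $h_y$ (in $y$-direction), $\boldsymbol{h}_M=(h_x,h_y)$, every $u\in H^3(M)$ and every multi-index $\boldsymbol{\gamma}$ with $|\boldsymbol{\gamma}|\le2$: $$\|\boldsymbol{D}^{\boldsymbol{\gamma}}(u-\Pi^yu)\|_{0,M}\le C\sum_{|\boldsymbol{\alpha}|=3-|\boldsymbol{\gamma}|}\boldsymbol{h}_M^{\boldsymbol{\alpha}}\|\boldsymbol{D}^{\boldsymbol{\alpha}+\boldsymbol{\gamma}}u\|_{0,M}\qquad\text{for }\boldsymbol{\gamma}\neq(2,0),$$ $$\big\|(u-\Pi^yu)_{xx}\big\|_{0,M}\le C\bigg(\sum_{|\boldsymbol{\alpha}|=1}\boldsymbol{h}_M^{\boldsymbol{\alpha}}\|\boldsymbol{D}^{\boldsymbol{\alpha}}u_{xx}\|_{0,M}+\sum_{|\boldsymbol{\alpha}|=2}\frac{\boldsymbol{h}_M^{\boldsymbol{\alpha}}}{h_x}\|\boldsymbol{D}^{\boldsymbol{\alpha}}u_x\|_{0,M}\bigg).$$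
   Context: $\boldsymbol{D}^{\boldsymbol{\gamma}}=\partial_x^{\gamma_1}\partial_y^{\gamma_2}$, $\boldsymbol{h}_M^{\boldsymbol{\alpha}}=h_x^{\alpha_1}h_y^{\alpha_2}$, $\|\cdot\|_{0,M}$ is the $L_2(M)$ norm. For $j\in\{-1,1\}$ let $\hat\varphi_j,\hat\psi_j\in C^1[-1,1]$ be the functions that are quadratic polynomials on each of $[-1,0]$ and $[0,1]$ and are uniquely determined by $\hat\varphi_j(k)=\delta_{jk}$, $\hat\varphi_j'(k)=0$, $\hat\psi_j(k)=0$, $\hat\psi_j'(k)=\delta_{jk}$ for $k\in\{-1,1\}$. For $i\in\{-1,0,1\}$ let $\hat\ell_i\in P_2[-1,1]$ be the quadratic Lagrange basis functions for the nodes $-1,0,1$. For $v\in C^1([-1,1]^2)$ set $$\hat\Pi^yv(x,y)=\sum_{i\in\{-1,0,1\}}\sum_{j\in\{-1,1\}}\left(v(i,j)\hat\ell_i(x)\hat\varphi_j(y)+\frac{\partial v}{\partial y}(i,j)\hat\ell_i(x)\hat\psi_j(y)\right).$$ For $M=[x_0-h_x/2,x_0+h_x/2]\times[y_0-h_y/2,y_0+h_y/2]$ let $F_M:[-1,1]^2\to M$ be the affine map $x=x_0+\frac{h_x}{2}\hat x$, $y=y_0+\frac{h_y}{2}\hat y$, and $\Pi^yu=(\hat\Pi^y(u\circ F_M))\circ F_M^{-1}$. *)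

theory Defs
  imports "HOL-Analysis.Analysis" "HOL-Computational_Algebra.Polynomial"
begin

type_synonym plane = "real \<times> real"
type_synonym multi_index = "nat \<times> nat"

definition mi_order :: "multi_index \<Rightarrow> nat" where
  "mi_order \<alpha> = fst \<alpha> + snd \<alpha>"

definition mi_power :: "plane \<Rightarrow> multi_index \<Rightarrow> real" where
  "mi_power h \<alpha> = fst h ^ fst \<alpha> * snd h ^ snd \<alpha>"

definition partial_x :: "(plane \<Rightarrow> real) \<Rightarrow> plane \<Rightarrow> real" where
  "partial_x f = (\<lambda>(x, y). deriv (\<lambda>t. f (t, y)) x)"

definition partial_y :: "(plane \<Rightarrow> real) \<Rightarrow> plane \<Rightarrow> real" where
  "partial_y f = (\<lambda>(x, y). deriv (\<lambda>t. f (x, t)) y)"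

definition classical_D :: "multi_index \<Rightarrow> (plane \<Rightarrow> real) \<Rightarrow> plane \<Rightarrow> real" where
  "classical_D \<gamma> f = (partial_x ^^ fst \<gamma>) ((partial_y ^^ snd \<gamma>) f)"

primrec Ck :: "nat \<Rightarrow> (plane \<Rightarrow> real) \<Rightarrow> bool" where
  "Ck 0 f \<longleftrightarrow> continuous_on UNIV f"
| "Ck (Suc n) f \<longleftrightarrow> (\<forall>p. f differentiable (at p)) \<and> Ck n (partial_x f) \<and> Ck n (partial_y f)"

definition test_functions :: "plane set \<Rightarrow> (plane \<Rightarrow> real) set" where
  "test_functions \<Omega> =
    {\<phi>. (\<forall>k. Ck k \<phi>) \<and> compact (closure {p. \<phi> p \<noteq> 0}) \<and> closure {p. \<phi> p \<noteq> 0} \<subseteq> \<Omega>}"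

text \<open>Functions are not identified when they agree almost everywhere. The norm is meaningful
  only for members of the space: the Bochner integral of a non-integrable function is 0.\<close>

definition L2_space :: "plane set \<Rightarrow> (plane \<Rightarrow> real) set" where
  "L2_space S = {f \<in> borel_measurable (lebesgue_on S). integrable (lebesgue_on S) (\<lambda>p. (f p)\<^sup>2)}"

definition L2_norm_on :: "plane set \<Rightarrow> (plane \<Rightarrow> real) \<Rightarrow> real" where
  "L2_norm_on S f = sqrt (\<integral>p. (f p)\<^sup>2 \<partial>lebesgue_on S)"

definition locally_integrable :: "plane set \<Rightarrow> (plane \<Rightarrow> real) \<Rightarrow> bool" where
  "locally_integrable \<Omega> f \<longleftrightarrow> (\<forall>K. compact K \<and> K \<subseteq> \<Omega> \<longrightarrow> f absolutely_integrable_on K)"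

definition has_weak_derivative ::
    "plane set \<Rightarrow> multi_index \<Rightarrow> (plane \<Rightarrow> real) \<Rightarrow> (plane \<Rightarrow> real) \<Rightarrow> bool" where
  "has_weak_derivative \<Omega> \<gamma> u w \<longleftrightarrow>
     locally_integrable \<Omega> u \<and> locally_integrable \<Omega> w \<and>
     (\<forall>\<phi>\<in>test_functions \<Omega>.
        (\<integral>p. u p * classical_D \<gamma> \<phi> p \<partial>lebesgue_on \<Omega>) =
        (-1) ^ mi_order \<gamma> * (\<integral>p. w p * \<phi> p \<partial>lebesgue_on \<Omega>))"

text \<open>Weak derivatives are unique only up to null sets, so a representative is chosen.\<close>

definition weak_D :: "plane set \<Rightarrow> multi_index \<Rightarrow> (plane \<Rightarrow> real) \<Rightarrow> plane \<Rightarrow> real" where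
  "weak_D \<Omega> \<gamma> u = (SOME w. has_weak_derivative \<Omega> \<gamma> u w)"

definition sobolev_H :: "nat \<Rightarrow> plane set \<Rightarrow> (plane \<Rightarrow> real) set" where
  "sobolev_H k \<Omega> = {u \<in> L2_space \<Omega>.
     \<forall>\<gamma>. mi_order \<gamma> \<le> k \<longrightarrow> (\<exists>w\<in>L2_space \<Omega>. has_weak_derivative \<Omega> \<gamma> u w)}"

definition C1_on :: "plane set \<Rightarrow> (plane \<Rightarrow> real) \<Rightarrow> bool" where
  "C1_on S v \<longleftrightarrow> (\<exists>v\<^sub>x v\<^sub>y. continuous_on S v\<^sub>x \<and> continuous_on S v\<^sub>y \<and>
     (\<forall>p\<in>S. (v has_derivative (\<lambda>h. v\<^sub>x p * fst h + v\<^sub>y p * snd h)) (at p within S)))"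

text \<open>On a closed rectangle \<open>M\<close> with nonempty interior the values on \<open>M\<close> do not depend on the
  choice, since continuous functions that agree almost everywhere on \<open>M\<close> agree on \<open>M\<close>. Existence
  for functions in \<open>H\<^sup>3\<close> is the Sobolev embedding theorem.\<close>

definition C1_representative :: "plane set \<Rightarrow> (plane \<Rightarrow> real) \<Rightarrow> plane \<Rightarrow> real" where
  "C1_representative M u = (SOME v. C1_on M v \<and> (AE p in lebesgue_on M. v p = u p))"

text \<open>Functions on \<open>[-1,1]\<close> are made extensional so that they are determined by their values
  there; derivatives at the end points are one-sided.\<close>

definition C1_quadratic_splines :: "(real \<Rightarrow> real) set" where
  "C1_quadratic_splines = {f \<in> extensional {-1..1}.
     (\<exists>f'. continuous_on {-1..1} f' \<and>
           (\<forall>x\<in>{-1..1}. (f has_real_derivative f' x) (at x within {-1..1}))) \<and>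
     (\<exists>p. degree p \<le> 2 \<and> (\<forall>x\<in>{-1..0}. f x = poly p x)) \<and>
     (\<exists>q. degree q \<le> 2 \<and> (\<forall>x\<in>{0..1}. f x = poly q x))}"

definition hermite_spline_data :: "(real \<Rightarrow> real) \<Rightarrow> (real \<Rightarrow> real) \<Rightarrow> (real \<Rightarrow> real) \<Rightarrow> bool" where
  "hermite_spline_data a d f \<longleftrightarrow> f \<in> C1_quadratic_splines \<and>
     (\<forall>k\<in>{-1,1}. f k = a k \<and> (f has_real_derivative d k) (at k within {-1..1}))"

definition phi_hat :: "real \<Rightarrow> real \<Rightarrow> real" where
  "phi_hat j = (THE f. hermite_spline_data (\<lambda>k. if j = k then 1 else 0) (\<lambda>k. 0) f)"

definition psi_hat :: "real \<Rightarrow> real \<Rightarrow> real" where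
  "psi_hat j = (THE f. hermite_spline_data (\<lambda>k. 0) (\<lambda>k. if j = k then 1 else 0) f)"

definition lagrange_hat :: "real \<Rightarrow> real \<Rightarrow> real" where
  "lagrange_hat i x = (\<Prod>k\<in>{-1, 0, 1} - {i}. (x - k) / (i - k))"

definition interp_hat :: "(plane \<Rightarrow> real) \<Rightarrow> plane \<Rightarrow> real" where
  "interp_hat v = (\<lambda>(x, y). \<Sum>i\<in>{-1, 0, 1}. \<Sum>j\<in>{-1, 1}.
     v (i, j) * lagrange_hat i x * phi_hat j y +
     vector_derivative (\<lambda>t. v (i, t)) (at j within {-1..1}) * lagrange_hat i x * psi_hat j y)"

definition rect :: "plane \<Rightarrow> plane \<Rightarrow> plane set" where
  "rect c h = {fst c - fst h / 2 .. fst c + fst h / 2} \<times> {snd c - snd h / 2 .. snd c + snd h / 2}"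

definition rect_map :: "plane \<Rightarrow> plane \<Rightarrow> plane \<Rightarrow> plane" where
  "rect_map c h = (\<lambda>(x, y). (fst c + fst h / 2 * x, snd c + snd h / 2 * y))"

definition interp_y :: "plane \<Rightarrow> plane \<Rightarrow> (plane \<Rightarrow> real) \<Rightarrow> plane \<Rightarrow> real" where
  "interp_y c h u = interp_hat (C1_representative (rect c h) u \<circ> rect_map c h) \<circ>
     inv_into ({-1..1} \<times> {-1..1}) (rect_map c h)"

lemma spline_piece_deriv:
  fixes f :: "real \<Rightarrow> real"
  assumes "(f has_real_derivative D) (at x within {-1..1})"
    and "\<And>t. t \<in> {l..r} \<Longrightarrow> f t = poly p t"
    and "l < r" "{l..r} \<subseteq> {-1..1}" "x \<in> {l..r}"
  shows "poly (pderiv p) x = D"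
proof -
  have "(f has_real_derivative D) (at x within {l..r})"
    using assms(1,4) by (rule DERIV_subset)
  then have "(poly p has_real_derivative D) (at x within {l..r})"
    by (rule has_field_derivative_transform_within[OF _ zero_less_one assms(5)])
       (use assms(2) in auto)
  moreover have "(poly p has_real_derivative poly (pderiv p) x) (at x within {l..r})"
    by (rule poly_DERIV[THEN has_field_derivative_at_within])
  ultimately show ?thesis
    using vector_derivative_unique_within_closed_interval[of l r x "poly p"] assms(3,5)
    by (auto simp: has_real_derivative_iff_has_vector_derivative)
qed

lemma poly_degree_le_2:
  fixes p :: "real poly"
  assumes "degree p \<le> 2"
  obtains a b c where "p = [:a, b, c:]"
proof -
  have "p = [:coeff p 0, coeff p 1, coeff p 2:]"
  proof (rule poly_eqI)
    fix n
    show "coeff p n = coeff [:coeff p 0, coeff p 1, coeff p 2:] n"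
    proof (cases "n \<le> 2")
      case True
      then have "n = 0 \<or> n = 1 \<or> n = 2" by auto
      then show ?thesis by (auto simp: numeral_2_eq_2)
    next
      case False
      then have "coeff p n = 0" using assms by (intro coeff_eq_0) auto
      moreover have "degree [:coeff p 0, coeff p 1, coeff p 2:] \<le> 2" by (auto simp: degree_pCons_eq_if)
      then have "coeff [:coeff p 0, coeff p 1, coeff p 2:] n = 0"
        using False by (intro coeff_eq_0) auto
      ultimately show ?thesis by simp
    qed
  qed
  then show ?thesis using that by blast
qed

lemma hermite_spline_exists:
  "\<exists>f. hermite_spline_data a d f"
proof -
  define A where "A = ((d 1 - d (-1)) / 2 + (a 1 - a (-1) - d 1 - d (-1))) / 2"
  define B where "B = ((d 1 - d (-1)) / 2 - (a 1 - a (-1) - d 1 - d (-1))) / 2"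
  define l where "l = (\<lambda>x. a (-1) + d (-1) * (x + 1) + A * (x + 1)\<^sup>2)"
  define r where "r = (\<lambda>x. a 1 + d 1 * (x - 1) + B * (x - 1)\<^sup>2)"
  define l' where "l' = (\<lambda>x. d (-1) + 2 * A * (x + 1))"
  define r' where "r' = (\<lambda>x. d 1 + 2 * B * (x - 1))"
  define g where "g = (\<lambda>x::real. if x \<in> {..0} then l x else r x)"
  define g' where "g' = (\<lambda>x::real. if x \<le> 0 then l' x else r' x)"
  define f where "f = restrict g {-1..1}"
  have l0: "l 0 = r 0" "l' 0 = r' 0"
    by (simp_all add: l_def r_def l'_def r'_def A_def B_def field_simps)
  have dl: "(l has_real_derivative l' x) (at x within S)" for x S
    unfolding l_def l'_def by (auto intro!: derivative_eq_intros)
  have dr: "(r has_real_derivative r' x) (at x within S)" for x S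
    unfolding r_def r'_def by (auto intro!: derivative_eq_intros)
  have dg: "(g has_real_derivative g' x) (at x within {-1..1})" for x
  proof -
    have "(g has_vector_derivative (if x \<in> {..0} then l' x else r' x)) (at x within UNIV)"
      unfolding g_def
    proof (rule has_vector_derivative_If_within_closures[where T = "{0..}"])
      show "(l has_vector_derivative l' x) (at x within {..0} \<union> closure {..0} \<inter> closure {0..})"
        using dl by (simp add: has_real_derivative_iff_has_vector_derivative)
      show "(r has_vector_derivative r' x) (at x within {0..} \<union> closure {..0} \<inter> closure {0..})"
        using dr by (simp add: has_real_derivative_iff_has_vector_derivative)
    qed (use l0 in \<open>auto intro!: antisym\<close>)
    then show ?thesis
      by (auto simp: g'_def has_real_derivative_iff_has_vector_derivative
               intro: has_vector_derivative_at_within)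
  qed
  have df: "(f has_real_derivative g' x) (at x within {-1..1})" if "x \<in> {-1..1}" for x
    by (rule has_field_derivative_transform_within[OF dg zero_less_one that]) (auto simp: f_def)
  have cont: "continuous_on {-1..1} g'"
  proof -
    have "continuous_on ({..0} \<union> {0..}) g'"
      unfolding g'_def
      by (rule continuous_on_If) (use l0 in \<open>auto simp: l'_def r'_def intro!: continuous_intros\<close>)
    then show ?thesis by (rule continuous_on_subset) auto
  qed
  have pl: "l x = poly [:a (-1) + d (-1) + A, d (-1) + 2 * A, A:] x" for x
    by (simp add: l_def power2_eq_square algebra_simps)
  have pr: "r x = poly [:a 1 - d 1 + B, d 1 - 2 * B, B:] x" for x
    by (simp add: r_def power2_eq_square algebra_simps)
  have "f \<in> C1_quadratic_splines"
    unfolding C1_quadratic_splines_def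
  proof (intro CollectI conjI)
    show "f \<in> extensional {-1..1}" by (simp add: f_def)
    show "\<exists>f'. continuous_on {-1..1} f' \<and>
           (\<forall>x\<in>{-1..1}. (f has_real_derivative f' x) (at x within {-1..1}))"
      using cont df by blast
    show "\<exists>p. degree p \<le> 2 \<and> (\<forall>x\<in>{-1..0}. f x = poly p x)"
      by (rule exI[of _ "[:a (-1) + d (-1) + A, d (-1) + 2 * A, A:]"])
         (auto simp: f_def g_def pl degree_pCons_eq_if)
    show "\<exists>p. degree p \<le> 2 \<and> (\<forall>x\<in>{0..1}. f x = poly p x)"
      by (rule exI[of _ "[:a 1 - d 1 + B, d 1 - 2 * B, B:]"])
         (use l0 in \<open>auto simp: f_def g_def pr degree_pCons_eq_if\<close>)
  qed
  moreover have "f 1 = a 1" "f (-1) = a (-1)" "g' 1 = d 1" "g' (-1) = d (-1)"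
    by (simp_all add: f_def g_def g'_def l_def r_def l'_def r'_def)
  ultimately have "hermite_spline_data a d f"
    unfolding hermite_spline_data_def using df[of 1] df[of "-1"] by auto
  then show ?thesis by blast
qed

lemma hermite_spline_unique:
  assumes "hermite_spline_data a d f" "hermite_spline_data a d g"
  shows "f = g"
proof -
  have key: "\<exists>A. (\<forall>x\<in>{-1..0}. f x = a (-1) + d (-1) * (x + 1) + A * (x + 1)\<^sup>2) \<and>
      (\<exists>B. (\<forall>x\<in>{0..1}. f x = a 1 + d 1 * (x - 1) + B * (x - 1)\<^sup>2) \<and>
           A = ((d 1 - d (-1)) / 2 + (a 1 - a (-1) - d 1 - d (-1))) / 2 \<and>
           B = ((d 1 - d (-1)) / 2 - (a 1 - a (-1) - d 1 - d (-1))) / 2)"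
    if "hermite_spline_data a d f" for f
  proof -
    have f: "f \<in> C1_quadratic_splines"
      and v: "f (-1) = a (-1)" "f 1 = a 1"
      and D: "(f has_real_derivative d (-1)) (at (-1) within {-1..1})"
             "(f has_real_derivative d 1) (at 1 within {-1..1})"
      using that unfolding hermite_spline_data_def by auto
    obtain f' where f': "\<And>x. x \<in> {-1..1} \<Longrightarrow> (f has_real_derivative f' x) (at x within {-1..1})"
      using f unfolding C1_quadratic_splines_def by blast
    obtain p where p: "degree p \<le> 2" "\<And>x. x \<in> {-1..0} \<Longrightarrow> f x = poly p x"
      using f unfolding C1_quadratic_splines_def by blast
    obtain q where q: "degree q \<le> 2" "\<And>x. x \<in> {0..1} \<Longrightarrow> f x = poly q x"
      using f unfolding C1_quadratic_splines_def by blast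
    obtain p0 p1 p2 where P: "p = [:p0, p1, p2:]" using p(1) by (rule poly_degree_le_2)
    obtain q0 q1 q2 where Q: "q = [:q0, q1, q2:]" using q(1) by (rule poly_degree_le_2)
    have e: "poly (pderiv p) (-1) = d (-1)" "poly (pderiv q) 1 = d 1"
         "poly (pderiv p) 0 = f' 0" "poly (pderiv q) 0 = f' 0"
      using spline_piece_deriv[OF D(1) p(2)] spline_piece_deriv[OF D(2) q(2)]
        spline_piece_deriv[OF f' p(2), of 0] spline_piece_deriv[OF f' q(2), of 0] by auto
    have w: "poly p (-1) = a (-1)" "poly q 1 = a 1" "poly p 0 = poly q 0"
      using p(2)[of "-1"] q(2)[of 1] p(2)[of 0] q(2)[of 0] v by auto
    have eqs: "p1 - 2 * p2 = d (-1)" "q1 + 2 * q2 = d 1" "p1 = q1"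
        "p0 - p1 + p2 = a (-1)" "q0 + q1 + q2 = a 1" "p0 = q0"
      using e w by (simp_all add: P Q pderiv_pCons algebra_simps)
    have "f x = a (-1) + d (-1) * (x + 1) + p2 * (x + 1)\<^sup>2" if "x \<in> {-1..0}" for x
      using that by (simp add: p(2) P eqs(1,4)[symmetric] power2_eq_square algebra_simps)
    moreover have "f x = a 1 + d 1 * (x - 1) + q2 * (x - 1)\<^sup>2" if "x \<in> {0..1}" for x
      using that by (simp add: q(2) Q eqs(2,5)[symmetric] power2_eq_square algebra_simps)
    moreover have "p2 = ((d 1 - d (-1)) / 2 + (a 1 - a (-1) - d 1 - d (-1))) / 2"
      "q2 = ((d 1 - d (-1)) / 2 - (a 1 - a (-1) - d 1 - d (-1))) / 2"
      by (simp_all add: eqs(1,2,4,5)[symmetric] eqs(3,6) field_simps)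
    ultimately show ?thesis by blast
  qed
  have "f x = g x" if "x \<in> {-1..1}" for x
    using key[OF assms(1)] key[OF assms(2)] that
    by (cases "x \<le> 0") auto
  moreover have "f \<in> extensional {-1..1}" "g \<in> extensional {-1..1}"
    using assms by (auto simp: hermite_spline_data_def C1_quadratic_splines_def)
  ultimately show ?thesis by (intro extensionalityI)
qed

lemma hermite_spline_ex1: "\<exists>!f. hermite_spline_data a d f"
  using hermite_spline_exists hermite_spline_unique by blast

lemma phi_hat_data: "hermite_spline_data (\<lambda>k. if j = k then 1 else 0) (\<lambda>k. 0) (phi_hat j)"
  unfolding phi_hat_def by (rule theI'[OF hermite_spline_ex1])

lemma psi_hat_data: "hermite_spline_data (\<lambda>k. 0) (\<lambda>k. if j = k then 1 else 0) (psi_hat j)"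
  unfolding psi_hat_def by (rule theI'[OF hermite_spline_ex1])

end

(* Let P be the quadratic polynomial for which all derivatives of r = u - P of order at most 2
   have mean value zero on the rectangle. The interpolation reproduces P, so the error is r minus
   the interpolant of r. Iterating the Poincare inequality bounds all derivatives of r by the
   third derivatives of u. A derivative of the interpolant of r depends only on certain
   differences of the nodal data, and these are bounded because a function f with f, f_x, f_y and
   f_xy in L^2 has a continuous representative with a quantitative bound; this applies to r, r_x
   and r_y. Second differences in x of the nodal derivatives in y cannot be bounded by r_xxy in
   this way, so for (2, 0) they are split into first differences at the cost of a factor 1 / h_x:
   the second sum in that estimate already suffices. *)

theory Submission
  imports Defs
begin

section \<open>Smooth functions of one variable\<close>

text \<open>No Sobolev function is transported to the reference square. All estimates are carried
  out on the given rectangle with the two side lengths kept apart, so every derivative is paired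
  with the side length of its own direction and no aspect ratio enters the constant; only the
  explicit basis functions are scaled. The analytic input is one-dimensional. Testing weak
  derivatives with products of one-variable functions and using Fubini, f becomes a function of y
  plus the primitive of f_x along horizontal lines. Doing this twice gives f(x, y) = m(y) + N(x) +
  double primitive of f_xy. The mixed derivatives of r_x and r_y are r_xxy and r_xyy, so the third
  order suffices for pointwise control of first derivatives; pointwise control of r_xy would take a
  derivative of order four, so differences of r_y in x are bounded without it. Weak derivatives and
  C^1 representatives are chosen by \<open>SOME\<close>. Uniqueness almost everywhere is therefore
  needed for both, and the chosen weak derivative is a priori only locally integrable.\<close>

primrec smooth_n :: "nat \<Rightarrow> (real \<Rightarrow> real) \<Rightarrow> bool" where
  "smooth_n 0 f \<longleftrightarrow> continuous_on UNIV f"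
| "smooth_n (Suc n) f \<longleftrightarrow> (\<forall>x. f differentiable (at x)) \<and> smooth_n n (deriv f)"

definition smooth :: "(real \<Rightarrow> real) \<Rightarrow> bool" where
  "smooth f \<longleftrightarrow> (\<forall>n. smooth_n n f)"

lemma smooth_n_SucI:
  assumes "\<And>x. (f has_real_derivative f' x) (at x)" "smooth_n n f'"
  shows "smooth_n (Suc n) f"
proof -
  have "deriv f = f'" using assms(1) by (auto intro!: DERIV_imp_deriv)
  then show ?thesis using assms by (auto simp: real_differentiable_def)
qed

lemma smooth_n_SucD:
  assumes "smooth_n (Suc n) f"
  shows "(f has_real_derivative deriv f x) (at x)" "smooth_n n (deriv f)"
  using assms by (auto simp: real_differentiable_def DERIV_deriv_iff_real_differentiable)

lemma smooth_n_Suc_imp: "smooth_n (Suc n) f \<Longrightarrow> smooth_n n f"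
proof (induction n arbitrary: f)
  case 0
  then show ?case
    by (auto intro!: continuous_at_imp_continuous_on differentiable_imp_continuous_within)
qed auto

lemma smooth_n_const: "smooth_n n (\<lambda>x. k)"
proof (induction n arbitrary: k)
  case (Suc n)
  show ?case by (rule smooth_n_SucI[OF _ Suc[of 0]]) (auto intro!: derivative_eq_intros)
qed auto

lemma smooth_n_add: "smooth_n n f \<Longrightarrow> smooth_n n g \<Longrightarrow> smooth_n n (\<lambda>x. f x + g x)"
proof (induction n arbitrary: f g)
  case (Suc n)
  note D = smooth_n_SucD[OF Suc.prems(1)] smooth_n_SucD[OF Suc.prems(2)]
  show ?case by (rule smooth_n_SucI[OF DERIV_add[OF D(1,3)] Suc.IH[OF D(2,4)]])
qed (auto intro!: continuous_intros)

lemma smooth_n_mult: "smooth_n n f \<Longrightarrow> smooth_n n g \<Longrightarrow> smooth_n n (\<lambda>x. f x * g x)"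
proof (induction n arbitrary: f g)
  case (Suc n)
  note D = smooth_n_SucD[OF Suc.prems(1)] smooth_n_SucD[OF Suc.prems(2)]
  note S = smooth_n_Suc_imp[OF Suc.prems(1)] smooth_n_Suc_imp[OF Suc.prems(2)]
  show ?case
    by (rule smooth_n_SucI[OF DERIV_mult[OF D(1,3)]
          smooth_n_add[OF Suc.IH[OF D(2) S(2)] Suc.IH[OF D(4) S(1)]]])
qed (auto intro!: continuous_intros)

lemma smooth_n_affine: "smooth_n n f \<Longrightarrow> smooth_n n (\<lambda>x. f (m * x + k))"
proof (induction n arbitrary: f)
  case 0
  then have "continuous_on UNIV (f \<circ> (\<lambda>x. m * x + k))"
    by (intro continuous_on_compose) (auto intro!: continuous_intros elim: continuous_on_subset)
  then show ?case by (simp add: o_def)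
next
  case (Suc n)
  show ?case
  proof (rule smooth_n_SucI[where f' = "\<lambda>x. m * deriv f (m * x + k)"])
    show "((\<lambda>x. f (m * x + k)) has_real_derivative m * deriv f (m * x + k)) (at x)" for x
    proof -
      have "((\<lambda>x. m * x + k) has_real_derivative m) (at x)" by (auto intro!: derivative_eq_intros)
      from DERIV_chain'[OF this smooth_n_SucD(1)[OF Suc.prems]] show ?thesis by (simp add: mult.commute)
    qed
    show "smooth_n n (\<lambda>x. m * deriv f (m * x + k))"
      by (rule smooth_n_mult[OF smooth_n_const Suc.IH[OF smooth_n_SucD(2)[OF Suc.prems]]])
  qed
qed

lemma smooth_n_exp: "smooth_n n f \<Longrightarrow> smooth_n n (\<lambda>x. exp (f x))"
proof (induction n arbitrary: f)
  case (Suc n)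
  note D = smooth_n_SucD[OF Suc.prems]
  show ?case
    by (rule smooth_n_SucI[OF DERIV_chain'[OF D(1) DERIV_exp]
          smooth_n_mult[OF Suc.IH[OF smooth_n_Suc_imp[OF Suc.prems]] D(2)]])
qed (auto intro!: continuous_intros)

lemma smooth_const: "smooth (\<lambda>x. k)"
  unfolding smooth_def by (intro allI smooth_n_const)

lemma smooth_add: "smooth f \<Longrightarrow> smooth g \<Longrightarrow> smooth (\<lambda>x. f x + g x)"
  unfolding smooth_def by (rule allI, rule smooth_n_add) (erule spec)+

lemma smooth_mult: "smooth f \<Longrightarrow> smooth g \<Longrightarrow> smooth (\<lambda>x. f x * g x)"
  unfolding smooth_def by (rule allI, rule smooth_n_mult) (erule spec)+

lemma smooth_affine: "smooth f \<Longrightarrow> smooth (\<lambda>x. f (m * x + k))"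
  unfolding smooth_def by (rule allI, rule smooth_n_affine) (erule spec)

lemma smooth_exp: "smooth f \<Longrightarrow> smooth (\<lambda>x. exp (f x))"
  unfolding smooth_def by (rule allI, rule smooth_n_exp) (erule spec)

lemma smooth_DERIV: "smooth f \<Longrightarrow> (f has_real_derivative deriv f x) (at x)"
  unfolding smooth_def by (rule smooth_n_SucD) auto

lemma smooth_deriv: "smooth f \<Longrightarrow> smooth (deriv f)"
  unfolding smooth_def using smooth_n_SucD(2) by blast

lemma smooth_continuous: "smooth f \<Longrightarrow> continuous_on S f"
  unfolding smooth_def by (drule spec[of _ 0]) (auto intro: continuous_on_subset)

lemma smooth_antiderivative:
  assumes "\<And>x. (f has_real_derivative f' x) (at x)" "smooth f'"
  shows "smooth f"
  unfolding smooth_def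
proof
  fix n show "smooth_n n f"
    using assms smooth_n_SucI[of f f' n] by (auto simp: smooth_def simp del: smooth_n.simps intro: smooth_n_Suc_imp)
qed

text \<open>\<open>flat 1\<close> is exp(-1/x) continued by zero. The polynomial factor in 1/x makes
  the family closed under differentiation, so that smoothness is proved for all members at
  once.\<close>

definition flat :: "real poly \<Rightarrow> real \<Rightarrow> real" where
  "flat p x = (if x > 0 then poly p (1 / x) * exp (- 1 / x) else 0)"

text \<open>The power \<open>t ^ k\<close> is there for the induction on the polynomial: splitting
  off the constant coefficient leaves the shorter polynomial with exponent k + 1.\<close>

lemma poly_times_exp_tendsto_0: "((\<lambda>t::real. t ^ k * poly p t * exp (- t)) \<longlongrightarrow> 0) at_top"
proof (induction p arbitrary: k)
  case (pCons a p)
  have "((\<lambda>t. a * (t ^ k / exp t) + t ^ Suc k * poly p t * exp (- t)) \<longlongrightarrow> a * 0 + 0) at_top"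
    by (intro tendsto_intros tendsto_power_div_exp_0 pCons.IH)
  then show ?case by (simp add: exp_minus field_simps)
qed auto

text \<open>With t = 1/x the derivative of p(t) exp(-t) in x is t^2 (p(t) - p'(t)) exp(-t), which
  gives the new polynomial. At 0 the two one-sided difference quotients are treated
  separately.\<close>

lemma flat_DERIV: "(flat p has_real_derivative flat ([:0, 0, 1:] * (p - pderiv p)) x) (at x)"
proof -
  consider "x > 0" | "x < 0" | "x = 0" by linarith
  then show ?thesis
  proof cases
    case 1
    have "((\<lambda>x. poly p (1 / x) * exp (- 1 / x)) has_real_derivative
        flat ([:0, 0, 1:] * (p - pderiv p)) x) (at x)"
      using 1 by (auto intro!: derivative_eq_intros poly_DERIV simp: flat_def field_simps power2_eq_square)
    then show ?thesis
      by (rule has_field_derivative_transform_within_open[where S = "{0<..}"])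
        (use 1 in \<open>auto simp: flat_def\<close>)
  next
    case 2
    have "((\<lambda>x. 0) has_real_derivative flat ([:0, 0, 1:] * (p - pderiv p)) x) (at x)"
      using 2 by (auto intro!: derivative_eq_intros simp: flat_def)
    then show ?thesis
      by (rule has_field_derivative_transform_within_open[where S = "{..<0}"])
        (use 2 in \<open>auto simp: flat_def\<close>)
  next
    case 3
    have "((\<lambda>h. (flat p h) / h) \<longlongrightarrow> 0) (at_right 0)"
    proof -
      have "filterlim (\<lambda>h::real. 1 / h) at_top (at_right 0)"
        by (simp add: filterlim_inverse_at_top_right divide_inverse)
      \<comment> \<open>The exponent is 1 because dividing by h = 1/t contributes one factor
        t.\<close>
      from filterlim_compose[OF poly_times_exp_tendsto_0[of 1 p] this]
      show ?thesis
        by (rule Lim_transform_eventually)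
          (auto simp: eventually_at_filter flat_def field_simps)
    qed
    moreover have "((\<lambda>h. (flat p h) / h) \<longlongrightarrow> 0) (at_left 0)"
      by (rule Lim_transform_eventually[OF tendsto_const])
        (auto simp: eventually_at_filter flat_def)
    ultimately have "((\<lambda>h. (flat p h) / h) \<longlongrightarrow> 0) (at 0)"
      by (simp add: filterlim_split_at)
    then show ?thesis
      using 3 by (simp add: DERIV_def flat_def)
  qed
qed

lemma smooth_flat: "smooth (flat p)"
proof -
  have "smooth_n n (flat p)" for n
  proof (induction n arbitrary: p)
    case 0
    show ?case
      using flat_DERIV[THEN DERIV_isCont] by (auto intro!: continuous_at_imp_continuous_on)
  next
    case (Suc n)
    show ?case by (rule smooth_n_SucI[OF flat_DERIV Suc])
  qed
  then show ?thesis by (simp add: smooth_def)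
qed

text \<open>Positive exactly on the open interval. The arguments are spelled out as m * x + k to fit
  \<open>smooth_affine\<close>.\<close>

definition bump :: "real \<Rightarrow> real \<Rightarrow> real \<Rightarrow> real" where
  "bump l r x = flat 1 (1 * x + (- l)) * flat 1 ((-1) * x + r)"

lemma smooth_bump: "smooth (bump l r)"
  unfolding bump_def
  by (rule smooth_mult[OF smooth_affine[OF smooth_flat] smooth_affine[OF smooth_flat]])

lemma bump_pos_iff: "bump l r x > 0 \<longleftrightarrow> l < x \<and> x < r"
  and bump_nonneg: "bump l r x \<ge> 0"
  and bump_eq_0: "\<not> (l < x \<and> x < r) \<Longrightarrow> bump l r x = 0"
  by (simp_all add: bump_def flat_def)

text \<open>A smooth sequence with values in [0, 1] that converges pointwise to the indicator of the
  open interval while keeping its support in the closed one: approximation of indicators by test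
  functions under a fixed dominating function.\<close>

definition plateau :: "real \<Rightarrow> real \<Rightarrow> nat \<Rightarrow> real \<Rightarrow> real" where
  "plateau l r n x = 1 + (-1) * exp ((- real n) * bump l r x)"

lemma smooth_plateau: "smooth (plateau l r n)"
  unfolding plateau_def
  by (rule smooth_add[OF smooth_const smooth_mult[OF smooth_const smooth_exp[OF
        smooth_mult[OF smooth_const smooth_bump]]]])

lemma plateau_eq_0: "\<not> (l < x \<and> x < r) \<Longrightarrow> plateau l r n x = 0"
  by (simp add: plateau_def bump_eq_0)

lemma plateau_bounds: "0 \<le> plateau l r n x" "plateau l r n x \<le> 1"
  using bump_nonneg[of l r x] by (auto simp: plateau_def)

lemma plateau_tendsto: "(\<lambda>n. plateau l r n x) \<longlonglongrightarrow> indicator {l<..<r} x"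
proof (cases "l < x \<and> x < r")
  case True
  then have "bump l r x > 0" by (simp add: bump_pos_iff)
  then have "filterlim (\<lambda>n. real n * bump l r x) at_top sequentially"
    by (intro filterlim_at_top_mult_tendsto_pos[OF tendsto_const _ filterlim_real_sequentially])
  then have "filterlim (\<lambda>n. - (real n * bump l r x)) at_bot sequentially"
    by (simp add: filterlim_uminus_at_bot)
  then have "(\<lambda>n. exp (- (real n * bump l r x))) \<longlonglongrightarrow> 0"
    by (rule filterlim_compose[OF exp_at_bot])
  then have "(\<lambda>n. 1 + (-1) * exp (- (real n * bump l r x))) \<longlonglongrightarrow> 1 + (-1) * 0"
    by (intro tendsto_intros)
  then show ?thesis using True by (simp add: plateau_def)
qed (simp add: plateau_eq_0)

subsection \<open>Test functions of one variable and their tensor products\<close>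

text \<open>The compactly supported smooth functions on the open interval; the support is kept away
  from the end points by explicit l and r.\<close>

definition tests :: "real \<Rightarrow> real \<Rightarrow> (real \<Rightarrow> real) set" where
  "tests a b = {f. smooth f \<and> (\<exists>l r. a < l \<and> l < r \<and> r < b \<and> (\<forall>x. x < l \<longrightarrow> f x = 0) \<and> (\<forall>x>r. f x = 0))}"

lemma testsI:
  "smooth f \<Longrightarrow> a < l \<Longrightarrow> l < r \<Longrightarrow> r < b \<Longrightarrow> (\<And>x. x < l \<Longrightarrow> f x = 0) \<Longrightarrow>
    (\<And>x. r < x \<Longrightarrow> f x = 0) \<Longrightarrow> f \<in> tests a b"
  unfolding tests_def by (intro CollectI conjI exI[of _ l] exI[of _ r] allI impI) auto

lemma testsE:
  assumes "f \<in> tests a b"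
  obtains l r where "smooth f" "a < l" "l < r" "r < b" "\<And>x. x < l \<Longrightarrow> f x = 0" "\<And>x. r < x \<Longrightarrow> f x = 0"
  using assms unfolding tests_def by (elim CollectE conjE exE) (use that in blast)

lemma tests_smooth: "f \<in> tests a b \<Longrightarrow> smooth f"
  by (simp add: tests_def)

lemma tests_eq_0: "f \<in> tests a b \<Longrightarrow> \<not> (a < x \<and> x < b) \<Longrightarrow> f x = 0"
  by (erule testsE) (cases "a < x", auto)

lemma plateau_tests: "a < l \<Longrightarrow> l < r \<Longrightarrow> r < b \<Longrightarrow> plateau l r n \<in> tests a b"
  by (rule testsI[OF smooth_plateau]) (auto intro: plateau_eq_0)

lemma bump_tests: "a < l \<Longrightarrow> l < r \<Longrightarrow> r < b \<Longrightarrow> bump l r \<in> tests a b"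
  by (rule testsI[OF smooth_bump]) (auto intro: bump_eq_0)

lemma tests_mono:
  assumes "f \<in> tests l r" "a \<le> l" "r \<le> b" shows "f \<in> tests a b"
proof -
  obtain l' r' where "smooth f" "l < l'" "l' < r'" "r' < r" "\<And>x. x < l' \<Longrightarrow> f x = 0" "\<And>x. r' < x \<Longrightarrow> f x = 0"
    using assms(1) by (rule testsE) blast
  then show ?thesis using assms(2,3) by (intro testsI[of f a l' r' b]) auto
qed

lemma tests_DERIV: "f \<in> tests a b \<Longrightarrow> (f has_real_derivative deriv f x) (at x)"
  by (intro smooth_DERIV tests_smooth)

lemma tests_deriv:
  assumes "f \<in> tests a b" shows "deriv f \<in> tests a b"
proof -
  obtain l r where f: "smooth f" "a < l" "l < r" "r < b" "\<And>x. x < l \<Longrightarrow> f x = 0" "\<And>x. r < x \<Longrightarrow> f x = 0"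
    using assms by (rule testsE) blast
  have "deriv f x = 0" if "x \<notin> {l..r}" for x
  proof (rule DERIV_imp_deriv)
    show "(f has_real_derivative 0) (at x)"
      by (rule has_field_derivative_transform_within_open[OF DERIV_const[of 0], where S = "- {l..r}"])
        (use that f(5,6) in \<open>auto simp: not_le\<close>)
  qed
  then show ?thesis using f by (intro testsI[of "deriv f" a l r b] smooth_deriv) auto
qed

lemma tests_continuous: "f \<in> tests a b \<Longrightarrow> continuous_on S f"
  by (intro smooth_continuous tests_smooth)

lemma tests_borel: "f \<in> tests a b \<Longrightarrow> f \<in> borel_measurable borel"
  by (intro borel_measurable_continuous_onI tests_continuous)

lemma tests_bounded:
  assumes "f \<in> tests a b" obtains K where "K > 0" "\<And>x. \<bar>f x\<bar> \<le> K"
proof -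
  obtain l r where f: "smooth f" "a < l" "l < r" "r < b" "\<And>x. x < l \<Longrightarrow> f x = 0" "\<And>x. r < x \<Longrightarrow> f x = 0"
    using assms by (rule testsE) blast
  have "compact (f ` {l..r})"
    by (intro compact_continuous_image tests_continuous[OF assms]) auto
  then obtain K where K: "K > 0" "\<And>x. x \<in> {l..r} \<Longrightarrow> \<bar>f x\<bar> \<le> K"
    unfolding compact_eq_bounded_closed bounded_pos by force
  moreover have "\<bar>f x\<bar> \<le> K" if "x \<notin> {l..r}" for x
    using that f(5,6)[of x] K(1) by auto
  ultimately show ?thesis using that[of K] by blast
qed

lemma tests_integrable:
  assumes "f \<in> tests a b" shows "integrable lborel f"
proof -
  obtain l r where f: "smooth f" "a < l" "l < r" "r < b" "\<And>x. x < l \<Longrightarrow> f x = 0" "\<And>x. r < x \<Longrightarrow> f x = 0"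
    using assms by (rule testsE) blast
  have "integrable lborel (\<lambda>x. indicator {l..r} x *\<^sub>R f x)"
    by (rule borel_integrable_compact) (auto intro: tests_continuous[OF assms])
  also have "(\<lambda>x. indicator {l..r} x *\<^sub>R f x) = f"
    using f(5,6) by (force simp: indicator_def fun_eq_iff)
  finally show ?thesis .
qed

lemma tests_lincomb: 
  assumes "f \<in> tests a b" "g \<in> tests a b" shows "(\<lambda>x. f x + k * g x) \<in> tests a b"
proof -
  obtain l r where f: "smooth f" "a < l" "l < r" "r < b" "\<And>x. x < l \<Longrightarrow> f x = 0" "\<And>x. r < x \<Longrightarrow> f x = 0"
    using assms(1) by (rule testsE) blast
  obtain l' r' where g: "smooth g" "a < l'" "l' < r'" "r' < b" "\<And>x. x < l' \<Longrightarrow> g x = 0" "\<And>x. r' < x \<Longrightarrow> g x = 0"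
    using assms(2) by (rule testsE) blast
  show ?thesis
    by (rule testsI[where l = "min l l'" and r = "max r r'"])
      (use f g in \<open>auto intro!: smooth_add smooth_mult smooth_const\<close>)
qed

lemma tests_integral_deriv_0:
  assumes "f \<in> tests a b" shows "(\<integral>x. indicator {..s} x * deriv f x \<partial>lborel) = f s"
    "(\<integral>x. indicator {s..} x * deriv f x \<partial>lborel) = - f s"
proof -
  obtain l r where f: "smooth f" "a < l" "l < r" "r < b" "\<And>x. x < l \<Longrightarrow> f x = 0" "\<And>x. r < x \<Longrightarrow> f x = 0"
    using assms by (rule testsE) blast
  obtain l' r' where g: "smooth (deriv f)" "a < l'" "l' < r'" "r' < b" "\<And>x. x < l' \<Longrightarrow> deriv f x = 0" "\<And>x. r' < x \<Longrightarrow> deriv f x = 0"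
    using tests_deriv[OF assms] by (rule testsE) blast
  have cont: "isCont (deriv f) x" for x
    using tests_continuous[OF tests_deriv[OF assms], of UNIV] by (simp add: continuous_on_eq_continuous_at)
  \<comment> \<open>Left of both supports, so that \<open>f p = 0\<close> and cutting the half line
    at \<open>p\<close> loses nothing of \<open>deriv f\<close>.\<close>
  define p where "p = min s (min l l') - 1"
  define q where "q = max s (max r r') + 1"
  have "(\<integral>x. deriv f x * indicator {p..s} x \<partial>lborel) = f s - f p"
    by (rule integral_FTC_Icc_real) (use cont in \<open>auto simp: p_def intro: tests_DERIV[OF assms]\<close>)
  moreover have "(\<lambda>x. deriv f x * indicator {p..s} x) = (\<lambda>x. indicator {..s} x * deriv f x)"
    using g(5) by (force simp: fun_eq_iff indicator_def p_def)
  moreover have "f p = 0" by (rule f(5)) (simp add: p_def)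
  ultimately show "(\<integral>x. indicator {..s} x * deriv f x \<partial>lborel) = f s" by simp
  have "(\<integral>x. deriv f x * indicator {s..q} x \<partial>lborel) = f q - f s"
    by (rule integral_FTC_Icc_real) (use cont in \<open>auto simp: q_def intro: tests_DERIV[OF assms]\<close>)
  moreover have "(\<lambda>x. deriv f x * indicator {s..q} x) = (\<lambda>x. indicator {s..} x * deriv f x)"
    using g(6) by (force simp: fun_eq_iff indicator_def q_def)
  moreover have "f q = 0" by (rule f(6)) (simp add: q_def)
  ultimately show "(\<integral>x. indicator {s..} x * deriv f x \<partial>lborel) = - f s" by simp
qed

text \<open>Vanishing mean is what makes the primitive return to zero to the right of the
  support.\<close>

lemma tests_antiderivative:
  assumes "f \<in> tests a b" "(\<integral>x. f x \<partial>lborel) = 0"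
  obtains F where "F \<in> tests a b" "deriv F = f"
proof -
  obtain l r where f: "smooth f" "a < l" "l < r" "r < b" "\<And>x. x < l \<Longrightarrow> f x = 0" "\<And>x. r < x \<Longrightarrow> f x = 0"
    using assms(1) by (rule testsE) blast
  \<comment> \<open>Starting one unit left of the support makes every x >= l an interior point of
    the interval of integration, so the fundamental theorem yields a two-sided derivative
    there.\<close>
  define F where "F = (\<lambda>x. integral {l - 1..x} f)"
  have int: "f integrable_on {s..t}" for s t
    by (intro integrable_continuous_real tests_continuous[OF assms(1)])
  have zl: "F x = 0" if "x < l" for x
  proof -
    have "F x = integral {l - 1..x} (\<lambda>x. 0)"
      unfolding F_def by (rule integral_cong, rule f(5)) (use that in simp)
    then show ?thesis by simp
  qed
  have D: "(F has_real_derivative f x) (at x)" for x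
  proof (cases "x < l")
    case True
    have "((\<lambda>x. 0) has_real_derivative f x) (at x)"
      using f(5)[OF True] by simp
    then show ?thesis
      by (rule has_field_derivative_transform_within_open[where S = "{..<l}"]) (use True in \<open>simp_all add: zl\<close>)
  next
    case False
    have "(F has_real_derivative f x) (at x within {l - 1..x + 1})"
      unfolding F_def
      by (rule integral_has_real_derivative[OF tests_continuous[OF assms(1)]]) (use False in simp)
    moreover have "at x within {l - 1..x + 1} = at x"
      using False by (intro at_within_Icc_at) auto
    ultimately show ?thesis by (simp only:)
  qed
  have zr: "F x = 0" if "x > r" for x
  proof -
    have s: "set_integrable lborel {l - 1..x} f"
      unfolding set_integrable_def
      by (rule borel_integrable_compact[OF compact_Icc tests_continuous[OF assms(1)]])
    have "F x = (LINT t:{l - 1..x}|lborel. f t)"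
      unfolding F_def by (rule set_borel_integral_eq_integral(2)[OF s, symmetric])
    also have "\<dots> = (\<integral>t. f t \<partial>lborel)"
      unfolding set_lebesgue_integral_def
    proof (rule Bochner_Integration.integral_cong)
      fix t
      have "f t = 0" if "t \<notin> {l - 1..x}"
        using f(5,6)[of t] f(3) \<open>r < x\<close> that by (cases "t < l") auto
      then show "indicator {l - 1..x} t *\<^sub>R f t = f t" by (auto simp: indicator_def)
    qed simp
    finally show ?thesis by (simp only: assms(2))
  qed
  have "F \<in> tests a b"
    by (rule testsI[OF smooth_antiderivative[OF D tests_smooth[OF assms(1)]] f(2-4)]) (simp_all add: zl zr)
  moreover have "deriv F = f" using DERIV_imp_deriv[OF D] by (rule ext)
  ultimately show ?thesis by (rule that)
qed

text \<open>Products are rich enough for testing: products of plateaus converge to indicators of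
  boxes, so an integrable function orthogonal to all products vanishes almost everywhere.\<close>

definition tensor :: "(real \<Rightarrow> real) \<Rightarrow> (real \<Rightarrow> real) \<Rightarrow> plane \<Rightarrow> real" where
  "tensor A B = (\<lambda>(x, y). A x * B y)"

lemma partial_tensor:
  assumes "smooth A" "smooth B"
  shows "partial_x (tensor A B) = tensor (deriv A) B" "partial_y (tensor A B) = tensor A (deriv B)"
  unfolding partial_x_def partial_y_def tensor_def
  by (auto simp: fun_eq_iff intro!: DERIV_imp_deriv derivative_eq_intros smooth_DERIV assms)

lemma Ck_tensor: "smooth A \<Longrightarrow> smooth B \<Longrightarrow> Ck k (tensor A B)"
proof (induction k arbitrary: A B)
  case 0
  have "continuous_on UNIV (\<lambda>p::plane. A (fst p) * B (snd p))"
    by (intro continuous_intros continuous_on_compose2[OF smooth_continuous[OF 0(1)]]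
        continuous_on_compose2[OF smooth_continuous[OF 0(2)]]) auto
  then show ?case by (simp add: tensor_def case_prod_unfold)
next
  case (Suc k)
  have "(tensor A B) differentiable (at p)" for p
  proof -
    have a: "(A has_derivative (*) (deriv A (fst p))) (at (fst p))"
      and b: "(B has_derivative (*) (deriv B (snd p))) (at (snd p))"
      using smooth_DERIV Suc.prems by (auto simp: has_field_derivative_def)
    note D = has_derivative_mult[OF
        has_derivative_compose[OF has_derivative_fst[OF has_derivative_ident], of A, OF a]
        has_derivative_compose[OF has_derivative_snd[OF has_derivative_ident], of B, OF b]]
    show ?thesis
      unfolding tensor_def case_prod_unfold by (rule differentiableI[OF D])
  qed
  then show ?case using Suc by (simp add: partial_tensor smooth_deriv)
qed

lemma classical_D_tensor:
  assumes "smooth A" "smooth B"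
  shows "classical_D (m, n) (tensor A B) = tensor ((deriv ^^ m) A) ((deriv ^^ n) B)"
proof -
  have s: "smooth ((deriv ^^ k) f)" if "smooth f" for k f
    using that by (induction k) (auto intro: smooth_deriv)
  have "(partial_y ^^ n) (tensor A B) = tensor A ((deriv ^^ n) B)"
    by (induction n) (use assms s in \<open>auto simp: partial_tensor\<close>)
  moreover have "(partial_x ^^ m) (tensor A C) = tensor ((deriv ^^ m) A) C" if "smooth C" for C
    by (induction m) (use assms that s in \<open>auto simp: partial_tensor\<close>)
  ultimately show ?thesis using assms s by (simp add: classical_D_def)
qed

lemma tensor_test_functions:
  assumes "A \<in> tests a b" "B \<in> tests c d"
  shows "tensor A B \<in> test_functions ({a<..<b} \<times> {c<..<d})"
proof -
  obtain l r where A: "smooth A" "a < l" "l < r" "r < b" "\<And>x. x < l \<Longrightarrow> A x = 0" "\<And>x. r < x \<Longrightarrow> A x = 0"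
    using assms(1) by (rule testsE) blast
  obtain l' r' where B: "smooth B" "c < l'" "l' < r'" "r' < d" "\<And>x. x < l' \<Longrightarrow> B x = 0" "\<And>x. r' < x \<Longrightarrow> B x = 0"
    using assms(2) by (rule testsE) blast
  have sup: "{p. tensor A B p \<noteq> 0} \<subseteq> {l..r} \<times> {l'..r'}"
    using A(5,6) B(5,6) by (auto simp: tensor_def) (meson not_le)+
  from sup have sub: "closure {p. tensor A B p \<noteq> 0} \<subseteq> {l..r} \<times> {l'..r'}"
    by (intro closure_minimal closed_Times) auto
  have "bounded {p. tensor A B p \<noteq> 0}"
    by (rule bounded_subset[OF _ sup]) (intro bounded_Times bounded_closed_interval)
  then have "compact (closure {p. tensor A B p \<noteq> 0})" by (simp add: compact_closure)
  moreover have "closure {p. tensor A B p \<noteq> 0} \<subseteq> {a<..<b} \<times> {c<..<d}"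
    using sub A B by fastforce
  ultimately show ?thesis
    using Ck_tensor tests_smooth assms by (auto simp: test_functions_def)
qed

section \<open>Functions with weak derivatives on a rectangle\<close>

lemma integrable_prod_plane:
  fixes f g :: "real \<Rightarrow> real"
  assumes f: "integrable lborel f" and g: "integrable lborel g"
  shows "integrable lborel (\<lambda>p. f (fst p) * g (snd p))"
    and "(\<integral>p. f (fst p) * g (snd p) \<partial>lborel) = (\<integral>x. f x \<partial>lborel) * (\<integral>y. g y \<partial>lborel)"
proof -
  have [measurable]: "f \<in> borel_measurable borel" "g \<in> borel_measurable borel"
    using f g by auto
  have i: "integrable (lborel \<Otimes>\<^sub>M lborel) (\<lambda>p. f (fst p) * g (snd p))"
  proof (rule lborel_pair.Fubini_integrable)
    show "integrable lborel (\<lambda>x. \<integral>y. norm (f (fst (x, y)) * g (snd (x, y))) \<partial>lborel)"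
      using f by (simp add: abs_mult)
  qed (use g in auto)
  then show "integrable lborel (\<lambda>p. f (fst p) * g (snd p))" by (simp add: lborel_prod)
  show "(\<integral>p. f (fst p) * g (snd p) \<partial>lborel) = (\<integral>x. f x \<partial>lborel) * (\<integral>y. g y \<partial>lborel)"
    using lborel_pair.integral_fst'[OF i] by (simp add: lborel_prod)
qed

lemma integrable_indicator_Ioo: "integrable lborel (indicator {l<..<r} :: real \<Rightarrow> real)"
  using emeasure_lborel_box_finite[of l r] by (intro integrable_real_indicator) (auto simp: box_real)

lemma fubini_plane:
  fixes f :: "plane \<Rightarrow> real"
  assumes f: "integrable lborel f"
  shows "AE x in lborel. integrable lborel (\<lambda>y. f (x, y))"
    and "integrable lborel (\<lambda>x. \<integral>y. f (x, y) \<partial>lborel)"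
    and "(\<integral>x. (\<integral>y. f (x, y) \<partial>lborel) \<partial>lborel) = (\<integral>p. f p \<partial>lborel)"
    and "AE y in lborel. integrable lborel (\<lambda>x. f (x, y))"
    and "integrable lborel (\<lambda>y. \<integral>x. f (x, y) \<partial>lborel)"
    and "(\<integral>y. (\<integral>x. f (x, y) \<partial>lborel) \<partial>lborel) = (\<integral>p. f p \<partial>lborel)"
proof -
  have f': "integrable (lborel \<Otimes>\<^sub>M lborel) f" using f by (simp add: lborel_prod)
  show "AE x in lborel. integrable lborel (\<lambda>y. f (x, y))"
    by (rule lborel_pair.AE_integrable_fst'[OF f'])
  show "integrable lborel (\<lambda>x. \<integral>y. f (x, y) \<partial>lborel)"
    by (rule lborel_pair.integrable_fst'[OF f'])
  show "(\<integral>x. (\<integral>y. f (x, y) \<partial>lborel) \<partial>lborel) = (\<integral>p. f p \<partial>lborel)"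
    using lborel_pair.integral_fst'[OF f'] by (simp add: lborel_prod)
  have f'': "integrable (lborel \<Otimes>\<^sub>M lborel) (\<lambda>(x, y). f (x, y))" using f' by simp
  show "AE y in lborel. integrable lborel (\<lambda>x. f (x, y))"
    using lborel_pair.AE_integrable_snd[OF f''] by simp
  show "integrable lborel (\<lambda>y. \<integral>x. f (x, y) \<partial>lborel)"
    using lborel_pair.integrable_snd[OF f''] by simp
  show "(\<integral>y. (\<integral>x. f (x, y) \<partial>lborel) \<partial>lborel) = (\<integral>p. f p \<partial>lborel)"
    using lborel_pair.integral_snd[OF f''] by (simp add: lborel_prod)
qed

lemma swap_plane:
  fixes f :: "plane \<Rightarrow> real"
  assumes f: "integrable lborel f"
  shows "integrable lborel (\<lambda>p. f (snd p, fst p))"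
    and "(\<integral>p. f (snd p, fst p) \<partial>lborel) = (\<integral>p. f p \<partial>lborel)"
proof -
  have f': "integrable (lborel \<Otimes>\<^sub>M lborel) f" using f by (simp add: lborel_prod)
  then show "integrable lborel (\<lambda>p. f (snd p, fst p))"
    using lborel_pair.integrable_product_swap[OF f'] by (simp add: lborel_prod case_prod_unfold)
  show "(\<integral>p. f (snd p, fst p) \<partial>lborel) = (\<integral>p. f p \<partial>lborel)"
    using lborel_pair.integral_product_swap[of f] f' by (simp add: lborel_prod case_prod_unfold)
qed

lemma AE_pair_plane:
  assumes "AE p in lborel. P (p::plane)"
  shows "AE x in lborel. AE y in lborel. P (x, y)" "AE y in lborel. AE x in lborel. P (x, y)"
proof -
  have *: "AE p in lborel \<Otimes>\<^sub>M lborel. P (p::plane)" using assms by (subst lborel_prod)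
  then show "AE x in lborel. AE y in lborel. P (x, y)" by (rule lborel_pair.AE_pair)
  have "AE p in distr (lborel \<Otimes>\<^sub>M lborel) (lborel \<Otimes>\<^sub>M lborel) (\<lambda>(x, y). (y, x)). P (p::plane)"
    using * lborel_pair.distr_pair_swap by metis
  then have "AE p in lborel \<Otimes>\<^sub>M lborel. P (snd p, fst p :: real)"
    by (drule_tac AE_distrD[rotated]) (auto simp: case_prod_unfold)
  then show "AE y in lborel. AE x in lborel. P (x, y)"
    using lborel_pair.AE_pair by fastforce
qed

lemma AE_swap_plane:
  assumes "AE p in lborel. P (p::plane)"
  shows "AE p in lborel. P (snd p, fst p)"
proof -
  have "AE p in distr (lborel \<Otimes>\<^sub>M lborel) (lborel \<Otimes>\<^sub>M lborel) (\<lambda>(x, y). (y, x)). P (p::plane)"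
    using assms lborel_pair.distr_pair_swap by (metis lborel_prod)
  then have "AE p in lborel \<Otimes>\<^sub>M lborel. P (snd p, fst p :: real)"
    by (drule_tac AE_distrD[rotated]) (auto simp: case_prod_unfold)
  then show ?thesis by (subst (asm) lborel_prod)
qed

section \<open>The fundamental lemma of the calculus of variations, tested with products\<close>

locale rectangle =
  fixes a b c d :: real
  assumes ab: "a < b" and cd: "c < d"
begin

definition Om :: "plane set" where "Om = {a<..<b} \<times> {c<..<d}"

text \<open>Functions live on the whole plane, are Borel measurable and vanish off the open
  rectangle. All integrals are then taken over \<open>lborel\<close>, where Fubini applies without
  restricting measures.\<close>

definition L1 :: "(plane \<Rightarrow> real) \<Rightarrow> bool" where
  "L1 f \<longleftrightarrow> integrable lborel f \<and> (\<forall>p. p \<notin> Om \<longrightarrow> f p = 0)"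

lemma Om_borel [measurable]: "Om \<in> sets borel"
  unfolding Om_def by (intro borel_open open_Times) auto

lemma L1_measurable: "L1 f \<Longrightarrow> f \<in> borel_measurable borel"
  by (auto simp: L1_def)

lemma tensor_measurable:
  assumes "A \<in> tests l r" "B \<in> tests l' r'" shows "tensor A B \<in> borel_measurable borel"
proof -
  have [measurable]: "A \<in> borel_measurable borel" "B \<in> borel_measurable borel"
    using assms by (auto intro: tests_borel)
  have "(\<lambda>p::plane. A (fst p) * B (snd p)) \<in> borel_measurable (borel \<Otimes>\<^sub>M borel)" by measurable
  then show ?thesis by (simp add: tensor_def case_prod_unfold borel_prod)
qed

lemma tensor_bounded:
  assumes "A \<in> tests l r" "B \<in> tests l' r'"
  obtains K where "\<And>p. \<bar>tensor A B p\<bar> \<le> K"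
proof -
  obtain K1 where "K1 > 0" "\<And>x. \<bar>A x\<bar> \<le> K1" using tests_bounded[OF assms(1)] by blast
  moreover obtain K2 where "K2 > 0" "\<And>x. \<bar>B x\<bar> \<le> K2" using tests_bounded[OF assms(2)] by blast
  ultimately have "\<bar>tensor A B p\<bar> \<le> K1 * K2" for p
    by (auto simp: tensor_def abs_mult case_prod_unfold intro!: mult_mono intro: less_imp_le)
  then show ?thesis by (rule that)
qed

lemma integrable_bounded_mult:
  fixes f g :: "'x \<Rightarrow> real"
  assumes f: "integrable M f" and g[measurable]: "g \<in> borel_measurable M" and K: "\<And>x. \<bar>g x\<bar> \<le> K"
  shows "integrable M (\<lambda>x. f x * g x)"
proof (rule Bochner_Integration.integrable_bound[of M "\<lambda>x. K * f x"])
  have [measurable]: "f \<in> borel_measurable M" using f by auto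
  show "(\<lambda>x. f x * g x) \<in> borel_measurable M" by measurable
  have "\<bar>f x * g x\<bar> \<le> \<bar>K * f x\<bar>" for x
  proof -
    have "\<bar>f x * g x\<bar> = \<bar>g x\<bar> * \<bar>f x\<bar>" by (simp add: abs_mult)
    also have "\<dots> \<le> K * \<bar>f x\<bar>" by (intro mult_right_mono K) simp
    also have "\<dots> \<le> \<bar>K * f x\<bar>" by (simp add: abs_mult mult_right_mono)
    finally show ?thesis .
  qed
  then show "AE x in M. norm (f x * g x) \<le> norm (K * f x)" by simp
qed (use f in auto)

lemma integrable_tensor:
  assumes "integrable lborel f" "A \<in> tests l r" "B \<in> tests l' r'"
  shows "integrable lborel (\<lambda>p. f p * tensor A B p)"
proof -
  obtain K where "\<And>p. \<bar>tensor A B p\<bar> \<le> K" using tensor_bounded assms(2,3) by blast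
  then show ?thesis
    by (intro integrable_bounded_mult[OF assms(1), where K = K])
      (use tensor_measurable[OF assms(2,3)] in auto)
qed

text \<open>The products of plateaus converge to the indicator of the box and are dominated by 1, so
  the vanishing integrals pass to the limit.\<close>

lemma L1_integral_open_box:
  assumes f: "L1 f" and test: "\<And>A B. A \<in> tests a b \<Longrightarrow> B \<in> tests c d \<Longrightarrow> (\<integral>p. f p * tensor A B p \<partial>lborel) = 0"
    and *: "a < l" "l < r" "r < b" "c < l'" "l' < r'" "r' < d"
  shows "(\<integral>p. f p * indicator ({l<..<r} \<times> {l'<..<r'}) p \<partial>lborel) = 0"
proof -
  define T where "T = (\<lambda>n. tensor (plateau l r n) (plateau l' r' n))"
  have t: "plateau l r n \<in> tests a b" "plateau l' r' n \<in> tests c d" for n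
    using * by (auto intro: plateau_tests)
  have [measurable]: "f \<in> borel_measurable borel" "\<And>n. T n \<in> borel_measurable borel"
    using L1_measurable[OF f] tensor_measurable[OF t] by (auto simp: T_def)
  have box: "{l<..<r} \<times> {l'<..<r'} \<in> sets (borel :: plane measure)"
    by (intro borel_open open_Times) auto
  have "(\<lambda>n. \<integral>p. f p * T n p \<partial>lborel) \<longlonglongrightarrow> (\<integral>p. f p * indicator ({l<..<r} \<times> {l'<..<r'}) p \<partial>lborel)"
  proof (rule integral_dominated_convergence[where w = "\<lambda>p. \<bar>f p\<bar>"])
    show "integrable lborel (\<lambda>p. \<bar>f p\<bar>)" using f by (auto simp: L1_def)
    show "AE p in lborel. (\<lambda>n. f p * T n p) \<longlonglongrightarrow> f p * indicator ({l<..<r} \<times> {l'<..<r'}) p"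
    proof (rule AE_I2)
      fix p :: plane
      obtain x y where p: "p = (x, y)" by fastforce
      have "(\<lambda>n. f p * (plateau l r n x * plateau l' r' n y)) \<longlonglongrightarrow>
          f p * (indicator {l<..<r} x * indicator {l'<..<r'} y)"
        by (intro tendsto_intros plateau_tendsto)
      then show "(\<lambda>n. f p * T n p) \<longlonglongrightarrow> f p * indicator ({l<..<r} \<times> {l'<..<r'}) p"
        by (simp add: T_def tensor_def p indicator_times)
    qed
    show "AE p in lborel. norm (f p * T n p) \<le> \<bar>f p\<bar>" for n
    proof (rule AE_I2)
      fix p :: plane
      have "\<bar>T n p\<bar> \<le> 1"
        using plateau_bounds by (auto simp: T_def tensor_def case_prod_unfold abs_mult intro!: mult_le_one)
      then show "norm (f p * T n p) \<le> \<bar>f p\<bar>" by (simp add: abs_mult mult_left_le)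
    qed
  qed (use box in measurable)
  moreover have "(\<integral>p. f p * T n p \<partial>lborel) = 0" for n
    unfolding T_def by (intro test t)
  ultimately show ?thesis by (simp add: LIMSEQ_const_iff)
qed

lemma One_plane: "(One :: plane) = (1, 1)"
  by (simp add: sum_Basis_prod_eq)

text \<open>By Lebesgue differentiation almost every value is a limit of averages over small
  squares, and each of these averages is zero by the box lemma.\<close>

proposition fundamental_lemma:
  assumes f: "L1 f" and test: "\<And>A B. A \<in> tests a b \<Longrightarrow> B \<in> tests c d \<Longrightarrow> (\<integral>p. f p * tensor A B p \<partial>lborel) = 0"
  shows "AE p in lborel. f p = 0"
proof -
  have int: "set_integrable lborel S f" if "S \<in> sets borel" for S
    unfolding set_integrable_def by (rule integrable_mult_indicator) (use f that in \<open>simp_all add: L1_def\<close>)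
  have "f integrable_on cbox u v" for u v
    by (rule set_borel_integral_eq_integral(1)[OF int]) auto
  then obtain N where N: "negligible N" "\<And>x e. \<lbrakk>x \<notin> N; 0 < e\<rbrakk> \<Longrightarrow>
      \<exists>d>0. \<forall>h. 0 < h \<and> h < d \<longrightarrow> norm (integral (cbox x (x + h *\<^sub>R One)) f /\<^sub>R h ^ DIM(plane) - f x) < e"
    using integrable_ccontinuous_explicit[of f] by blast
  have z: "f p = 0" if pN: "p \<notin> N" for p
  proof (rule ccontr)
    assume nz: "f p \<noteq> 0"
    then have "p \<in> Om" using f unfolding L1_def by blast
    then obtain x y where p: "p = (x, y)" "a < x" "x < b" "c < y" "y < d" by (auto simp: Om_def)
    obtain e where e: "e > 0" "\<And>h. 0 < h \<Longrightarrow> h < e \<Longrightarrow>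
        norm (integral (cbox p (p + h *\<^sub>R One)) f /\<^sub>R h ^ DIM(plane) - f p) < \<bar>f p\<bar>"
      using N(2)[OF pN, of "\<bar>f p\<bar>"] nz by (metis zero_less_abs_iff)
    \<comment> \<open>Half the minimum: the square of side h at (x, y) lies in the rectangle, away
      from its boundary, and h is below the threshold for the averages.\<close>
    define h where "h = min e (min (b - x) (d - y)) / 2"
    have "min e (min (b - x) (d - y)) \<le> e" "min e (min (b - x) (d - y)) \<le> b - x"
      "min e (min (b - x) (d - y)) \<le> d - y" "0 < min e (min (b - x) (d - y))"
      using e(1) p by auto
    then have h: "0 < h" "h < e" "x + h < b" "y + h < d"
      unfolding h_def by linarith+
    have bx: "box p (p + h *\<^sub>R One) = {x<..<x + h} \<times> {y<..<y + h}"
      by (auto simp: p One_plane box_prod box_real)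
    have "integral (cbox p (p + h *\<^sub>R One)) f = integral (box p (p + h *\<^sub>R One)) f"
      by (rule integral_open_interval[symmetric])
    also have "\<dots> = (LINT q:box p (p + h *\<^sub>R One)|lborel. f q)"
      by (rule set_borel_integral_eq_integral(2)[OF int, symmetric]) auto
    also have "\<dots> = (\<integral>q. f q * indicator ({x<..<x + h} \<times> {y<..<y + h}) q \<partial>lborel)"
      unfolding set_lebesgue_integral_def bx by (simp add: mult.commute)
    also have "\<dots> = 0"
      using p h by (intro L1_integral_open_box[OF f test]) auto
    finally show False using e(2)[OF h(1,2)] by simp
  qed
  have "N \<in> null_sets lebesgue" using N(1) negligible_iff_null_sets by blast
  then have "AE p in lebesgue. p \<notin> N" by (rule AE_not_in)
  then have "AE p in lebesgue. f p = 0" by (rule AE_mp) (use z in auto)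
  then show ?thesis by (simp add: AE_completion_iff)
qed

text \<open>Tested with products only. This follows from the general weak derivative and is the form
  in which Fubini separates the variables.\<close>

definition weak_x :: "(plane \<Rightarrow> real) \<Rightarrow> (plane \<Rightarrow> real) \<Rightarrow> bool" where
  "weak_x f g \<longleftrightarrow> (\<forall>A\<in>tests a b. \<forall>B\<in>tests c d.
     (\<integral>p. f p * tensor (deriv A) B p \<partial>lborel) = - (\<integral>p. g p * tensor A B p \<partial>lborel))"

definition weak_y :: "(plane \<Rightarrow> real) \<Rightarrow> (plane \<Rightarrow> real) \<Rightarrow> bool" where
  "weak_y f g \<longleftrightarrow> (\<forall>A\<in>tests a b. \<forall>B\<in>tests c d.
     (\<integral>p. f p * tensor A (deriv B) p \<partial>lborel) = - (\<integral>p. g p * tensor A B p \<partial>lborel))"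

end

text \<open>Integration starts at -infinity instead of at the left side: the integrands vanish off
  the rectangle, so both agree, and the primitive does not depend on the rectangle.\<close>

definition prim :: "(real \<Rightarrow> real) \<Rightarrow> real \<Rightarrow> real" where
  "prim g x = (\<integral>s. indicator {..x} s * g s \<partial>lborel)"

lemma prim_bound:
  assumes "integrable lborel g" shows "\<bar>prim g x\<bar> \<le> (\<integral>s. \<bar>g s\<bar> \<partial>lborel)"
proof -
  have "\<bar>prim g x\<bar> \<le> (\<integral>s. \<bar>indicator {..x} s * g s\<bar> \<partial>lborel)"
    unfolding prim_def by (rule integral_abs_bound)
  also have "\<dots> \<le> (\<integral>s. \<bar>g s\<bar> \<partial>lborel)"
  proof (intro integral_mono integrable_abs)
    show "integrable lborel (\<lambda>s. indicator {..x} s * g s)"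
      using integrable_mult_indicator[OF _ assms, of "{..x}"] by simp
  qed (use assms in \<open>auto simp: indicator_def\<close>)
  finally show ?thesis .
qed

lemma prim_measurable:
  fixes g :: "plane \<Rightarrow> real"
  assumes [measurable]: "g \<in> borel_measurable borel"
  shows "(\<lambda>p. prim (\<lambda>s. g (s, snd p)) (fst p)) \<in> borel_measurable borel"
proof -
  have [measurable]: "g \<in> borel_measurable (borel \<Otimes>\<^sub>M borel)" by (simp add: borel_prod)
  have "(\<lambda>(p::plane, s). (if s \<le> fst p then 1 else 0) * g (s, snd p)) \<in>
      borel_measurable ((borel \<Otimes>\<^sub>M borel) \<Otimes>\<^sub>M lborel)"
    by measurable
  then have "(\<lambda>(p::plane, s). (if s \<le> fst p then 1 else 0) * g (s, snd p)) \<in> borel_measurable (borel \<Otimes>\<^sub>M lborel)"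
    by (simp add: borel_prod)
  then have "(\<lambda>p::plane. \<integral>s. (if s \<le> fst p then 1 else 0) * g (s, snd p) \<partial>lborel) \<in> borel_measurable borel"
    by (rule lborel.borel_measurable_lebesgue_integral)
  moreover have "(if s \<le> x then 1 else 0) = (indicator {..x} s :: real)" for s x :: real
    by (simp add: indicator_def)
  ultimately show ?thesis unfolding prim_def by simp
qed

text \<open>Fubini over the half plane s <= x: the inner integral of \<open>deriv A\<close> over x
  >= s is \<open>- A s\<close>. No regularity of \<open>g\<close> enters.\<close>

lemma prim_weak_derivative:
  assumes g: "integrable lborel g" and A: "A \<in> tests a b"
  shows "(\<integral>x. deriv A x * prim g x \<partial>lborel) = - (\<integral>s. g s * A s \<partial>lborel)"
proof -
  have A': "integrable lborel (deriv A)" by (rule tests_integrable[OF tests_deriv[OF A]])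
  have [measurable]: "g \<in> borel_measurable borel" "deriv A \<in> borel_measurable borel"
    using g A' by auto
  define h :: "plane \<Rightarrow> real" where "h = (\<lambda>p. deriv A (fst p) * g (snd p) * (if snd p \<le> fst p then 1 else 0))"
  have h: "integrable lborel h"
    unfolding h_def
  proof (rule Bochner_Integration.integrable_bound[OF integrable_prod_plane(1)[OF A' g]])
    have "(\<lambda>p. deriv A (fst p) * g (snd p) * (if snd p \<le> fst p then 1 else 0)) \<in> borel_measurable (borel \<Otimes>\<^sub>M borel)"
      by measurable
    then show "(\<lambda>p. deriv A (fst p) * g (snd p) * (if snd p \<le> fst p then 1 else 0)) \<in> borel_measurable lborel"
      by (simp add: borel_prod)
  qed auto
  have "(\<integral>x. deriv A x * prim g x \<partial>lborel) = (\<integral>x. (\<integral>s. h (x, s) \<partial>lborel) \<partial>lborel)"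
  proof (rule Bochner_Integration.integral_cong[OF refl])
    fix x
    have "(\<integral>s. h (x, s) \<partial>lborel) = (\<integral>s. deriv A x * (indicator {..x} s * g s) \<partial>lborel)"
      by (rule Bochner_Integration.integral_cong) (auto simp: h_def indicator_def)
    then show "deriv A x * prim g x = (\<integral>s. h (x, s) \<partial>lborel)" by (simp add: prim_def)
  qed
  also have "\<dots> = (\<integral>s. (\<integral>x. h (x, s) \<partial>lborel) \<partial>lborel)"
    using fubini_plane(3,6)[OF h] by simp
  also have "\<dots> = (\<integral>s. - (g s * A s) \<partial>lborel)"
  proof (rule Bochner_Integration.integral_cong[OF refl])
    fix s
    have "(\<integral>x. h (x, s) \<partial>lborel) = (\<integral>x. g s * (indicator {s..} x * deriv A x) \<partial>lborel)"
      by (rule Bochner_Integration.integral_cong) (auto simp: h_def indicator_def)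
    then show "(\<integral>x. h (x, s) \<partial>lborel) = - (g s * A s)" by (simp add: tests_integral_deriv_0[OF A])
  qed
  finally show ?thesis by simp
qed

section \<open>Representation of a function through its weak x-derivative\<close>

context rectangle begin

text \<open>On the line at height y the primitive is bounded by the integral of |g| over that line.
  This bound is integrable in y and independent of x, and the strip has finite width.\<close>

lemma L1_prim:
  assumes g: "L1 g"
  shows "L1 (\<lambda>p. indicator Om p * prim (\<lambda>s. g (s, snd p)) (fst p))"
  unfolding L1_def
proof
  have [measurable]: "g \<in> borel_measurable borel" by (rule L1_measurable[OF g])
  define \<gamma> where "\<gamma> = (\<lambda>y. \<integral>s. \<bar>g (s, y)\<bar> \<partial>lborel)"
  have \<gamma>: "integrable lborel \<gamma>"
    using fubini_plane(5)[of "\<lambda>p. \<bar>g p\<bar>"] g by (simp add: L1_def \<gamma>_def)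
  have ind: "integrable lborel (indicator {a<..<b} :: real \<Rightarrow> real)" by (rule integrable_indicator_Ioo)
  show "integrable lborel (\<lambda>p. indicator Om p * prim (\<lambda>s. g (s, snd p)) (fst p))"
  proof (rule Bochner_Integration.integrable_bound[OF integrable_prod_plane(1)[OF ind \<gamma>]])
    show "(\<lambda>p. indicator Om p * prim (\<lambda>s. g (s, snd p)) (fst p)) \<in> borel_measurable lborel"
      using prim_measurable[of g] by simp
    have "AE y in lborel. integrable lborel (\<lambda>s. g (s, y))"
      using fubini_plane(4)[of g] g by (simp add: L1_def)
    then have "AE y in lborel. \<forall>x. \<bar>prim (\<lambda>s. g (s, y)) x\<bar> \<le> \<gamma> y"
      by (rule AE_mp) (auto simp: \<gamma>_def intro!: AE_I2 prim_bound)
    then have "AE y in lborel. \<bar>prim (\<lambda>s. g (s, y)) x\<bar> \<le> \<gamma> y" for x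
      by (rule eventually_mono) blast
    then have "AE x in lborel. AE y in lborel. \<bar>prim (\<lambda>s. g (s, y)) x\<bar> \<le> \<gamma> y"
      by (rule AE_I2)
    moreover have "{p \<in> space (lborel \<Otimes>\<^sub>M lborel). \<bar>prim (\<lambda>s. g (s, snd p)) (fst p)\<bar> \<le> \<gamma> (snd p)} \<in> sets (lborel \<Otimes>\<^sub>M lborel)"
    proof -
      have [measurable]: "\<gamma> \<in> borel_measurable borel" using \<gamma> by auto
      have [measurable]: "(\<lambda>p. prim (\<lambda>s. g (s, snd p)) (fst p)) \<in> borel_measurable borel"
        by (rule prim_measurable) measurable
      have "(\<lambda>p. \<gamma> (snd p)) \<in> borel_measurable (borel \<Otimes>\<^sub>M borel :: plane measure)" by measurable
      then have [measurable]: "(\<lambda>p::plane. \<gamma> (snd p)) \<in> borel_measurable borel" by (simp add: borel_prod)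
      have "{p \<in> space borel. \<bar>prim (\<lambda>s. g (s, snd p)) (fst p)\<bar> \<le> \<gamma> (snd p)} \<in> sets borel"
        by (intro borel_measurable_le borel_measurable_abs) measurable
      then show ?thesis unfolding lborel_prod by simp
    qed
    ultimately have "AE p in lborel \<Otimes>\<^sub>M lborel. \<bar>prim (\<lambda>s. g (s, snd p)) (fst p)\<bar> \<le> \<gamma> (snd p)"
      by (intro lborel_pair.AE_pair_measure) auto
    then have "AE p in lborel. \<bar>prim (\<lambda>s. g (s, snd p)) (fst p)\<bar> \<le> \<gamma> (snd p)"
      by (subst (asm) lborel_prod)
    then show "AE p in lborel. norm (indicator Om p * prim (\<lambda>s. g (s, snd p)) (fst p)) \<le>
        norm (indicator {a<..<b} (fst p) * \<gamma> (snd p))"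
      by (rule AE_mp) (auto simp: Om_def indicator_def intro!: AE_I2)
  qed
qed auto

lemma weak_x_prim:
  assumes g: "L1 g"
  shows "weak_x (\<lambda>p. indicator Om p * prim (\<lambda>s. g (s, snd p)) (fst p)) g"
  unfolding weak_x_def
proof (intro ballI)
  fix A B assume A: "A \<in> tests a b" and B: "B \<in> tests c d"
  let ?P = "\<lambda>p. indicator Om p * prim (\<lambda>s. g (s, snd p)) (fst p)"
  have [measurable]: "g \<in> borel_measurable borel" "A \<in> borel_measurable borel" "B \<in> borel_measurable borel"
    "deriv A \<in> borel_measurable borel"
    using L1_measurable[OF g] A B tests_deriv[OF A] by (auto intro: tests_borel)
  have gi: "integrable lborel g" using g by (simp add: L1_def)
  have i1: "integrable lborel (\<lambda>p. ?P p * tensor (deriv A) B p)"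
    using L1_prim[OF g] A B by (intro integrable_tensor) (auto simp: L1_def intro: tests_deriv)
  have i2: "integrable lborel (\<lambda>p. g p * tensor A B p)"
    by (rule integrable_tensor[OF gi A B])
  have "(\<integral>p. ?P p * tensor (deriv A) B p \<partial>lborel) = (\<integral>y. (\<integral>x. ?P (x, y) * tensor (deriv A) B (x, y) \<partial>lborel) \<partial>lborel)"
    by (rule fubini_plane(6)[OF i1, symmetric])
  also have "\<dots> = (\<integral>y. - (\<integral>x. g (x, y) * tensor A B (x, y) \<partial>lborel) \<partial>lborel)"
  proof (rule integral_cong_AE)
    show "(\<lambda>y. \<integral>x. ?P (x, y) * tensor (deriv A) B (x, y) \<partial>lborel) \<in> borel_measurable lborel"
      using fubini_plane(5)[OF i1] by (rule borel_measurable_integrable)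
    show "(\<lambda>y. - (\<integral>x. g (x, y) * tensor A B (x, y) \<partial>lborel)) \<in> borel_measurable lborel"
      using fubini_plane(5)[OF i2] by (intro borel_measurable_uminus borel_measurable_integrable)
    show "AE y in lborel. (\<integral>x. ?P (x, y) * tensor (deriv A) B (x, y) \<partial>lborel) =
        - (\<integral>x. g (x, y) * tensor A B (x, y) \<partial>lborel)"
      using fubini_plane(4)[OF gi]
    proof (rule AE_mp, intro AE_I2 impI)
      fix y assume y: "integrable lborel (\<lambda>x. g (x, y))"
      have "(\<integral>x. ?P (x, y) * tensor (deriv A) B (x, y) \<partial>lborel) =
          (\<integral>x. B y * (deriv A x * prim (\<lambda>s. g (s, y)) x) \<partial>lborel)"
      proof (rule Bochner_Integration.integral_cong[OF refl])
        fix x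
        show "?P (x, y) * tensor (deriv A) B (x, y) = B y * (deriv A x * prim (\<lambda>s. g (s, y)) x)"
        proof (cases "(x, y) \<in> Om")
          case False
          then have "deriv A x = 0 \<or> B y = 0"
            using tests_eq_0[OF B] tests_eq_0[OF tests_deriv[OF A]] by (auto simp: Om_def)
          then show ?thesis by (auto simp: tensor_def)
        qed (simp add: tensor_def)
      qed
      also have "\<dots> = B y * (- (\<integral>s. g (s, y) * A s \<partial>lborel))"
        by (simp add: prim_weak_derivative[OF y A])
      also have "\<dots> = - (\<integral>x. g (x, y) * tensor A B (x, y) \<partial>lborel)"
        by (simp add: tensor_def mult.assoc[symmetric])
      finally show "(\<integral>x. ?P (x, y) * tensor (deriv A) B (x, y) \<partial>lborel) =
        - (\<integral>x. g (x, y) * tensor A B (x, y) \<partial>lborel)" .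
    qed
  qed
  also have "\<dots> = - (\<integral>p. g p * tensor A B p \<partial>lborel)"
    using fubini_plane(6)[OF i2] by simp
  finally show "(\<integral>p. ?P p * tensor (deriv A) B p \<partial>lborel) = - (\<integral>p. g p * tensor A B p \<partial>lborel)" .
qed

text \<open>The du Bois-Reymond argument with y as a parameter. Fix a bump \<beta> in x with nonzero
  integral. Any test function \<eta> minus a suitable multiple of \<beta> has mean zero, hence is
  the derivative of a test function, to which w is orthogonal. So w acts on \<eta> through the
  integral of \<eta> alone, with the \<beta>-weighted mean of w over the line as factor.\<close>

lemma weak_x_0_imp:
  assumes w: "L1 w" and weak: "weak_x w (\<lambda>p. 0)"
  obtains m where "integrable lborel m" "AE p in lborel. p \<in> Om \<longrightarrow> w p = m (snd p)"
proof -
  have wi: "integrable lborel w" using w by (simp add: L1_def)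
  define l r where "l = a + (b - a) / 3" and "r = a + 2 * (b - a) / 3"
  have lr: "a < l" "l < r" "r < b" using ab by (auto simp: l_def r_def field_simps)
  define \<beta> where "\<beta> = bump l r"
  have \<beta>: "\<beta> \<in> tests a b" unfolding \<beta>_def by (rule bump_tests[OF lr])
  have \<beta>i: "integrable lborel \<beta>" by (rule tests_integrable[OF \<beta>])
  have \<beta>pos: "(\<integral>x. \<beta> x \<partial>lborel) \<noteq> 0"
  proof
    assume 0: "(\<integral>x. \<beta> x \<partial>lborel) = 0"
    then have "AE x in lborel. \<beta> x = 0"
      using integral_nonneg_eq_0_iff_AE[OF \<beta>i] by (simp add: \<beta>_def bump_nonneg)
    then have "AE x in lborel. x \<notin> {l<..<r}"
    proof (rule AE_mp, intro AE_I2 impI)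
      fix x assume "\<beta> x = 0"
      then show "x \<notin> {l<..<r}" using bump_pos_iff[of l r x] by (simp add: \<beta>_def)
    qed
    then have "emeasure lborel {l<..<r} = 0"
      by (subst (asm) AE_iff_measurable[of "{l<..<r}"]) auto
    then show False using lr by simp
  qed
  \<comment> \<open>The multiple of \<beta> with the same integral as the given function.\<close>
  define \<kappa> where "\<kappa> f = (\<integral>x. f x \<partial>lborel) / (\<integral>x. \<beta> x \<partial>lborel)" for f :: "real \<Rightarrow> real"
  define m where "m y = (\<integral>x. w (x, y) * \<beta> x \<partial>lborel) / (\<integral>x. \<beta> x \<partial>lborel)" for y
  obtain K where K: "\<And>x. \<bar>\<beta> x\<bar> \<le> K" using tests_bounded[OF \<beta>] by blast
  have [measurable]: "\<beta> \<in> borel_measurable borel" by (rule tests_borel[OF \<beta>])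
  have "(\<lambda>p. \<beta> (fst p)) \<in> borel_measurable (borel \<Otimes>\<^sub>M borel :: plane measure)" by measurable
  then have [measurable]: "(\<lambda>p::plane. \<beta> (fst p)) \<in> borel_measurable borel" by (simp add: borel_prod)
  have w\<beta>: "integrable lborel (\<lambda>p. w p * \<beta> (fst p))"
    by (rule integrable_bounded_mult[OF wi _ K]) auto
  have m: "integrable lborel m"
    unfolding m_def using fubini_plane(5)[OF w\<beta>] by simp
  have ind: "integrable lborel (indicator {a<..<b} :: real \<Rightarrow> real)" by (rule integrable_indicator_Ioo)
  \<comment> \<open>Cut off in y so that the difference \<open>f\<close> below vanishes off the
    rectangle and the fundamental lemma applies.\<close>
  define m' where "m' y = indicator {c<..<d} y * m y" for y
  have m': "integrable lborel m'"
    unfolding m'_def using integrable_mult_indicator[OF _ m, of "{c<..<d}"] by simp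
  define f where "f = (\<lambda>p. w p - indicator {a<..<b} (fst p) * m' (snd p))"
  have Lf: "L1 f"
    unfolding f_def L1_def using w integrable_prod_plane(1)[OF ind m'] wi
    by (auto simp: L1_def Om_def m'_def indicator_def)
  have "AE p in lborel. f p = 0"
  proof (rule fundamental_lemma[OF Lf])
    fix \<eta> B assume \<eta>: "\<eta> \<in> tests a b" and B: "B \<in> tests c d"
    have [measurable]: "\<eta> \<in> borel_measurable borel" "B \<in> borel_measurable borel"
      using \<eta> B by (auto intro: tests_borel)
    obtain KB where KB: "\<And>x. \<bar>B x\<bar> \<le> KB" using tests_bounded[OF B] by blast
    obtain A where A: "A \<in> tests a b" "deriv A = (\<lambda>x. \<eta> x + (- \<kappa> \<eta>) * \<beta> x)"
    proof (rule tests_antiderivative[OF tests_lincomb[OF \<eta> \<beta>, of "- \<kappa> \<eta>"]])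
      show "(\<integral>x. \<eta> x + - \<kappa> \<eta> * \<beta> x \<partial>lborel) = 0"
        using \<beta>i tests_integrable[OF \<eta>] \<beta>pos by (simp add: \<kappa>_def)
    qed (rule that)
    have "0 = (\<integral>p. w p * tensor (deriv A) B p \<partial>lborel)"
      using weak A(1) B by (simp add: weak_x_def)
    also have "\<dots> = (\<integral>p. w p * tensor \<eta> B p - \<kappa> \<eta> * (w p * tensor \<beta> B p) \<partial>lborel)"
      by (rule Bochner_Integration.integral_cong) (auto simp: A tensor_def algebra_simps)
    also have "\<dots> = (\<integral>p. w p * tensor \<eta> B p \<partial>lborel) - \<kappa> \<eta> * (\<integral>p. w p * tensor \<beta> B p \<partial>lborel)"
      using integrable_tensor[OF wi \<eta> B] integrable_tensor[OF wi \<beta> B] by simp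
    also have "(\<integral>p. w p * tensor \<beta> B p \<partial>lborel) = (\<integral>y. (\<integral>x. \<beta> x \<partial>lborel) * (m' y * B y) \<partial>lborel)"
    proof -
      have "(\<integral>p. w p * tensor \<beta> B p \<partial>lborel) = (\<integral>y. (\<integral>x. w (x, y) * tensor \<beta> B (x, y) \<partial>lborel) \<partial>lborel)"
        by (rule fubini_plane(6)[OF integrable_tensor[OF wi \<beta> B], symmetric])
      also have "\<dots> = (\<integral>y. (\<integral>x. \<beta> x \<partial>lborel) * (m' y * B y) \<partial>lborel)"
      proof (rule Bochner_Integration.integral_cong[OF refl])
        fix y
        have "(\<integral>x. w (x, y) * tensor \<beta> B (x, y) \<partial>lborel) = (\<integral>x. w (x, y) * \<beta> x \<partial>lborel) * B y"
          by (simp add: tensor_def mult.assoc[symmetric])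
        also have "\<dots> = (\<integral>x. \<beta> x \<partial>lborel) * (m' y * B y)"
          using \<beta>pos tests_eq_0[OF B, of y] by (auto simp: m'_def m_def indicator_def)
        finally show "(\<integral>x. w (x, y) * tensor \<beta> B (x, y) \<partial>lborel) = (\<integral>x. \<beta> x \<partial>lborel) * (m' y * B y)" .
      qed
      finally show ?thesis .
    qed
    also have "\<kappa> \<eta> * \<dots> = (\<integral>x. \<eta> x \<partial>lborel) * (\<integral>y. m' y * B y \<partial>lborel)"
      using \<beta>pos by (simp add: \<kappa>_def)
    also have "\<dots> = (\<integral>p. \<eta> (fst p) * (m' (snd p) * B (snd p)) \<partial>lborel)"
      by (rule integrable_prod_plane(2)[symmetric, OF tests_integrable[OF \<eta>] integrable_bounded_mult[OF m' _ KB]]) auto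
    also have "\<dots> = (\<integral>p. indicator {a<..<b} (fst p) * m' (snd p) * tensor \<eta> B p \<partial>lborel)"
      by (rule Bochner_Integration.integral_cong)
        (auto simp: tensor_def indicator_def tests_eq_0[OF \<eta>])
    finally have "(\<integral>p. w p * tensor \<eta> B p \<partial>lborel) =
        (\<integral>p. indicator {a<..<b} (fst p) * m' (snd p) * tensor \<eta> B p \<partial>lborel)" by simp
    then show "(\<integral>p. f p * tensor \<eta> B p \<partial>lborel) = 0"
      unfolding f_def left_diff_distrib
      using integrable_tensor[OF wi \<eta> B] integrable_tensor[OF integrable_prod_plane(1)[OF ind m'] \<eta> B]
      by simp
  qed
  then have "AE p in lborel. p \<in> Om \<longrightarrow> w p = m' (snd p)"
    by (rule AE_mp) (auto simp: f_def Om_def intro!: AE_I2)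
  then show ?thesis using m' that by blast
qed

text \<open>The primitive of g along horizontal lines has weak x-derivative g, so subtracting it
  from f leaves a function whose weak x-derivative is zero.\<close>

proposition weak_x_representation:
  assumes f: "L1 f" and g: "L1 g" and weak: "weak_x f g"
  obtains m where "integrable lborel m"
    "AE p in lborel. p \<in> Om \<longrightarrow> f p = m (snd p) + prim (\<lambda>s. g (s, snd p)) (fst p)"
proof -
  let ?P = "\<lambda>p. indicator Om p * prim (\<lambda>s. g (s, snd p)) (fst p)"
  have P: "L1 ?P" by (rule L1_prim[OF g])
  have L: "L1 (\<lambda>p. f p - ?P p)" using f P by (auto simp: L1_def)
  have "weak_x (\<lambda>p. f p - ?P p) (\<lambda>p. 0)"
    unfolding weak_x_def
  proof (intro ballI)
    fix A B assume A: "A \<in> tests a b" and B: "B \<in> tests c d"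
    have "(\<integral>p. (f p - ?P p) * tensor (deriv A) B p \<partial>lborel) =
        (\<integral>p. f p * tensor (deriv A) B p \<partial>lborel) - (\<integral>p. ?P p * tensor (deriv A) B p \<partial>lborel)"
      unfolding left_diff_distrib using f P A B
      by (intro Bochner_Integration.integral_diff integrable_tensor tests_deriv) (auto simp: L1_def)
    also have "\<dots> = 0"
      using weak weak_x_prim[OF g] A B by (simp add: weak_x_def)
    finally show "(\<integral>p. (f p - ?P p) * tensor (deriv A) B p \<partial>lborel) = - (\<integral>p. 0 * tensor A B p \<partial>lborel)"
      by simp
  qed
  from weak_x_0_imp[OF L this] obtain m where m: "integrable lborel m"
    "AE p in lborel. p \<in> Om \<longrightarrow> f p - ?P p = m (snd p)" by blast
  have "AE p in lborel. p \<in> Om \<longrightarrow> f p = m (snd p) + prim (\<lambda>s. g (s, snd p)) (fst p)"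
    using m(2) by (rule AE_mp) (auto intro!: AE_I2)
  then show ?thesis using m(1) that by blast
qed

end

section \<open>Exchange of the coordinates\<close>

context rectangle begin

text \<open>The rectangle with exchanged sides is again an instance of the locale. In this way the
  representation, the difference bounds and differentiability in y are inherited from those in
  x.\<close>

lemma rectangle_swap: "rectangle c d a b"
  using ab cd by (simp add: rectangle_def)

lemma Om_swap: "rectangle.Om c d a b = {p. (snd p, fst p) \<in> Om}"
  by (auto simp: Om_def rectangle.Om_def[OF rectangle_swap])

lemma L1_swap: "L1 f \<Longrightarrow> rectangle.L1 c d a b (\<lambda>p. f (snd p, fst p))"
  using swap_plane(1)[of f]
  by (simp add: L1_def rectangle.L1_def[OF rectangle_swap] Om_swap)

lemma weak_y_swap:
  assumes f: "L1 f" and g: "L1 g" and w: "weak_y f g"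
  shows "rectangle.weak_x c d a b (\<lambda>p. f (snd p, fst p)) (\<lambda>p. g (snd p, fst p))"
  unfolding rectangle.weak_x_def[OF rectangle_swap]
proof (intro ballI)
  fix B A assume B: "B \<in> tests c d" and A: "A \<in> tests a b"
  have t: "tensor X Y p = tensor Y X (snd p, fst p)" for X Y p
    by (simp add: tensor_def case_prod_unfold)
  have 1: "integrable lborel (\<lambda>p. f p * tensor A (deriv B) p)"
    using f A B by (intro integrable_tensor) (auto simp: L1_def intro: tests_deriv)
  have 2: "integrable lborel (\<lambda>p. g p * tensor A B p)"
    using g A B by (intro integrable_tensor) (auto simp: L1_def)
  have "(\<integral>p. f p * tensor A (deriv B) p \<partial>lborel) = - (\<integral>p. g p * tensor A B p \<partial>lborel)"
    using w A B by (simp add: weak_y_def)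
  then show "(\<integral>p. f (snd p, fst p) * tensor (deriv B) A p \<partial>lborel) =
      - (\<integral>p. g (snd p, fst p) * tensor B A p \<partial>lborel)"
    using swap_plane(2)[OF 1] swap_plane(2)[OF 2] by (simp add: t[of "deriv B" A] t[of B A])
qed

lemma weak_x_swap:
  assumes f: "L1 f" and g: "L1 g" and w: "weak_x f g"
  shows "rectangle.weak_y c d a b (\<lambda>p. f (snd p, fst p)) (\<lambda>p. g (snd p, fst p))"
  unfolding rectangle.weak_y_def[OF rectangle_swap]
proof (intro ballI)
  fix B A assume B: "B \<in> tests c d" and A: "A \<in> tests a b"
  have t: "tensor X Y p = tensor Y X (snd p, fst p)" for X Y p
    by (simp add: tensor_def case_prod_unfold)
  have 1: "integrable lborel (\<lambda>p. f p * tensor (deriv A) B p)"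
    using f A B by (intro integrable_tensor) (auto simp: L1_def intro: tests_deriv)
  have 2: "integrable lborel (\<lambda>p. g p * tensor A B p)"
    using g A B by (intro integrable_tensor) (auto simp: L1_def)
  have "(\<integral>p. f p * tensor (deriv A) B p \<partial>lborel) = - (\<integral>p. g p * tensor A B p \<partial>lborel)"
    using w A B by (simp add: weak_x_def)
  then show "(\<integral>p. f (snd p, fst p) * tensor B (deriv A) p \<partial>lborel) =
      - (\<integral>p. g (snd p, fst p) * tensor B A p \<partial>lborel)"
    using swap_plane(2)[OF 1] swap_plane(2)[OF 2] by (simp add: t[of B "deriv A"] t[of B A])
qed

proposition weak_y_representation:
  assumes f: "L1 f" and g: "L1 g" and weak: "weak_y f g"
  obtains m where "integrable lborel m"
    "AE p in lborel. p \<in> Om \<longrightarrow> f p = m (fst p) + prim (\<lambda>t. g (fst p, t)) (snd p)"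
proof -
  obtain m where m: "integrable lborel m"
    "AE p in lborel. p \<in> rectangle.Om c d a b \<longrightarrow>
       f (snd p, fst p) = m (snd p) + prim (\<lambda>s. g (snd p, s)) (fst p)"
    using rectangle.weak_x_representation[OF rectangle_swap L1_swap[OF f] L1_swap[OF g] weak_y_swap[OF assms]]
    by auto
  have "AE p in lborel. p \<in> Om \<longrightarrow> f p = m (fst p) + prim (\<lambda>t. g (fst p, t)) (snd p)"
    using AE_swap_plane[OF m(2)] by (simp add: Om_swap)
  then show ?thesis using m(1) that by blast
qed

end

text \<open>The set where two continuous functions differ inside U is open, and an open null set is
  empty; continuity carries the equality to the closure.\<close>

lemma AE_eq_imp_eq_closure:
  fixes f g :: "'n::euclidean_space \<Rightarrow> real"
  assumes "open U" and f: "continuous_on (closure U) f" and g: "continuous_on (closure U) g"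
    and ae: "AE p in lebesgue. p \<in> U \<longrightarrow> f p = g p" and p: "p \<in> closure U"
  shows "f p = g p"
proof -
  define S where "S = U \<inter> (\<lambda>p. f p - g p) -` (- {0})"
  have "continuous_on U (\<lambda>p. f p - g p)"
    by (intro continuous_intros continuous_on_subset[OF f closure_subset] continuous_on_subset[OF g closure_subset])
  then have "open S"
    unfolding S_def by (rule continuous_open_preimage) (use \<open>open U\<close> in auto)
  moreover have "S \<in> null_sets lebesgue"
  proof -
    have "AE p in lebesgue. p \<notin> S" using ae by (rule AE_mp) (auto simp: S_def intro!: AE_I2)
    moreover have "S \<in> sets lebesgue" using \<open>open S\<close> by auto
    ultimately show ?thesis using AE_iff_null_sets by blast
  qed
  ultimately have "S = {}"
    using open_not_negligible negligible_iff_null_sets by blast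
  then have "f q - g q = 0" if "q \<in> U" for q using that by (auto simp: S_def)
  then have "f p - g p = 0"
    by (rule continuous_constant_on_closure[rotated, OF _ p]) (auto intro!: continuous_intros f g)
  then show ?thesis by simp
qed

lemma AE_eq_imp_eq_Icc:
  fixes f g :: "real \<Rightarrow> real"
  assumes "a < b" "continuous_on {a..b} f" "continuous_on {a..b} g"
    and ae: "AE x in lborel. x \<in> {a<..<b} \<longrightarrow> f x = g x" and x: "x \<in> {a..b}"
  shows "f x = g x"
proof (rule AE_eq_imp_eq_closure[where U = "{a<..<b}" and f = f and g = g])
  show "AE p in lebesgue. p \<in> {a<..<b} \<longrightarrow> f p = g p" using ae by (rule AE_completion)
qed (use assms in auto)

text \<open>The exceptional set is first enlarged to a Borel null set, since the product measure
  needs a measurable set.\<close>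

lemma AE_snd_plane:
  assumes "AE y in lborel. P (y::real)" shows "AE p in lborel. P (snd (p :: plane))"
proof -
  obtain N where N: "N \<in> null_sets lborel" "{y. \<not> P y} \<subseteq> N"
    using assms unfolding eventually_ae_filter by auto
  have [measurable]: "N \<in> sets borel" using N by auto
  have "AE x in (lborel :: real measure). AE y in lborel. y \<notin> N" using N(1) AE_not_in by auto
  then have "AE p in lborel \<Otimes>\<^sub>M lborel. snd (p :: plane) \<notin> N"
  proof (intro lborel_pair.AE_pair_measure)
    have "{p \<in> space (borel \<Otimes>\<^sub>M borel). snd (p :: plane) \<notin> N} \<in> sets (borel \<Otimes>\<^sub>M borel)" by measurable
    then show "{p \<in> space (lborel \<Otimes>\<^sub>M lborel). snd (p :: plane) \<notin> N} \<in> sets (lborel \<Otimes>\<^sub>M lborel)"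
      by (simp add: space_pair_measure)
  qed simp
  then have "AE p in lborel. snd (p :: plane) \<notin> N" by (subst (asm) lborel_prod)
  then show ?thesis by (rule eventually_mono) (use N(2) in blast)
qed

lemma AE_fst_plane:
  assumes "AE y in lborel. P (y::real)" shows "AE p in lborel. P (fst (p :: plane))"
  using AE_swap_plane[OF AE_snd_plane[OF assms]] by simp

lemma AE_Ioo_ex:
  fixes a b :: real
  assumes "a < b" "AE x in lborel. x \<in> {a<..<b} \<longrightarrow> P x"
  obtains x where "a < x" "x < b" "P x"
proof (rule ccontr)
  assume "\<not> thesis"
  then have "\<And>x. x \<in> {a<..<b} \<Longrightarrow> \<not> P x" using that by auto
  then have "AE x in lborel. x \<notin> {a<..<b}"
    using assms(2) by (auto elim!: eventually_mono)
  then have "emeasure lborel {a<..<b} = 0"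
    by (subst (asm) AE_iff_measurable[of "{a<..<b}"]) auto
  then show False using assms by simp
qed

lemma eventually_indicator_atMost:
  fixes s x :: real
  assumes "s \<noteq> x" "v \<longlonglongrightarrow> x"
  shows "eventually (\<lambda>n. indicator {..v n} s = (indicator {..x} s :: real)) sequentially"
proof (cases "s < x")
  case True
  from order_tendstoD(1)[OF assms(2) this] show ?thesis
    by (rule eventually_mono) (use True in simp)
next
  case False
  then have "x < s" using assms(1) by simp
  from order_tendstoD(2)[OF assms(2) this] show ?thesis
    by (rule eventually_mono) (use \<open>x < s\<close> in simp)
qed

lemma continuous_on_prim:
  assumes g: "integrable lborel g" shows "continuous_on S (prim g)"
proof -
  have "continuous_on UNIV (prim g)"
  proof (rule continuous_on_sequentiallyI)
    fix u :: "nat \<Rightarrow> real" and x assume u: "u \<longlonglongrightarrow> x"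
    show "(\<lambda>n. prim g (u n)) \<longlonglongrightarrow> prim g x"
      unfolding prim_def
    proof (rule integral_dominated_convergence[where w = "\<lambda>s. \<bar>g s\<bar>"])
      have [measurable]: "g \<in> borel_measurable borel" using g by auto
      show "(\<lambda>s. indicator {..x} s * g s) \<in> borel_measurable lborel"
        "\<And>n. (\<lambda>s. indicator {..u n} s * g s) \<in> borel_measurable lborel" by measurable
      show "AE s in lborel. (\<lambda>n. indicator {..u n} s * g s) \<longlonglongrightarrow> indicator {..x} s * g s"
        using AE_lborel_singleton[of x]
      proof (rule AE_mp, intro AE_I2 impI)
        fix s assume "s \<noteq> x"
        from eventually_indicator_atMost[OF this u] have "eventually (\<lambda>n. indicator {..x} s * g s = indicator {..u n} s * g s) sequentially"
          by (rule eventually_mono) simp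
        then show "(\<lambda>n. indicator {..u n} s * g s) \<longlonglongrightarrow> indicator {..x} s * g s"
          by (rule Lim_transform_eventually[OF tendsto_const])
      qed
    qed (use g in \<open>auto simp: indicator_def\<close>)
  qed
  then show ?thesis by (rule continuous_on_subset) auto
qed

lemma prim_diff_bound:
  assumes g: "integrable lborel g" shows "\<bar>prim g x - prim g y\<bar> \<le> (\<integral>s. \<bar>g s\<bar> \<partial>lborel)"
proof -
  have i: "integrable lborel (\<lambda>s. indicator {..x} s * g s)" for x
    using integrable_mult_indicator[OF _ g, of "{..x}"] by simp
  have "prim g x - prim g y = (\<integral>s. indicator {..x} s * g s - indicator {..y} s * g s \<partial>lborel)"
    unfolding prim_def by (rule Bochner_Integration.integral_diff[symmetric, OF i i])
  also have "\<bar>\<dots>\<bar> \<le> (\<integral>s. \<bar>indicator {..x} s * g s - indicator {..y} s * g s\<bar> \<partial>lborel)"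
    by (rule integral_abs_bound)
  also have "\<dots> \<le> (\<integral>s. \<bar>g s\<bar> \<partial>lborel)"
    by (intro integral_mono integrable_abs Bochner_Integration.integrable_diff i g) (auto simp: indicator_def)
  finally show ?thesis .
qed

lemma prim_cong_AE:
  assumes "AE s in lborel. f s = g s" "f \<in> borel_measurable borel" "g \<in> borel_measurable borel"
  shows "prim f x = prim g x"
proof -
  note [measurable] = assms(2,3)
  show ?thesis
    unfolding prim_def by (rule integral_cong_AE) (use assms(1) in \<open>auto elim!: eventually_mono\<close>)
qed

text \<open>The double primitive written as one planar integral over a quadrant, so that both
  iterated forms are instances of Fubini and continuity follows by dominated convergence.\<close>

definition prim2 :: "(plane \<Rightarrow> real) \<Rightarrow> plane \<Rightarrow> real" where
  "prim2 g p = (\<integral>q. indicator ({..fst p} \<times> {..snd p}) q * g q \<partial>lborel)"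

lemma prim2_integrable:
  fixes x y :: real and g :: "plane \<Rightarrow> real"
  assumes g: "integrable lborel g"
  shows "integrable lborel (\<lambda>q. indicator ({..x} \<times> {..y}) q * g q)"
proof -
  have "{..x} \<times> {..y} \<in> sets (borel :: plane measure)" by (intro borel_closed closed_Times) auto
  then show ?thesis using integrable_mult_indicator[OF _ g, of "{..x} \<times> {..y}"] by simp
qed

lemma prim2_iterated:
  assumes g: "integrable lborel g"
  shows "prim2 g (x, y) = prim (\<lambda>s. prim (\<lambda>t. g (s, t)) y) x"
    and "prim2 g (x, y) = prim (\<lambda>t. prim (\<lambda>s. g (s, t)) x) y"
proof -
  note i = prim2_integrable[OF g, of x y]
  show "prim2 g (x, y) = prim (\<lambda>s. prim (\<lambda>t. g (s, t)) y) x"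
    unfolding prim2_def prim_def fst_conv snd_conv fubini_plane(3)[OF i, symmetric]
    by (simp add: indicator_times mult.assoc)
  show "prim2 g (x, y) = prim (\<lambda>t. prim (\<lambda>s. g (s, t)) x) y"
  proof -
    have "indicator ({..x} \<times> {..y}) (s, t) * g (s, t) = indicator {..y} t * (indicator {..x} s * g (s, t))" for s t
      by (simp add: indicator_times)
    note e = this
    show ?thesis
      unfolding prim2_def prim_def fst_conv snd_conv fubini_plane(6)[OF i, symmetric] e by simp
  qed
qed

lemma continuous_on_prim2:
  assumes g: "integrable lborel g" shows "continuous_on S (prim2 g)"
proof -
  have "continuous_on UNIV (prim2 g)"
  proof (rule continuous_on_sequentiallyI)
    fix u :: "nat \<Rightarrow> plane" and p assume u: "u \<longlonglongrightarrow> p"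
    have u1: "(\<lambda>n. fst (u n)) \<longlonglongrightarrow> fst p" and u2: "(\<lambda>n. snd (u n)) \<longlonglongrightarrow> snd p"
      using u by (auto intro: tendsto_intros)
    show "(\<lambda>n. prim2 g (u n)) \<longlonglongrightarrow> prim2 g p"
      unfolding prim2_def
    proof (rule integral_dominated_convergence[where w = "\<lambda>s. \<bar>g s\<bar>"])
      show "(\<lambda>q. indicator ({..fst p} \<times> {..snd p}) q * g q) \<in> borel_measurable lborel"
        "\<And>n. (\<lambda>q. indicator ({..fst (u n)} \<times> {..snd (u n)}) q * g q) \<in> borel_measurable lborel"
        using prim2_integrable[OF g] by (auto intro: borel_measurable_integrable)
      have "AE q in lborel. fst q \<noteq> fst p \<and> snd q \<noteq> snd p"
        using AE_fst_plane[OF AE_lborel_singleton[of "fst p"]] AE_snd_plane[OF AE_lborel_singleton[of "snd p"]]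
        by eventually_elim simp
      then show "AE q in lborel. (\<lambda>n. indicator ({..fst (u n)} \<times> {..snd (u n)}) q * g q)
          \<longlonglongrightarrow> indicator ({..fst p} \<times> {..snd p}) q * g q"
      proof (rule AE_mp, intro AE_I2 impI)
        fix q :: plane assume q: "fst q \<noteq> fst p \<and> snd q \<noteq> snd p"
        have "eventually (\<lambda>n. indicator {..fst (u n)} (fst q) = (indicator {..fst p} (fst q) :: real)) sequentially"
          "eventually (\<lambda>n. indicator {..snd (u n)} (snd q) = (indicator {..snd p} (snd q) :: real)) sequentially"
          using q by (auto intro!: eventually_indicator_atMost u1 u2)
        then have "eventually (\<lambda>n. indicator ({..fst p} \<times> {..snd p}) q * g q =
            indicator ({..fst (u n)} \<times> {..snd (u n)}) q * g q) sequentially"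
          by eventually_elim (simp add: indicator_times)
        then show "(\<lambda>n. indicator ({..fst (u n)} \<times> {..snd (u n)}) q * g q)
          \<longlonglongrightarrow> indicator ({..fst p} \<times> {..snd p}) q * g q"
          by (rule Lim_transform_eventually[OF tendsto_const])
      qed
    qed (use g in \<open>auto simp: indicator_def\<close>)
  qed
  then show ?thesis by (rule continuous_on_subset) auto
qed

text \<open>The mixed difference of the four quadrant indicators is a product of differences of half
  line indicators, each of modulus at most 1.\<close>

lemma prim2_mixed_difference_bound:
  assumes g: "integrable lborel g"
  shows "\<bar>prim2 g (x2, y2) - prim2 g (x1, y2) - prim2 g (x2, y1) + prim2 g (x1, y1)\<bar> \<le> (\<integral>q. \<bar>g q\<bar> \<partial>lborel)"
proof -
  note i = prim2_integrable[OF g]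
  let ?I = "\<lambda>x y q. indicator ({..x} \<times> {..y}) q * g q"
  have i4: "integrable lborel (\<lambda>q. ?I x2 y2 q - ?I x1 y2 q - ?I x2 y1 q + ?I x1 y1 q)"
    by (rule Bochner_Integration.integrable_add[OF Bochner_Integration.integrable_diff[OF
          Bochner_Integration.integrable_diff[OF i i] i] i])
  have e: "prim2 g (x2, y2) - prim2 g (x1, y2) - prim2 g (x2, y1) + prim2 g (x1, y1) =
      (\<integral>q. ?I x2 y2 q - ?I x1 y2 q - ?I x2 y1 q + ?I x1 y1 q \<partial>lborel)"
    unfolding prim2_def
    by (simp only: Bochner_Integration.integral_add[OF Bochner_Integration.integrable_diff[OF
          Bochner_Integration.integrable_diff[OF i i] i] i]
        Bochner_Integration.integral_diff[OF Bochner_Integration.integrable_diff[OF i i] i]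
        Bochner_Integration.integral_diff[OF i i] fst_conv snd_conv)
  have "(\<integral>q. \<bar>?I x2 y2 q - ?I x1 y2 q - ?I x2 y1 q + ?I x1 y1 q\<bar> \<partial>lborel) \<le> (\<integral>q. \<bar>g q\<bar> \<partial>lborel)"
  proof (rule integral_mono[OF integrable_abs[OF i4] integrable_abs[OF g]])
    fix q
    have alg: "A2 * B2 * r - A1 * B2 * r - A2 * B1 * r + A1 * B1 * r = (A2 - A1) * (B2 - B1) * r"
      for A1 A2 B1 B2 r :: real by (simp add: algebra_simps)
    have e': "?I x2 y2 q - ?I x1 y2 q - ?I x2 y1 q + ?I x1 y1 q =
        (indicator {..x2} (fst q) - indicator {..x1} (fst q)) * (indicator {..y2} (snd q) - indicator {..y1} (snd q)) * g q"
      unfolding indicator_times by (rule alg)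
    have "\<bar>indicator {..x2} s - indicator {..x1} s\<bar> \<le> (1::real)" for x1 x2 s :: real
      by (simp add: indicator_def)
    then show "\<bar>?I x2 y2 q - ?I x1 y2 q - ?I x2 y1 q + ?I x1 y1 q\<bar> \<le> \<bar>g q\<bar>"
      unfolding e' abs_mult by (intro mult_left_le_one_le mult_le_one mult_nonneg_nonneg abs_ge_zero)
  qed
  then show ?thesis
    unfolding e by (rule order_trans[OF integral_abs_bound])
qed

section \<open>Continuous representatives from a mixed derivative\<close>

context rectangle begin

text \<open>The representation of \<open>f1\<close> in y is inserted into the representation of
  \<open>f\<close> in x. The part depending on x alone is a primitive and hence continuous; nothing
  is known yet about \<open>m\<close>.\<close>

lemma mixed_representation:
  assumes L: "L1 f" "L1 f1" "L1 f12" and w: "weak_x f f1" "weak_y f1 f12"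
  obtains m N where "continuous_on UNIV N"
    "AE p in lborel. p \<in> Om \<longrightarrow> f p = m (snd p) + N (fst p) + prim2 f12 p"
proof -
  have [measurable]: "f1 \<in> borel_measurable borel" "f12 \<in> borel_measurable borel"
    using L by (auto dest: L1_measurable)
  have [measurable]: "f1 \<in> borel_measurable (borel \<Otimes>\<^sub>M borel)" "f12 \<in> borel_measurable (borel \<Otimes>\<^sub>M borel)"
    by (simp_all add: borel_prod)
  have i12: "integrable lborel f12" using L by (simp add: L1_def)
  obtain m where m: "integrable lborel m"
    "AE p in lborel. p \<in> Om \<longrightarrow> f p = m (snd p) + prim (\<lambda>s. f1 (s, snd p)) (fst p)"
    using weak_x_representation[OF L(1,2) w(1)] by blast
  obtain n where n: "integrable lborel n"
    "AE p in lborel. p \<in> Om \<longrightarrow> f1 p = n (fst p) + prim (\<lambda>t. f12 (fst p, t)) (snd p)"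
    using weak_y_representation[OF L(2,3) w(2)] by blast
  \<comment> \<open>After the cut-off the formula for \<open>f1\<close> on a horizontal line holds
    for almost all real s, both sides being zero outside the interval, and can be integrated from
    -infinity.\<close>
  define n' where "n' = (\<lambda>x. indicator {a<..<b} x * n x)"
  have n': "integrable lborel n'"
    unfolding n'_def using integrable_mult_indicator[OF _ n(1), of "{a<..<b}"] by simp
  have [measurable]: "n' \<in> borel_measurable borel" using n' by auto
  \<comment> \<open>The exceptional set of y is the same for all x, so the identity can later be
    used at every point of a line.\<close>
  have P: "AE y in lborel. y \<in> {c<..<d} \<longrightarrow> (\<forall>x. prim (\<lambda>s. f1 (s, y)) x = prim n' x + prim2 f12 (x, y))"
    using AE_pair_plane(2)[OF n(2)]
  proof (rule AE_mp, intro AE_I2 impI allI)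
    fix y x
    assume ae: "AE x in lborel. (x, y) \<in> Om \<longrightarrow> f1 (x, y) = n (fst (x, y)) + prim (\<lambda>t. f12 (fst (x, y), t)) (snd (x, y))"
      and y: "y \<in> {c<..<d}"
    have z: "prim (\<lambda>t. f12 (s, t)) y = 0" if "s \<notin> {a<..<b}" for s
    proof -
      have "f12 (s, t) = 0" for t using L(3) that by (auto simp: L1_def Om_def)
      then show ?thesis by (simp add: prim_def)
    qed
    have "AE s in lborel. f1 (s, y) = n' s + prim (\<lambda>t. f12 (s, t)) y"
      using ae
    proof (rule AE_mp, intro AE_I2 impI)
      fix s assume *: "(s, y) \<in> Om \<longrightarrow> f1 (s, y) = n (fst (s, y)) + prim (\<lambda>t. f12 (fst (s, y), t)) (snd (s, y))"
      show "f1 (s, y) = n' s + prim (\<lambda>t. f12 (s, t)) y"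
      proof (cases "s \<in> {a<..<b}")
        case True
        then show ?thesis using * y by (simp add: Om_def n'_def)
      next
        case False
        then have "f1 (s, y) = 0" using L(2) by (auto simp: L1_def Om_def)
        then show ?thesis using False z by (simp add: n'_def)
      qed
    qed
    moreover have pm: "(\<lambda>s. prim (\<lambda>t. f12 (s, t)) y) \<in> borel_measurable borel"
      unfolding prim_def by measurable
    ultimately have "prim (\<lambda>s. f1 (s, y)) x = prim (\<lambda>s. n' s + prim (\<lambda>t. f12 (s, t)) y) x"
      by (intro prim_cong_AE) measurable
    also have "\<dots> = prim n' x + prim (\<lambda>s. prim (\<lambda>t. f12 (s, t)) y) x"
    proof -
      have "integrable lborel (\<lambda>s. indicator {..x} s * n' s)"
        using integrable_mult_indicator[OF _ n', of "{..x}"] by simp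
      moreover have "integrable lborel (\<lambda>s. indicator {..x} s * prim (\<lambda>t. f12 (s, t)) y)"
        using fubini_plane(2)[OF prim2_integrable[OF i12, of x y]]
        by (simp add: prim_def indicator_times mult.assoc)
      ultimately show ?thesis by (simp add: prim_def distrib_left)
    qed
    finally show "prim (\<lambda>s. f1 (s, y)) x = prim n' x + prim2 f12 (x, y)"
      by (simp add: prim2_iterated(1)[OF i12])
  qed
  have "AE p in lborel. snd (p :: plane) \<in> {c<..<d} \<longrightarrow> (\<forall>x. prim (\<lambda>s. f1 (s, snd p)) x = prim n' x + prim2 f12 (x, snd p))"
    by (rule AE_snd_plane[OF P])
  with m(2) have "AE p in lborel. p \<in> Om \<longrightarrow> f p = m (snd p) + prim n' (fst p) + prim2 f12 p"
    by eventually_elim (auto simp: Om_def)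
  then show ?thesis using continuous_on_prim[OF n'] that by blast
qed

text \<open>The mixed derivative makes \<open>f - prim2 f12\<close> a sum of a continuous function of \<open>x\<close> and some
  function of \<open>y\<close>, and also the other way round; comparing the two gives a continuous
  representative. This is the Sobolev embedding used here.\<close>

proposition continuous_representative:
  assumes L: "L1 f" "L1 f1" "L1 f2" "L1 f12"
    and w: "weak_x f f1" "weak_y f f2" "weak_y f1 f12" "weak_x f2 f12"
  obtains v where "continuous_on UNIV v" "AE p in lborel. p \<in> Om \<longrightarrow> f p = v p"
    "\<And>x1 x2 y1 y2. \<bar>v (x2, y2) - v (x1, y2) - v (x2, y1) + v (x1, y1)\<bar> \<le> (\<integral>q. \<bar>f12 q\<bar> \<partial>lborel)"
proof -
  have i12: "integrable lborel f12" using L by (simp add: L1_def)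
  obtain m N where N: "continuous_on UNIV N"
    and 1: "AE p in lborel. p \<in> Om \<longrightarrow> f p = m (snd p) + N (fst p) + prim2 f12 p"
    using mixed_representation[OF L(1,2,4) w(1,3)] by blast
  obtain m2 Q where Q: "continuous_on UNIV Q"
    and 2: "AE p in lborel. p \<in> Om \<longrightarrow> f p = m2 (fst p) + Q (snd p) + prim2 f12 p"
  proof -
    have "rectangle.weak_y c d a b (\<lambda>p. f2 (snd p, fst p)) (\<lambda>p. f12 (snd p, fst p))"
      by (rule weak_x_swap[OF L(3,4) w(4)])
    from rectangle.mixed_representation[OF rectangle_swap L1_swap[OF L(1)] L1_swap[OF L(3)] L1_swap[OF L(4)]
        weak_y_swap[OF L(1,3) w(2)] this]
    obtain m2 Q where Q: "continuous_on UNIV Q" and 2: "AE p in lborel. p \<in> rectangle.Om c d a b \<longrightarrow>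
        f (snd p, fst p) = m2 (snd p) + Q (fst p) + prim2 (\<lambda>p. f12 (snd p, fst p)) p" by blast
    have "prim2 (\<lambda>p. f12 (snd p, fst p)) (y, x) = prim2 f12 (x, y)" for x y
      unfolding prim2_iterated(1)[OF swap_plane(1)[OF i12]] prim2_iterated(2)[OF i12] by simp
    then have "AE p in lborel. p \<in> Om \<longrightarrow> f p = m2 (fst p) + Q (snd p) + prim2 f12 p"
      using AE_swap_plane[OF 2] by (simp add: Om_swap)
    then show ?thesis using Q that by blast
  qed
  \<comment> \<open>The variables separate, so both sides are constant almost everywhere. Freezing
    one good height \<open>y0\<close> fixes the constant and determines \<open>m2\<close> up to a
    null set, which removes the uncontrolled summand from the second representation.\<close>
  have "AE p in lborel. p \<in> Om \<longrightarrow> m (snd p) - Q (snd p) = m2 (fst p) - N (fst p)"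
    using 1 2 by eventually_elim auto
  from AE_pair_plane(2)[OF this]
  have "AE y in lborel. y \<in> {c<..<d} \<longrightarrow> (AE x in lborel. x \<in> {a<..<b} \<longrightarrow> m y - Q y = m2 x - N x)"
    by (auto elim!: eventually_mono simp: Om_def)
  from AE_Ioo_ex[OF cd this] obtain y0 where "AE x in lborel. x \<in> {a<..<b} \<longrightarrow> m y0 - Q y0 = m2 x - N x"
    by blast
  then have c0: "AE x in lborel. x \<in> {a<..<b} \<longrightarrow> m2 x = N x + (m y0 - Q y0)"
    by (rule eventually_mono) auto
  define c0 where "c0 = m y0 - Q y0"
  have c0': "AE p in lborel. fst (p :: plane) \<in> {a<..<b} \<longrightarrow> m2 (fst p) = N (fst p) + c0"
    unfolding c0_def by (rule AE_fst_plane[OF c0])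
  define v where "v p = c0 + N (fst p) + Q (snd p) + prim2 f12 p" for p
  have "AE p in lborel. p \<in> Om \<longrightarrow> f p = v p"
    using 2 c0' by eventually_elim (auto simp: v_def Om_def)
  moreover have "continuous_on UNIV v"
    unfolding v_def
    by (intro continuous_intros continuous_on_prim2 i12 continuous_on_compose2[OF N] continuous_on_compose2[OF Q]) auto
  \<comment> \<open>Summands that depend on one variable only drop out of a mixed
    difference.\<close>
  moreover have "\<bar>v (x2, y2) - v (x1, y2) - v (x2, y1) + v (x1, y1)\<bar> \<le> (\<integral>q. \<bar>f12 q\<bar> \<partial>lborel)" for x1 x2 y1 y2
    using prim2_mixed_difference_bound[OF i12, of x2 y2 x1 y1] by (simp add: v_def)
  ultimately show ?thesis using that by blast
qed

end

text \<open>The integral of (|h| - l)^2 over S is nonnegative for every real l; the best l gives the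
  inequality.\<close>

lemma Cauchy_Schwarz_indicator:
  fixes h :: "'x \<Rightarrow> real"
  assumes h: "integrable M h" and h2: "integrable M (\<lambda>x. (h x)\<^sup>2)"
    and S: "S \<in> sets M" "emeasure M S < \<infinity>" and z: "\<And>x. x \<in> space M \<Longrightarrow> x \<notin> S \<Longrightarrow> h x = 0"
  shows "(\<integral>x. \<bar>h x\<bar> \<partial>M)\<^sup>2 \<le> measure M S * (\<integral>x. (h x)\<^sup>2 \<partial>M)"
proof -
  let ?\<mu> = "measure M S" and ?I = "\<integral>x. \<bar>h x\<bar> \<partial>M" and ?Q = "\<integral>x. (h x)\<^sup>2 \<partial>M"
  have iS: "integrable M (indicator S :: _ \<Rightarrow> real)" by (rule integrable_real_indicator[OF S])
  have mS: "(\<integral>x. indicator S x \<partial>M) = ?\<mu>" using S by (simp add: Int_absorb1 sets.sets_into_space)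
  have key: "0 \<le> ?Q - 2 * l * ?I + l\<^sup>2 * ?\<mu>" for l
  proof -
    have "0 \<le> (\<integral>x. (h x)\<^sup>2 - 2 * l * \<bar>h x\<bar> + l\<^sup>2 * indicator S x \<partial>M)"
    proof (rule Bochner_Integration.integral_nonneg)
      fix x assume "x \<in> space M"
      have "(\<bar>h x\<bar> - l)\<^sup>2 \<ge> 0" by simp
      then show "0 \<le> (h x)\<^sup>2 - 2 * l * \<bar>h x\<bar> + l\<^sup>2 * indicator S x"
        using z[OF \<open>x \<in> space M\<close>] by (cases "x \<in> S") (auto simp: power2_eq_square algebra_simps)
    qed
    moreover have "(\<integral>x. (h x)\<^sup>2 - 2 * l * \<bar>h x\<bar> + l\<^sup>2 * indicator S x \<partial>M) = ?Q - 2 * l * ?I + l\<^sup>2 * ?\<mu>"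
      using h h2 iS mS by (simp del: Bochner_Integration.integral_indicator)
    ultimately show ?thesis by simp
  qed
  show ?thesis
  proof (cases "?\<mu> = 0")
    case True
    have "?I = 0"
    proof (rule ccontr)
      assume "?I \<noteq> 0"
      moreover have "?I \<ge> 0" by (rule Bochner_Integration.integral_nonneg) simp
      ultimately have "?I > 0" by linarith
      \<comment> \<open>If S is null the quadratic degenerates to an affine function of l, and this
        l makes it equal to -1.\<close>
      then show False using key[of "(?Q + 1) / (2 * ?I)"] True by simp
    qed
    then show ?thesis using True by simp
  next
    case False
    then have "?\<mu> > 0" by (simp add: order_less_le)
    \<comment> \<open>The minimizer of the quadratic.\<close>
    then show ?thesis using key[of "?I / ?\<mu>"]
      by (simp add: power2_eq_square field_simps)
  qed
qed

lemma prim_diff_eq_integral: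
  assumes g: "integrable lborel g" and V: "continuous_on {x1..x2} V"
    and ae: "AE s in lborel. s \<in> {a<..<b} \<longrightarrow> g s = V s" and x: "a \<le> x1" "x1 \<le> x2" "x2 \<le> b"
  shows "prim g x2 - prim g x1 = integral {x1..x2} V"
proof -
  have i: "integrable lborel (\<lambda>s. indicator {..x} s * g s)" for x
    using integrable_mult_indicator[OF _ g, of "{..x}"] by simp
  have s: "set_integrable lborel {x1..x2} V"
    unfolding set_integrable_def by (rule borel_integrable_compact[OF compact_Icc V])
  have "prim g x2 - prim g x1 = (\<integral>s. indicator {..x2} s * g s - indicator {..x1} s * g s \<partial>lborel)"
    unfolding prim_def by (rule Bochner_Integration.integral_diff[symmetric, OF i i])
  also have "\<dots> = (\<integral>s. indicator {x1..x2} s *\<^sub>R V s \<partial>lborel)"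
  proof (rule integral_cong_AE)
    show "(\<lambda>s. indicator {..x2} s * g s - indicator {..x1} s * g s) \<in> borel_measurable lborel"
      by (intro borel_measurable_integrable Bochner_Integration.integrable_diff i)
    show "(\<lambda>s. indicator {x1..x2} s *\<^sub>R V s) \<in> borel_measurable lborel"
      using s unfolding set_integrable_def by (rule borel_measurable_integrable)
    show "AE s in lborel. indicator {..x2} s * g s - indicator {..x1} s * g s = indicator {x1..x2} s *\<^sub>R V s"
      \<comment> \<open>At a and b the functions g and V are not compared; at x1 the half-open
        interval of the difference and the closed interval disagree.\<close>
      using ae AE_lborel_singleton[of a] AE_lborel_singleton[of b] AE_lborel_singleton[of x1]
      by eventually_elim (use x in \<open>auto simp: indicator_def\<close>)
  qed
  also have "\<dots> = integral {x1..x2} V"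
    using set_borel_integral_eq_integral(2)[OF s] by (simp add: set_lebesgue_integral_def)
  finally show ?thesis .
qed

section \<open>Pointwise bounds for continuous representatives\<close>

context rectangle begin

text \<open>In the representation the summand depending on y cancels in differences along a line. On
  a good line the equality holds almost everywhere first and then, both sides being continuous, on
  the whole closed side.\<close>

lemma weak_x_absolutely_continuous:
  assumes f: "L1 f" and f1: "L1 f1" and w: "weak_x f f1"
    and v: "continuous_on UNIV v" "AE p in lborel. p \<in> Om \<longrightarrow> f p = v p"
  shows "AE y in lborel. y \<in> {c<..<d} \<longrightarrow> integrable lborel (\<lambda>s. f1 (s, y)) \<and>
    (\<forall>x1\<in>{a..b}. \<forall>x2\<in>{a..b}. v (x2, y) - v (x1, y) = prim (\<lambda>s. f1 (s, y)) x2 - prim (\<lambda>s. f1 (s, y)) x1)"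
proof -
  obtain m where m: "AE p in lborel. p \<in> Om \<longrightarrow> f p = m (snd p) + prim (\<lambda>s. f1 (s, snd p)) (fst p)"
    using weak_x_representation[OF f f1 w] by blast
  have "AE p in lborel. p \<in> Om \<longrightarrow> v p = m (snd p) + prim (\<lambda>s. f1 (s, snd p)) (fst p)"
    using m v(2) by eventually_elim auto
  from AE_pair_plane(2)[OF this] fubini_plane(4)[of f1] f1
  have "AE y in lborel. (AE x in lborel. (x, y) \<in> Om \<longrightarrow> v (x, y) = m y + prim (\<lambda>s. f1 (s, y)) x) \<and>
      integrable lborel (\<lambda>s. f1 (s, y))"
    by (simp add: L1_def)
  then show ?thesis
  proof (rule eventually_mono, intro impI)
    fix y assume *: "(AE x in lborel. (x, y) \<in> Om \<longrightarrow> v (x, y) = m y + prim (\<lambda>s. f1 (s, y)) x) \<and>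
      integrable lborel (\<lambda>s. f1 (s, y))" and y: "y \<in> {c<..<d}"
    have e: "v (x, y) = m y + prim (\<lambda>s. f1 (s, y)) x" if x: "x \<in> {a..b}" for x
    proof (rule AE_eq_imp_eq_Icc[OF ab _ _ _ x])
      show "continuous_on {a..b} (\<lambda>x. v (x, y))"
        by (rule continuous_on_compose2[OF v(1)]) (auto intro!: continuous_intros)
      show "continuous_on {a..b} (\<lambda>x. m y + prim (\<lambda>s. f1 (s, y)) x)"
        using * by (intro continuous_intros continuous_on_prim) simp
      show "AE x in lborel. x \<in> {a<..<b} \<longrightarrow> v (x, y) = m y + prim (\<lambda>s. f1 (s, y)) x"
        using * y by (auto simp: Om_def)
    qed
    show "integrable lborel (\<lambda>s. f1 (s, y)) \<and> (\<forall>x1\<in>{a..b}. \<forall>x2\<in>{a..b}.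
        v (x2, y) - v (x1, y) = prim (\<lambda>s. f1 (s, y)) x2 - prim (\<lambda>s. f1 (s, y)) x1)"
      using * by (auto simp: e)
  qed
qed

text \<open>A continuous \<open>v\<close> together with all that is used about its derivatives. The
  mixed derivative \<open>f12\<close> enters only through the bound on mixed differences, which is
  symmetric in the two coordinates.\<close>

definition represents :: "(plane \<Rightarrow> real) \<Rightarrow> (plane \<Rightarrow> real) \<Rightarrow> (plane \<Rightarrow> real) \<Rightarrow> (plane \<Rightarrow> real) \<Rightarrow>
    (plane \<Rightarrow> real) \<Rightarrow> bool" where
  "represents v f f1 f2 f12 \<longleftrightarrow> L1 f \<and> L1 f1 \<and> L1 f2 \<and> L1 f12 \<and> weak_x f f1 \<and> weak_y f f2 \<and>
     continuous_on UNIV v \<and> (AE p in lborel. p \<in> Om \<longrightarrow> f p = v p) \<and>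
     (\<forall>x1 x2 y1 y2. \<bar>v (x2, y2) - v (x1, y2) - v (x2, y1) + v (x1, y1)\<bar> \<le> (\<integral>q. \<bar>f12 q\<bar> \<partial>lborel))"

lemma represents_swap:
  assumes "represents v f f1 f2 f12"
  shows "rectangle.represents c d a b (\<lambda>p. v (snd p, fst p)) (\<lambda>p. f (snd p, fst p))
    (\<lambda>p. f2 (snd p, fst p)) (\<lambda>p. f1 (snd p, fst p)) (\<lambda>p. f12 (snd p, fst p))"
proof -
  have L: "L1 f" "L1 f1" "L1 f2" "L1 f12" and w: "weak_x f f1" "weak_y f f2"
    and v: "continuous_on UNIV v" "AE p in lborel. p \<in> Om \<longrightarrow> f p = v p"
    and m: "\<And>x1 x2 y1 y2. \<bar>v (x2, y2) - v (x1, y2) - v (x2, y1) + v (x1, y1)\<bar> \<le> (\<integral>q. \<bar>f12 q\<bar> \<partial>lborel)"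
    using assms by (auto simp: represents_def)
  have "continuous_on UNIV (\<lambda>p. v (snd p, fst p))"
    by (rule continuous_on_compose2[OF v(1)]) (auto intro!: continuous_intros)
  moreover have "(\<integral>q. \<bar>f12 (snd q, fst q)\<bar> \<partial>lborel) = (\<integral>q. \<bar>f12 q\<bar> \<partial>lborel)"
    using L(4) by (intro swap_plane(2)[of "\<lambda>q. \<bar>f12 q\<bar>"]) (simp add: L1_def)
  moreover have "\<bar>v (y2, x2) - v (y2, x1) - v (y1, x2) + v (y1, x1)\<bar> \<le> (\<integral>q. \<bar>f12 q\<bar> \<partial>lborel)" for x1 x2 y1 y2
    using m[of y2 x2 y1 x1] by (simp add: algebra_simps)
  ultimately show ?thesis
    unfolding rectangle.represents_def[OF rectangle_swap]
    using L1_swap L weak_y_swap[OF L(1,3) w(2)] weak_x_swap[OF L(1,2) w(1)] AE_swap_plane[OF v(2)]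
    by (simp add: Om_swap)
qed

lemma average_bound_Ioo:
  assumes "integrable lborel F" "\<And>y. 0 \<le> F y" "AE y in lborel. y \<in> {c<..<d} \<longrightarrow> r \<le> F y"
  shows "(d - c) * r \<le> (\<integral>y. F y \<partial>lborel)"
proof -
  have "(d - c) * r = (\<integral>y. indicator {c<..<d} y * r \<partial>lborel)"
    using cd by simp
  also have "\<dots> \<le> (\<integral>y. F y \<partial>lborel)"
  proof (rule integral_mono_AE)
    show "AE y in lborel. indicator {c<..<d} y * r \<le> F y"
      using assms(3) by eventually_elim (use assms(2) in \<open>auto simp: indicator_def\<close>)
  qed (use assms(1) integrable_indicator_Ioo in auto)
  finally show ?thesis .
qed

lemma measure_Om: "integrable lborel (indicator Om :: plane \<Rightarrow> real)"
    "(\<integral>p. indicator Om p \<partial>lborel) = (b - a) * (d - c)"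
proof -
  have e: "(indicator Om :: plane \<Rightarrow> real) = (\<lambda>p. indicator {a<..<b} (fst p) * indicator {c<..<d} (snd p))"
    by (auto simp: fun_eq_iff Om_def indicator_times)
  note i = integrable_indicator_Ioo[of a b] integrable_indicator_Ioo[of c d]
  show "integrable lborel (indicator Om :: plane \<Rightarrow> real)"
    unfolding e by (rule integrable_prod_plane(1)[OF i])
  show "(\<integral>p. indicator Om p \<partial>lborel) = (b - a) * (d - c)"
    unfolding e integrable_prod_plane(2)[OF i] using ab cd by simp
qed

text \<open>Moving from height y to another height changes the x-difference by at most the L^1 norm
  of \<open>f12\<close>. At almost every height the difference is bounded by the line integral of
  |f1|, and averaging over all heights gives the planar norm.\<close>

lemma difference_x_bound:
  assumes R: "represents v f f1 f2 f12" and x: "x1 \<in> {a..b}" "x2 \<in> {a..b}"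
  shows "(d - c) * \<bar>v (x2, y) - v (x1, y)\<bar> \<le> (\<integral>q. \<bar>f1 q\<bar> \<partial>lborel) + (d - c) * (\<integral>q. \<bar>f12 q\<bar> \<partial>lborel)"
proof -
  have L: "L1 f" "L1 f1" and w: "weak_x f f1"
    and v: "continuous_on UNIV v" "AE p in lborel. p \<in> Om \<longrightarrow> f p = v p"
    and m: "\<And>x1 x2 y1 y2. \<bar>v (x2, y2) - v (x1, y2) - v (x2, y1) + v (x1, y1)\<bar> \<le> (\<integral>q. \<bar>f12 q\<bar> \<partial>lborel)"
    using R by (auto simp: represents_def)
  have f1: "integrable lborel (\<lambda>q. \<bar>f1 q\<bar>)" using L by (simp add: L1_def)
  let ?K = "\<integral>q. \<bar>f12 q\<bar> \<partial>lborel"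
  have "(d - c) * (\<bar>v (x2, y) - v (x1, y)\<bar> - ?K) \<le> (\<integral>y. (\<integral>x. \<bar>f1 (x, y)\<bar> \<partial>lborel) \<partial>lborel)"
  proof (rule average_bound_Ioo[OF fubini_plane(5)[OF f1]])
    show "AE y' in lborel. y' \<in> {c<..<d} \<longrightarrow> \<bar>v (x2, y) - v (x1, y)\<bar> - ?K \<le> (\<integral>x. \<bar>f1 (x, y')\<bar> \<partial>lborel)"
      using weak_x_absolutely_continuous[OF L w v]
    proof (rule eventually_mono, intro impI)
      fix y' assume "y' \<in> {c<..<d} \<longrightarrow> integrable lborel (\<lambda>s. f1 (s, y')) \<and>
        (\<forall>x1\<in>{a..b}. \<forall>x2\<in>{a..b}. v (x2, y') - v (x1, y') = prim (\<lambda>s. f1 (s, y')) x2 - prim (\<lambda>s. f1 (s, y')) x1)"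
        and "y' \<in> {c<..<d}"
      then have "\<bar>v (x2, y') - v (x1, y')\<bar> \<le> (\<integral>x. \<bar>f1 (x, y')\<bar> \<partial>lborel)"
        using x prim_diff_bound[of "\<lambda>s. f1 (s, y')"] by auto
      then show "\<bar>v (x2, y) - v (x1, y)\<bar> - ?K \<le> (\<integral>x. \<bar>f1 (x, y')\<bar> \<partial>lborel)"
        using m[of x2 y' x1 y] by linarith
    qed
  qed simp
  also have "\<dots> = (\<integral>q. \<bar>f1 q\<bar> \<partial>lborel)" by (rule fubini_plane(6)[OF f1])
  finally show ?thesis by (simp add: algebra_simps)
qed

lemma difference_y_bound:
  assumes R: "represents v f f1 f2 f12" and y: "y1 \<in> {c..d}" "y2 \<in> {c..d}"
  shows "(b - a) * \<bar>v (x, y2) - v (x, y1)\<bar> \<le> (\<integral>q. \<bar>f2 q\<bar> \<partial>lborel) + (b - a) * (\<integral>q. \<bar>f12 q\<bar> \<partial>lborel)"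
proof -
  have L: "L1 f2" "L1 f12" using R by (auto simp: represents_def)
  have "(\<integral>q. \<bar>g (snd q, fst q)\<bar> \<partial>lborel) = (\<integral>q. \<bar>g q\<bar> \<partial>lborel)" if "L1 g" for g
    using that by (intro swap_plane(2)[of "\<lambda>q. \<bar>g q\<bar>"]) (simp add: L1_def)
  then show ?thesis
    using rectangle.difference_x_bound[OF rectangle_swap represents_swap[OF R] y, of x] L by simp
qed

text \<open>The value at (x, y) is compared with the value at an arbitrary point of the rectangle by
  one step in x and one in y, and the result is averaged over that point. The two steps each cost
  one norm of \<open>f12\<close>, whence the factor 2.\<close>

lemma sup_bound:
  assumes R: "represents v f f1 f2 f12" and p: "x \<in> {a..b}" "y \<in> {c..d}"
  shows "(b - a) * (d - c) * \<bar>v (x, y)\<bar> \<le> (\<integral>q. \<bar>f q\<bar> \<partial>lborel) + (b - a) * (\<integral>q. \<bar>f1 q\<bar> \<partial>lborel) +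
    (d - c) * (\<integral>q. \<bar>f2 q\<bar> \<partial>lborel) + 2 * (b - a) * (d - c) * (\<integral>q. \<bar>f12 q\<bar> \<partial>lborel)"
proof -
  have L: "L1 f" and v: "AE p in lborel. p \<in> Om \<longrightarrow> f p = v p"
    using R by (auto simp: represents_def)
  have fi: "integrable lborel (\<lambda>q. \<bar>f q\<bar>)" using L by (simp add: L1_def)
  define I where "I = (\<integral>q. \<bar>f q\<bar> \<partial>lborel)"
  define I1 where "I1 = (\<integral>q. \<bar>f1 q\<bar> \<partial>lborel)"
  define I2 where "I2 = (\<integral>q. \<bar>f2 q\<bar> \<partial>lborel)"
  define K where "K = (\<integral>q. \<bar>f12 q\<bar> \<partial>lborel)"
  define D1 where "D1 = I1 / (d - c) + K"
  define D2 where "D2 = I2 / (b - a) + K"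
  have dx: "\<bar>v (x2, y) - v (x1, y)\<bar> \<le> D1" if "x1 \<in> {a..b}" "x2 \<in> {a..b}" for x1 x2 y
    using difference_x_bound[OF R that, of y] cd
    by (simp add: D1_def I1_def[symmetric] K_def[symmetric] field_simps)
  have dy: "\<bar>v (x, y2) - v (x, y1)\<bar> \<le> D2" if "y1 \<in> {c..d}" "y2 \<in> {c..d}" for x y1 y2
    using difference_y_bound[OF R that, of x] ab
    by (simp add: D2_def I2_def[symmetric] K_def[symmetric] field_simps)
  have "(b - a) * (d - c) * (\<bar>v (x, y)\<bar> - D1 - D2) = (\<integral>q. indicator Om q * (\<bar>v (x, y)\<bar> - D1 - D2) \<partial>lborel)"
    using measure_Om(2) by simp
  also have "\<dots> \<le> (\<integral>q. \<bar>f q\<bar> \<partial>lborel)"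
  proof (rule integral_mono_AE)
    show "integrable lborel (\<lambda>q. indicator Om q * (\<bar>v (x, y)\<bar> - D1 - D2))"
      using measure_Om(1) by simp
    show "AE q in lborel. indicator Om q * (\<bar>v (x, y)\<bar> - D1 - D2) \<le> \<bar>f q\<bar>"
      using v
    proof (rule eventually_mono)
      fix q assume q: "q \<in> Om \<longrightarrow> f q = v q"
      show "indicator Om q * (\<bar>v (x, y)\<bar> - D1 - D2) \<le> \<bar>f q\<bar>"
      proof (cases "q \<in> Om")
        case True
        then obtain x' y' where q': "q = (x', y')" "x' \<in> {a..b}" "y' \<in> {c..d}" by (auto simp: Om_def)
        show ?thesis
          using dx[OF q'(2) p(1), of y] dy[OF q'(3) p(2), of x'] q True by (simp add: q'(1))
      qed simp
    qed
  qed (rule fi)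
  finally have "(b - a) * (d - c) * (\<bar>v (x, y)\<bar> - D1 - D2) \<le> I" by (simp add: I_def)
  moreover have "h * k * (V - (I1 / k + K) - (I2 / h + K)) = h * k * V - h * I1 - k * I2 - 2 * h * k * K"
    if "h \<noteq> 0" "k \<noteq> 0" for h k V using that by (simp add: field_simps)
  ultimately show ?thesis
    using ab cd unfolding I_def[symmetric] I1_def[symmetric] I2_def[symmetric] K_def[symmetric] D1_def D2_def
    by simp
qed

subsection \<open>Differentiability\<close>

text \<open>True on almost every line by absolute continuity, and then on every line of the closed
  rectangle, since both sides are continuous in y.\<close>

lemma represents_integral_x:
  assumes R: "represents v f f1 f2 f12" and R1: "represents v1 f1 g1 g2 g12"
    and x: "a \<le> x1" "x1 \<le> x2" "x2 \<le> b" and y: "y \<in> {c..d}"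
  shows "v (x2, y) - v (x1, y) = integral {x1..x2} (\<lambda>s. v1 (s, y))"
proof (rule AE_eq_imp_eq_Icc[OF cd _ _ _ y])
  have L: "L1 f" "L1 f1" and w: "weak_x f f1"
    and v: "continuous_on UNIV v" "AE p in lborel. p \<in> Om \<longrightarrow> f p = v p"
    using R by (auto simp: represents_def)
  have v1: "continuous_on UNIV v1" "AE p in lborel. p \<in> Om \<longrightarrow> f1 p = v1 p"
    using R1 by (auto simp: represents_def)
  show "continuous_on {c..d} (\<lambda>y. v (x2, y) - v (x1, y))"
    by (intro continuous_intros continuous_on_compose2[OF v(1)]) auto
  have "continuous_on {c..d} (\<lambda>y. integral (cbox x1 x2) (\<lambda>s. v1 (s, y)))"
    by (rule integral_continuous_on_param)
      (auto simp: case_prod_unfold intro!: continuous_intros continuous_on_compose2[OF v1(1)])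
  then show "continuous_on {c..d} (\<lambda>y. integral {x1..x2} (\<lambda>s. v1 (s, y)))" by simp
  have cont: "continuous_on {x1..x2} (\<lambda>s. v1 (s, y))" for y
    by (rule continuous_on_compose2[OF v1(1)]) (auto intro!: continuous_intros)
  show "AE y in lborel. y \<in> {c<..<d} \<longrightarrow> v (x2, y) - v (x1, y) = integral {x1..x2} (\<lambda>s. v1 (s, y))"
    using weak_x_absolutely_continuous[OF L w v] AE_pair_plane(2)[OF v1(2)]
  proof (eventually_elim, intro impI)
    fix y assume 1: "y \<in> {c<..<d} \<longrightarrow> integrable lborel (\<lambda>s. f1 (s, y)) \<and>
      (\<forall>x1\<in>{a..b}. \<forall>x2\<in>{a..b}. v (x2, y) - v (x1, y) = prim (\<lambda>s. f1 (s, y)) x2 - prim (\<lambda>s. f1 (s, y)) x1)"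
      and 2: "AE x in lborel. (x, y) \<in> Om \<longrightarrow> f1 (x, y) = v1 (x, y)" and y: "y \<in> {c<..<d}"
    have "prim (\<lambda>s. f1 (s, y)) x2 - prim (\<lambda>s. f1 (s, y)) x1 = integral {x1..x2} (\<lambda>s. v1 (s, y))"
    proof (rule prim_diff_eq_integral[OF _ cont _ x])
      show "AE s in lborel. s \<in> {a<..<b} \<longrightarrow> f1 (s, y) = v1 (s, y)"
        using 2 y by (auto simp: Om_def)
    qed (use 1 y in blast)
    then show "v (x2, y) - v (x1, y) = integral {x1..x2} (\<lambda>s. v1 (s, y))"
      using 1 y x by auto
  qed
qed

lemma represents_DERIV_x:
  assumes R: "represents v f f1 f2 f12" and R1: "represents v1 f1 g1 g2 g12"
    and x: "x \<in> {a..b}" and y: "y \<in> {c..d}"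
  shows "((\<lambda>x. v (x, y)) has_real_derivative v1 (x, y)) (at x within {a..b})"
proof -
  have v1: "continuous_on UNIV v1" using R1 by (auto simp: represents_def)
  have cont: "continuous_on {a..b} (\<lambda>s. v1 (s, y))" for y
    by (rule continuous_on_compose2[OF v1(1)]) (auto intro!: continuous_intros)
  have "((\<lambda>x. v (a, y) + integral {a..x} (\<lambda>s. v1 (s, y))) has_real_derivative v1 (x, y)) (at x within {a..b})"
    using integral_has_real_derivative[OF cont x, of y] by (auto intro!: derivative_eq_intros)
  then show ?thesis
  proof (rule has_field_derivative_transform_within[OF _ zero_less_one x])
    fix x' assume "x' \<in> {a..b}"
    then show "v (a, y) + integral {a..x'} (\<lambda>s. v1 (s, y)) = v (x', y)"
      using represents_integral_x[OF R R1, of a x' y] y by auto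
  qed
qed

lemma represents_DERIV_y:
  assumes R: "represents v f f1 f2 f12" and R2: "represents v2 f2 g1 g2 g12"
    and x: "x \<in> {a..b}" and y: "y \<in> {c..d}"
  shows "((\<lambda>y. v (x, y)) has_real_derivative v2 (x, y)) (at y within {c..d})"
  using rectangle.represents_DERIV_x[OF rectangle_swap represents_swap[OF R] represents_swap[OF R2] y x] by simp

proposition represents_C1_on:
  assumes R: "represents v f f1 f2 f12" and R1: "represents v1 f1 g1 g2 g12" and R2: "represents v2 f2 k1 k2 k12"
  shows "C1_on ({a..b} \<times> {c..d}) v"
  unfolding C1_on_def
proof (intro exI conjI ballI)
  have cont: "continuous_on UNIV v1" "continuous_on UNIV v2"
    using R1 R2 by (auto simp: represents_def)
  then show "continuous_on ({a..b} \<times> {c..d}) v1" "continuous_on ({a..b} \<times> {c..d}) v2"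
    by (auto elim: continuous_on_subset)
  fix p assume "p \<in> {a..b} \<times> {c..d}"
  then obtain x y where p: "p = (x, y)" "x \<in> {a..b}" "y \<in> {c..d}" by auto
  have "((\<lambda>(x, y). v (x, y)) has_derivative (\<lambda>(tx, ty). v1 (x, y) * tx + blinfun_scaleR_right (v2 (x, y)) ty))
      (at (x, y) within {a..b} \<times> {c..d})"
  \<comment> \<open>The rule asks for a partial derivative in y that is continuous as a map into
    linear operators, which is why \<open>v2\<close> is wrapped as a bounded linear
    function.\<close>
  proof (rule has_derivative_partialsI[where fy = "\<lambda>x y. blinfun_scaleR_right (v2 (x, y))"])
    show "((\<lambda>x. v (x, y)) has_derivative (*) (v1 (x, y))) (at x within {a..b})"
      using represents_DERIV_x[OF R R1 p(2,3)] by (simp add: has_field_derivative_def)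
    show "((\<lambda>y. v (x, y)) has_derivative blinfun_apply (blinfun_scaleR_right (v2 (x, y)))) (at y within {c..d})"
      if "x \<in> {a..b}" "y \<in> {c..d}" for x y
      using represents_DERIV_y[OF R R2 that] by (simp add: has_field_derivative_def real_scaleR_def[abs_def])
    have "continuous_on UNIV (\<lambda>p. blinfun_scaleR_right (v2 p) :: real \<Rightarrow>\<^sub>L real)"
      by (rule bounded_linear.continuous_on[OF bounded_linear_blinfun_scaleR_right cont(2)])
    then show "continuous (at (x, y) within {a..b} \<times> {c..d}) (\<lambda>(x, y). blinfun_scaleR_right (v2 (x, y)) :: real \<Rightarrow>\<^sub>L real)"
      by (simp add: case_prod_unfold continuous_on_eq_continuous_at continuous_at_imp_continuous_at_within)
  qed (use p in auto)
  then show "(v has_derivative (\<lambda>h. v1 p * fst h + v2 p * snd h)) (at p within {a..b} \<times> {c..d})"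
    by (simp add: p(1) case_prod_unfold)
qed

subsection \<open>Square integrable functions and the Poincare inequality\<close>

definition L2 :: "(plane \<Rightarrow> real) \<Rightarrow> bool" where
  "L2 f \<longleftrightarrow> L1 f \<and> integrable lborel (\<lambda>p. (f p)\<^sup>2)"

definition l2 :: "(plane \<Rightarrow> real) \<Rightarrow> real" where
  "l2 f = sqrt (\<integral>p. (f p)\<^sup>2 \<partial>lborel)"

lemma l2_nonneg: "0 \<le> l2 f"
  by (simp add: l2_def)

lemma l2_power2: "(l2 f)\<^sup>2 = (\<integral>p. (f p)\<^sup>2 \<partial>lborel)"
  by (simp add: l2_def)

lemma L1_norm_le_l2:
  assumes "L2 f" shows "(\<integral>p. \<bar>f p\<bar> \<partial>lborel) \<le> sqrt ((b - a) * (d - c)) * l2 f"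
proof -
  have e: "emeasure lborel Om < \<infinity>"
    using measure_Om(1) by (subst (asm) integrable_indicator_iff) (auto simp: less_top)
  have m: "measure lborel Om = (b - a) * (d - c)"
    using measure_Om(2) by simp
  have "(\<integral>p. \<bar>f p\<bar> \<partial>lborel)\<^sup>2 \<le> measure lborel Om * (\<integral>p. (f p)\<^sup>2 \<partial>lborel)"
    using assms e by (intro Cauchy_Schwarz_indicator) (auto simp: L2_def L1_def)
  then have "(\<integral>p. \<bar>f p\<bar> \<partial>lborel) \<le> sqrt ((b - a) * (d - c) * (\<integral>p. (f p)\<^sup>2 \<partial>lborel))"
    unfolding m by (rule real_le_rsqrt)
  then show ?thesis by (simp add: l2_def real_sqrt_mult)
qed

text \<open>Cauchy-Schwarz on each horizontal line, followed by Fubini.\<close>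

lemma line_L1_bound:
  assumes f: "L2 f"
  shows "(\<integral>y. (\<integral>s. \<bar>f (s, y)\<bar> \<partial>lborel)\<^sup>2 \<partial>lborel) \<le> (b - a) * (\<integral>p. (f p)\<^sup>2 \<partial>lborel)"
    and "integrable lborel (\<lambda>y. (\<integral>s. \<bar>f (s, y)\<bar> \<partial>lborel)\<^sup>2)"
proof -
  have fi: "integrable lborel f" and f2: "integrable lborel (\<lambda>p. (f p)\<^sup>2)" using f by (auto simp: L2_def L1_def)
  have fa: "integrable lborel (\<lambda>p. \<bar>f p\<bar>)" using fi by simp
  have m: "(\<lambda>y. (\<integral>s. \<bar>f (s, y)\<bar> \<partial>lborel)\<^sup>2) \<in> borel_measurable lborel"
    by (intro borel_measurable_power borel_measurable_integrable fubini_plane(5)[OF fa])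
  have pt: "AE y in lborel. (\<integral>s. \<bar>f (s, y)\<bar> \<partial>lborel)\<^sup>2 \<le> (b - a) * (\<integral>s. (f (s, y))\<^sup>2 \<partial>lborel)"
    using fubini_plane(4)[OF fi] fubini_plane(4)[OF f2]
  proof eventually_elim
    fix y assume i: "integrable lborel (\<lambda>s. f (s, y))" "integrable lborel (\<lambda>s. (f (s, y))\<^sup>2)"
    have "(\<integral>s. \<bar>f (s, y)\<bar> \<partial>lborel)\<^sup>2 \<le> measure lborel {a<..<b} * (\<integral>s. (f (s, y))\<^sup>2 \<partial>lborel)"
    proof (rule Cauchy_Schwarz_indicator[OF i])
      show "emeasure lborel {a<..<b} < \<infinity>" using ab by simp
      show "f (s, y) = 0" if "s \<notin> {a<..<b}" for s
        using f that by (auto simp: L2_def L1_def Om_def)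
    qed simp
    then show "(\<integral>s. \<bar>f (s, y)\<bar> \<partial>lborel)\<^sup>2 \<le> (b - a) * (\<integral>s. (f (s, y))\<^sup>2 \<partial>lborel)"
      using ab by simp
  qed
  have i2: "integrable lborel (\<lambda>y. (b - a) * (\<integral>s. (f (s, y))\<^sup>2 \<partial>lborel))"
    using fubini_plane(5)[OF f2] by simp
  show i: "integrable lborel (\<lambda>y. (\<integral>s. \<bar>f (s, y)\<bar> \<partial>lborel)\<^sup>2)"
  proof (rule Bochner_Integration.integrable_bound[OF i2 m])
    show "AE y in lborel. norm ((\<integral>s. \<bar>f (s, y)\<bar> \<partial>lborel)\<^sup>2) \<le> norm ((b - a) * (\<integral>s. (f (s, y))\<^sup>2 \<partial>lborel))"
      using pt by eventually_elim (use ab in simp)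
  qed
  have "(\<integral>y. (\<integral>s. \<bar>f (s, y)\<bar> \<partial>lborel)\<^sup>2 \<partial>lborel) \<le> (\<integral>y. (b - a) * (\<integral>s. (f (s, y))\<^sup>2 \<partial>lborel) \<partial>lborel)"
    by (rule integral_mono_AE[OF i i2 pt])
  then show "(\<integral>y. (\<integral>s. \<bar>f (s, y)\<bar> \<partial>lborel)\<^sup>2 \<partial>lborel) \<le> (b - a) * (\<integral>p. (f p)\<^sup>2 \<partial>lborel)"
    using fubini_plane(6)[OF f2] by simp
qed

text \<open>Two comparisons. On a good line W differs from its line mean by at most twice the line
  integral of |f|. The line integrals of W in turn vary around a constant \<mu> by at most the L^1
  norm of g, and the vanishing total mean bounds \<mu> by the same quantity. The inequality is
  multiplied by b - a, so that integrals can stand in for means.\<close>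

lemma mean_zero_pointwise_bound:
  assumes W: "L1 W" and f: "L1 f" and g: "L1 g" and wx: "weak_x W f" and wy: "weak_y W g"
    and mean: "(\<integral>p. W p \<partial>lborel) = 0"
  shows "AE p in lborel. p \<in> Om \<longrightarrow>
    (b - a) * \<bar>W p\<bar> \<le> 2 * (b - a) * (\<integral>s. \<bar>f (s, snd p)\<bar> \<partial>lborel) + 2 * (\<integral>q. \<bar>g q\<bar> \<partial>lborel)"
proof -
  define F where "F y = (\<integral>s. \<bar>f (s, y)\<bar> \<partial>lborel)" for y
  define G where "G x = (\<integral>t. \<bar>g (x, t)\<bar> \<partial>lborel)" for x
  define wb where "wb y = (\<integral>x. W (x, y) \<partial>lborel)" for y
  define \<Gamma> where "\<Gamma> = (\<integral>q. \<bar>g q\<bar> \<partial>lborel)"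
  have Wi: "integrable lborel W" and fi: "integrable lborel f" and gi: "integrable lborel g"
    using W f g by (auto simp: L1_def)
  have fa: "integrable lborel (\<lambda>p. \<bar>f p\<bar>)" and ga: "integrable lborel (\<lambda>p. \<bar>g p\<bar>)"
    using fi gi by auto
  have Wz: "W (x, y) = 0" if "x \<notin> {a<..<b} \<or> y \<notin> {c<..<d}" for x y
    using W that by (auto simp: L1_def Om_def)
  obtain m where m: "AE p in lborel. p \<in> Om \<longrightarrow> W p = m (snd p) + prim (\<lambda>s. f (s, snd p)) (fst p)"
    using weak_x_representation[OF W f wx] by blast
  obtain m2 where m2: "integrable lborel m2"
      "AE p in lborel. p \<in> Om \<longrightarrow> W p = m2 (fst p) + prim (\<lambda>t. g (fst p, t)) (snd p)"
    using weak_y_representation[OF W g wy] by blast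
  have 1: "AE y in lborel. y \<in> {c<..<d} \<longrightarrow>
      (AE x in lborel. x \<in> {a<..<b} \<longrightarrow> \<bar>(b - a) * W (x, y) - wb y\<bar> \<le> 2 * ((b - a) * F y))"
    using AE_pair_plane(2)[OF m] fubini_plane(4)[OF Wi] fubini_plane(4)[OF fi]
  proof (eventually_elim, intro impI)
    fix y assume rep: "AE x in lborel. (x, y) \<in> Om \<longrightarrow> W (x, y) = m (snd (x, y)) + prim (\<lambda>s. f (s, snd (x, y))) (fst (x, y))"
      and Wy: "integrable lborel (\<lambda>x. W (x, y))" and fy: "integrable lborel (\<lambda>x. f (x, y))" and y: "y \<in> {c<..<d}"
    have ae: "AE x in lborel. x \<in> {a<..<b} \<longrightarrow> \<bar>W (x, y) - m y\<bar> \<le> F y"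
      using rep
    proof eventually_elim
      fix x assume "(x, y) \<in> Om \<longrightarrow> W (x, y) = m (snd (x, y)) + prim (\<lambda>s. f (s, snd (x, y))) (fst (x, y))"
      then show "x \<in> {a<..<b} \<longrightarrow> \<bar>W (x, y) - m y\<bar> \<le> F y"
        using prim_bound[OF fy, of x] y by (auto simp: Om_def F_def)
    qed
    have i: "integrable lborel (\<lambda>x. W (x, y) - indicator {a<..<b} x * m y)"
      using Wy integrable_indicator_Ioo[of a b] by simp
    have "wb y - (b - a) * m y = (\<integral>x. W (x, y) - indicator {a<..<b} x * m y \<partial>lborel)"
      using Wy integrable_indicator_Ioo[of a b] ab by (simp add: wb_def)
    moreover have "\<bar>\<integral>x. W (x, y) - indicator {a<..<b} x * m y \<partial>lborel\<bar> \<le> (\<integral>x. \<bar>W (x, y) - indicator {a<..<b} x * m y\<bar> \<partial>lborel)"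
      by (rule integral_abs_bound)
    moreover have "(\<integral>x. \<bar>W (x, y) - indicator {a<..<b} x * m y\<bar> \<partial>lborel) \<le> (\<integral>x. indicator {a<..<b} x * F y \<partial>lborel)"
    proof (rule integral_mono_AE[OF integrable_abs[OF i]])
      show "AE x in lborel. \<bar>W (x, y) - indicator {a<..<b} x * m y\<bar> \<le> indicator {a<..<b} x * F y"
        using ae by eventually_elim (use Wz in \<open>auto simp: indicator_def\<close>)
    qed (use integrable_indicator_Ioo[of a b] in simp)
    moreover have "(\<integral>x. indicator {a<..<b} x * F y \<partial>lborel) = (b - a) * F y"
      using ab by simp
    ultimately have wbm: "\<bar>wb y - (b - a) * m y\<bar> \<le> (b - a) * F y" by linarith
    show "AE x in lborel. x \<in> {a<..<b} \<longrightarrow> \<bar>(b - a) * W (x, y) - wb y\<bar> \<le> 2 * ((b - a) * F y)"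
      using ae
    proof (eventually_elim, intro impI)
      fix x assume "x \<in> {a<..<b} \<longrightarrow> \<bar>W (x, y) - m y\<bar> \<le> F y" and "x \<in> {a<..<b}"
      then have "(b - a) * \<bar>W (x, y) - m y\<bar> \<le> (b - a) * F y" using ab by simp
      moreover have "(b - a) * \<bar>W (x, y) - m y\<bar> = \<bar>(b - a) * W (x, y) - (b - a) * m y\<bar>"
        using ab by (simp add: right_diff_distrib[symmetric] abs_mult)
      ultimately show "\<bar>(b - a) * W (x, y) - wb y\<bar> \<le> 2 * ((b - a) * F y)"
        using wbm by linarith
    qed
  qed
  \<comment> \<open>Integrating the representation of W in y-direction over x shows that every line
    integral \<open>wb y\<close> is close to this number.\<close>
  define \<mu> where "\<mu> = (\<integral>x. indicator {a<..<b} x * m2 x \<partial>lborel)"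
  have im2: "integrable lborel (\<lambda>x. indicator {a<..<b} x * m2 x)"
    using integrable_mult_indicator[OF _ m2(1), of "{a<..<b}"] by simp
  have iG: "integrable lborel G" unfolding G_def by (rule fubini_plane(2)[OF ga])
  have Gint: "(\<integral>x. G x \<partial>lborel) = \<Gamma>" unfolding G_def \<Gamma>_def by (rule fubini_plane(3)[OF ga])
  have gx: "AE x in lborel. integrable lborel (\<lambda>t. g (x, t))" by (rule fubini_plane(1)[OF gi])
  have 2: "AE y in lborel. y \<in> {c<..<d} \<longrightarrow> \<bar>wb y - \<mu>\<bar> \<le> \<Gamma>"
    using AE_pair_plane(2)[OF m2(2)] fubini_plane(4)[OF Wi]
  proof (eventually_elim, intro impI)
    fix y assume rep: "AE x in lborel. (x, y) \<in> Om \<longrightarrow> W (x, y) = m2 (fst (x, y)) + prim (\<lambda>t. g (fst (x, y), t)) (snd (x, y))"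
      and Wy: "integrable lborel (\<lambda>x. W (x, y))" and y: "y \<in> {c<..<d}"
    have i: "integrable lborel (\<lambda>x. W (x, y) - indicator {a<..<b} x * m2 x)"
      using Wy im2 by simp
    have "wb y - \<mu> = (\<integral>x. W (x, y) - indicator {a<..<b} x * m2 x \<partial>lborel)"
      using Wy im2 by (simp add: wb_def \<mu>_def)
    moreover have "\<bar>\<integral>x. W (x, y) - indicator {a<..<b} x * m2 x \<partial>lborel\<bar> \<le> (\<integral>x. \<bar>W (x, y) - indicator {a<..<b} x * m2 x\<bar> \<partial>lborel)"
      by (rule integral_abs_bound)
    moreover have "(\<integral>x. \<bar>W (x, y) - indicator {a<..<b} x * m2 x\<bar> \<partial>lborel) \<le> (\<integral>x. G x \<partial>lborel)"
    proof (rule integral_mono_AE[OF integrable_abs[OF i] iG])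
      show "AE x in lborel. \<bar>W (x, y) - indicator {a<..<b} x * m2 x\<bar> \<le> G x"
        using rep gx
      proof eventually_elim
        fix x assume *: "(x, y) \<in> Om \<longrightarrow> W (x, y) = m2 (fst (x, y)) + prim (\<lambda>t. g (fst (x, y), t)) (snd (x, y))"
          and gx: "integrable lborel (\<lambda>t. g (x, t))"
        have "0 \<le> G x" by (simp add: G_def)
        then show "\<bar>W (x, y) - indicator {a<..<b} x * m2 x\<bar> \<le> G x"
          using * prim_bound[OF gx, of y] y Wz[of x y] by (auto simp: Om_def G_def indicator_def)
      qed
    qed
    ultimately show "\<bar>wb y - \<mu>\<bar> \<le> \<Gamma>" using Gint by linarith
  qed
  have iwb: "integrable lborel wb" unfolding wb_def by (rule fubini_plane(5)[OF Wi])
  have wb0: "(\<integral>y. wb y \<partial>lborel) = 0" unfolding wb_def using fubini_plane(6)[OF Wi] mean by simp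
  have wbz: "wb y = 0" if "y \<notin> {c<..<d}" for y
    using Wz that by (simp add: wb_def)
  \<comment> \<open>The integral of \<open>wb\<close> over all heights is zero, so the constant that
    it stays close to is small as well.\<close>
  have mu: "\<bar>\<mu>\<bar> \<le> \<Gamma>"
  proof -
    have i: "integrable lborel (\<lambda>y. indicator {c<..<d} y * \<mu> - wb y)"
      using iwb integrable_indicator_Ioo[of c d] by simp
    have "(d - c) * \<mu> = (\<integral>y. indicator {c<..<d} y * \<mu> - wb y \<partial>lborel)"
      using iwb integrable_indicator_Ioo[of c d] cd wb0 by simp
    moreover have "\<bar>\<integral>y. indicator {c<..<d} y * \<mu> - wb y \<partial>lborel\<bar> \<le> (\<integral>y. \<bar>indicator {c<..<d} y * \<mu> - wb y\<bar> \<partial>lborel)"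
      by (rule integral_abs_bound)
    moreover have "(\<integral>y. \<bar>indicator {c<..<d} y * \<mu> - wb y\<bar> \<partial>lborel) \<le> (\<integral>y. indicator {c<..<d} y * \<Gamma> \<partial>lborel)"
    proof (rule integral_mono_AE[OF integrable_abs[OF i]])
      show "AE y in lborel. \<bar>indicator {c<..<d} y * \<mu> - wb y\<bar> \<le> indicator {c<..<d} y * \<Gamma>"
        using 2 by eventually_elim (use wbz in \<open>auto simp: indicator_def abs_minus_commute\<close>)
    qed (use integrable_indicator_Ioo[of c d] in simp)
    moreover have "(\<integral>y. indicator {c<..<d} y * \<Gamma> \<partial>lborel) = (d - c) * \<Gamma>"
      using cd by simp
    ultimately have "\<bar>(d - c) * \<mu>\<bar> \<le> (d - c) * \<Gamma>" by linarith
    then show ?thesis using cd by (simp add: abs_mult)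
  qed
  have "AE y in lborel. AE x in lborel. (x, y) \<in> Om \<longrightarrow> (b - a) * \<bar>W (x, y)\<bar> \<le> 2 * (b - a) * F y + 2 * \<Gamma>"
    using 1 2
  proof eventually_elim
    fix y assume A: "y \<in> {c<..<d} \<longrightarrow> (AE x in lborel. x \<in> {a<..<b} \<longrightarrow> \<bar>(b - a) * W (x, y) - wb y\<bar> \<le> 2 * ((b - a) * F y))"
      and B: "y \<in> {c<..<d} \<longrightarrow> \<bar>wb y - \<mu>\<bar> \<le> \<Gamma>"
    show "AE x in lborel. (x, y) \<in> Om \<longrightarrow> (b - a) * \<bar>W (x, y)\<bar> \<le> 2 * (b - a) * F y + 2 * \<Gamma>"
    proof (cases "y \<in> {c<..<d}")
      case True
      with A have "AE x in lborel. x \<in> {a<..<b} \<longrightarrow> \<bar>(b - a) * W (x, y) - wb y\<bar> \<le> 2 * ((b - a) * F y)" by blast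
      then show ?thesis
      proof (eventually_elim, intro impI)
        fix x assume "x \<in> {a<..<b} \<longrightarrow> \<bar>(b - a) * W (x, y) - wb y\<bar> \<le> 2 * ((b - a) * F y)" "(x, y) \<in> Om"
        then have "\<bar>(b - a) * W (x, y) - wb y\<bar> \<le> 2 * ((b - a) * F y)" by (auto simp: Om_def)
        moreover have "\<bar>wb y - \<mu>\<bar> \<le> \<Gamma>" using B True by blast
        moreover have "(b - a) * \<bar>W (x, y)\<bar> = \<bar>(b - a) * W (x, y)\<bar>" using ab by (simp add: abs_mult)
        ultimately show "(b - a) * \<bar>W (x, y)\<bar> \<le> 2 * (b - a) * F y + 2 * \<Gamma>" using mu by linarith
      qed
    next
      case False
      then show ?thesis by (intro AE_I2) (auto simp: Om_def)
    qed
  qed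
  then have *: "AE y in lborel. AE x in lborel. (x, y) \<in> Om \<longrightarrow> (b - a) * \<bar>W (x, y)\<bar> \<le> 2 * (b - a) * F y + 2 * \<Gamma>" .
  \<comment> \<open>The exceptional sets are taken first in y and then in x, so the product
    statement is formed with exchanged coordinates and swapped back at the end.\<close>
  have "AE p in lborel \<Otimes>\<^sub>M lborel. (snd p, fst p) \<in> Om \<longrightarrow> (b - a) * \<bar>W (snd p, fst p)\<bar> \<le> 2 * (b - a) * F (fst p) + 2 * \<Gamma>"
  proof (rule lborel_pair.AE_pair_measure)
    have [measurable]: "F \<in> borel_measurable borel" "W \<in> borel_measurable (borel \<Otimes>\<^sub>M borel)"
      using borel_measurable_integrable[OF fubini_plane(5)[OF fa]] L1_measurable[OF W]
      by (simp_all add: F_def[abs_def] borel_prod)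
    have [measurable]: "Om \<in> sets (borel \<Otimes>\<^sub>M borel)" unfolding borel_prod by (rule Om_borel)
    have "{p \<in> space (borel \<Otimes>\<^sub>M borel). (snd p, fst p) \<in> Om \<longrightarrow> (b - a) * \<bar>W (snd p, fst p)\<bar> \<le> 2 * (b - a) * F (fst p) + 2 * \<Gamma>}
        \<in> sets (borel \<Otimes>\<^sub>M borel)" by measurable
    then show "{p \<in> space (lborel \<Otimes>\<^sub>M lborel). (snd p, fst p) \<in> Om \<longrightarrow> (b - a) * \<bar>W (snd p, fst p)\<bar> \<le> 2 * (b - a) * F (fst p) + 2 * \<Gamma>}
        \<in> sets (lborel \<Otimes>\<^sub>M lborel)" by (simp add: space_pair_measure)
  qed (use * in simp)
  then have "AE p in lborel. (snd p, fst p) \<in> Om \<longrightarrow> (b - a) * \<bar>W (snd p, fst p)\<bar> \<le> 2 * (b - a) * F (fst p) + 2 * \<Gamma>"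
    by (subst (asm) lborel_prod)
  from AE_swap_plane[OF this] show ?thesis by (simp add: F_def \<Gamma>_def)
qed

text \<open>The pointwise bound is squared and integrated. Each derivative keeps the side length of
  its own direction: the line integral of |f| picks up b - a, and the L^1 norm of g divided by b - a
  is integrated over the whole area. The constant comes from (2s + 2t)^2 <= 8s^2 + 8t^2 and 8 <=
  3^2.\<close>

proposition poincare:
  assumes W: "L2 W" and f: "L2 f" and g: "L2 g" and wx: "weak_x W f" and wy: "weak_y W g"
    and mean: "(\<integral>p. W p \<partial>lborel) = 0"
  shows "l2 W \<le> 3 * ((b - a) * l2 f + (d - c) * l2 g)"
proof -
  define h where "h = b - a"
  define k where "k = d - c"
  have hk: "h > 0" "k > 0" using ab cd by (auto simp: h_def k_def)
  define F where "F y = (\<integral>s. \<bar>f (s, y)\<bar> \<partial>lborel)" for y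
  define \<Gamma> where "\<Gamma> = (\<integral>q. \<bar>g q\<bar> \<partial>lborel)"
  have iF: "integrable lborel (\<lambda>y. (F y)\<^sup>2)" and F: "(\<integral>y. (F y)\<^sup>2 \<partial>lborel) \<le> h * (l2 f)\<^sup>2"
    using line_L1_bound[OF f] by (simp_all add: F_def l2_power2 h_def)
  have G: "\<Gamma>\<^sup>2 \<le> h * k * (l2 g)\<^sup>2"
  proof -
    have "\<Gamma> \<le> sqrt (h * k) * l2 g"
      using L1_norm_le_l2[OF g] by (simp add: \<Gamma>_def h_def k_def)
    moreover have "\<Gamma> \<ge> 0" by (simp add: \<Gamma>_def)
    ultimately have "\<Gamma>\<^sup>2 \<le> (sqrt (h * k) * l2 g)\<^sup>2" by (rule power_mono)
    then show ?thesis using hk by (simp add: power_mult_distrib)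
  qed
  have L: "L1 W" "L1 f" "L1 g" using W f g by (auto simp: L2_def)
  define U where "U p = indicator {a<..<b} (fst p) * (indicator {c<..<d} (snd p) * (8 * \<Gamma>\<^sup>2 / h\<^sup>2) + 8 * (F (snd p))\<^sup>2)" for p
  have iu: "integrable lborel (\<lambda>y. indicator {c<..<d} y * (8 * \<Gamma>\<^sup>2 / h\<^sup>2) + 8 * (F y)\<^sup>2)"
    using iF integrable_indicator_Ioo[of c d] by simp
  have iU: "integrable lborel U"
    unfolding U_def by (rule integrable_prod_plane(1)[OF integrable_indicator_Ioo iu])
  have "(\<integral>p. U p \<partial>lborel) = h * (k * (8 * \<Gamma>\<^sup>2 / h\<^sup>2) + 8 * (\<integral>y. (F y)\<^sup>2 \<partial>lborel))"
    unfolding U_def integrable_prod_plane(2)[OF integrable_indicator_Ioo iu]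
    using iF integrable_indicator_Ioo[of c d] ab cd by (simp add: h_def k_def)
  moreover have "\<dots> \<le> h * (k * (8 * (h * k * (l2 g)\<^sup>2) / h\<^sup>2) + 8 * (h * (l2 f)\<^sup>2))"
    using hk by (intro mult_left_mono add_mono divide_right_mono F G) auto
  moreover have "\<dots> = 8 * (h * l2 f)\<^sup>2 + 8 * (k * l2 g)\<^sup>2"
    using hk by (simp add: power2_eq_square field_simps)
  moreover have "(\<integral>p. (W p)\<^sup>2 \<partial>lborel) \<le> (\<integral>p. U p \<partial>lborel)"
  proof (rule integral_mono_AE[OF _ iU])
    show "AE p in lborel. (W p)\<^sup>2 \<le> U p"
      using mean_zero_pointwise_bound[OF L wx wy mean]
    proof eventually_elim
      fix p assume *: "p \<in> Om \<longrightarrow>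
        (b - a) * \<bar>W p\<bar> \<le> 2 * (b - a) * (\<integral>s. \<bar>f (s, snd p)\<bar> \<partial>lborel) + 2 * (\<integral>q. \<bar>g q\<bar> \<partial>lborel)"
      show "(W p)\<^sup>2 \<le> U p"
      proof (cases "p \<in> Om")
        case True
        then have "h * \<bar>W p\<bar> \<le> 2 * h * F (snd p) + 2 * \<Gamma>"
          using * by (simp add: F_def \<Gamma>_def h_def)
        then have "\<bar>W p\<bar> \<le> 2 * F (snd p) + 2 * (\<Gamma> / h)"
          using hk by (simp add: field_simps)
        then have "\<bar>W p\<bar>\<^sup>2 \<le> (2 * F (snd p) + 2 * (\<Gamma> / h))\<^sup>2" by (rule power_mono) simp
        also have "\<dots> \<le> 8 * (F (snd p))\<^sup>2 + 8 * (\<Gamma> / h)\<^sup>2"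
        proof -
          have "(2 * s + 2 * t)\<^sup>2 \<le> 8 * s\<^sup>2 + 8 * t\<^sup>2" for s t :: real
            using zero_le_power2[of "s - t"] by (simp add: power2_eq_square algebra_simps)
          then show ?thesis .
        qed
        finally show ?thesis using True by (simp add: U_def Om_def power_divide mem_Times_iff)
      next
        case False
        then have "W p = 0" using L(1) unfolding L1_def by blast
        then show ?thesis by (simp add: U_def indicator_def)
      qed
    qed
  qed (use W in \<open>simp add: L2_def\<close>)
  ultimately have "(l2 W)\<^sup>2 \<le> 8 * (h * l2 f)\<^sup>2 + 8 * (k * l2 g)\<^sup>2"
    unfolding l2_power2[of W] by linarith
  also have "\<dots> \<le> (3 * (h * l2 f + k * l2 g))\<^sup>2"
  proof -
    have "0 \<le> (h * l2 f) * (k * l2 g)" using hk by (intro mult_nonneg_nonneg l2_nonneg) auto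
    then show ?thesis
      using zero_le_power2[of "h * l2 f"] zero_le_power2[of "k * l2 g"] by (simp add: power2_eq_square algebra_simps)
  qed
  finally have "l2 W \<le> 3 * (h * l2 f + k * l2 g)"
    by (rule power2_le_imp_le) (use hk l2_nonneg in \<open>auto intro!: add_nonneg_nonneg mult_nonneg_nonneg\<close>)
  then show ?thesis by (simp add: h_def k_def)
qed

end

section \<open>Test functions and weak derivatives\<close>

lemma partial_eq_0:
  assumes "p \<notin> closure {p. \<phi> p \<noteq> 0}"
  shows "partial_x \<phi> p = 0" "partial_y \<phi> p = 0"
proof -
  obtain x y where p: "p = (x, y)" by fastforce
  define U where "U = - closure {p. \<phi> p \<noteq> 0}"
  have U: "open U" "p \<in> U" using assms by (auto simp: U_def)
  have z: "\<phi> q = 0" if "q \<in> U" for q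
    using that closure_subset[of "{p. \<phi> p \<noteq> 0}"] by (auto simp: U_def)
  have "continuous_on UNIV (\<lambda>t. (t, y))" "continuous_on UNIV (\<lambda>t. (x, t))"
    by (intro continuous_intros)+
  from this[THEN open_vimage[OF U(1)]]
  have ox: "open {t. (t, y) \<in> U}" and oy: "open {t. (x, t) \<in> U}"
    by (simp_all add: vimage_def)
  have "((\<lambda>t. \<phi> (t, y)) has_real_derivative 0) (at x)"
    by (rule has_field_derivative_transform_within_open[OF DERIV_const ox]) (use U p z in auto)
  moreover have "((\<lambda>t. \<phi> (x, t)) has_real_derivative 0) (at y)"
    by (rule has_field_derivative_transform_within_open[OF DERIV_const oy]) (use U p z in auto)
  ultimately show "partial_x \<phi> p = 0" "partial_y \<phi> p = 0"
    by (auto simp: partial_x_def partial_y_def p intro: DERIV_imp_deriv)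
qed

lemma test_functions_partial:
  assumes "\<phi> \<in> test_functions \<Omega>"
  shows "partial_x \<phi> \<in> test_functions \<Omega>" "partial_y \<phi> \<in> test_functions \<Omega>"
proof -
  have C: "Ck (Suc k) \<phi>" for k using assms unfolding test_functions_def by blast
  have c: "compact (closure {p. \<phi> p \<noteq> 0})" "closure {p. \<phi> p \<noteq> 0} \<subseteq> \<Omega>"
    using assms by (auto simp: test_functions_def)
  have *: "\<psi> \<in> test_functions \<Omega>" if "\<And>k. Ck k \<psi>" "\<And>p. p \<notin> closure {p. \<phi> p \<noteq> 0} \<Longrightarrow> \<psi> p = 0" for \<psi>
  proof -
    have sub: "closure {p. \<psi> p \<noteq> 0} \<subseteq> closure {p. \<phi> p \<noteq> 0}"
      by (rule closure_minimal) (use that(2) in auto)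
    have "bounded {p. \<psi> p \<noteq> 0}"
      by (rule bounded_subset[OF compact_imp_bounded[OF c(1)]]) (use that(2) in auto)
    then show ?thesis using that(1) sub c(2) by (auto simp: test_functions_def compact_closure)
  qed
  show "partial_x \<phi> \<in> test_functions \<Omega>" "partial_y \<phi> \<in> test_functions \<Omega>"
    by (rule *, use C in simp, erule partial_eq_0)+
qed

lemma test_functions_higher_partial:
  assumes "\<phi> \<in> test_functions \<Omega>"
  shows "(partial_x ^^ m) \<phi> \<in> test_functions \<Omega>" "(partial_y ^^ m) \<phi> \<in> test_functions \<Omega>"
  using assms by (induction m) (auto intro: test_functions_partial)

lemma classical_D_test: "\<phi> \<in> test_functions \<Omega> \<Longrightarrow> classical_D \<gamma> \<phi> \<in> test_functions \<Omega>"
  by (simp add: classical_D_def test_functions_higher_partial)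

lemma test_function_continuous: "\<phi> \<in> test_functions \<Omega> \<Longrightarrow> continuous_on S \<phi>"
  unfolding test_functions_def by (auto dest!: spec[of _ 0] intro: continuous_on_subset)

lemma test_function_borel: "\<phi> \<in> test_functions \<Omega> \<Longrightarrow> \<phi> \<in> borel_measurable borel"
  by (intro borel_measurable_continuous_onI test_function_continuous)

lemma test_function_eq_0: "\<phi> \<in> test_functions \<Omega> \<Longrightarrow> p \<notin> \<Omega> \<Longrightarrow> \<phi> p = 0"
  unfolding test_functions_def using closure_subset[of "{p. \<phi> p \<noteq> 0}"] by auto

lemma test_function_bounded:
  assumes "\<phi> \<in> test_functions \<Omega>" obtains K where "\<And>p. \<bar>\<phi> p\<bar> \<le> K"
proof -
  have "compact (\<phi> ` closure {p. \<phi> p \<noteq> 0})"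
    using assms by (intro compact_continuous_image test_function_continuous) (auto simp: test_functions_def)
  then obtain K where K: "K > 0" "\<And>p. p \<in> closure {p. \<phi> p \<noteq> 0} \<Longrightarrow> \<bar>\<phi> p\<bar> \<le> K"
    unfolding compact_eq_bounded_closed bounded_pos by force
  have "\<bar>\<phi> p\<bar> \<le> K" for p
  proof (cases "\<phi> p = 0")
    case False
    then have "p \<in> closure {p. \<phi> p \<noteq> 0}" using closure_subset[of "{p. \<phi> p \<noteq> 0}"] by auto
    then show ?thesis by (rule K(2))
  qed (use K(1) in simp)
  then show ?thesis by (rule that)
qed

lemma test_function_DERIV:
  assumes "\<phi> \<in> test_functions \<Omega>"
  shows "((\<lambda>t. \<phi> (t, y)) has_real_derivative partial_x \<phi> (x, y)) (at x)"
    and "((\<lambda>t. \<phi> (x, t)) has_real_derivative partial_y \<phi> (x, y)) (at y)"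
proof -
  have "Ck (Suc 0) \<phi>" using assms unfolding test_functions_def by blast
  then have d: "\<phi> differentiable (at (x, y))" by simp
  have "(\<lambda>t. \<phi> (t, y)) differentiable (at x)"
    using differentiable_chain_at[of "\<lambda>t. (t, y)" x \<phi>] d by (auto simp: o_def intro!: derivative_intros)
  then show "((\<lambda>t. \<phi> (t, y)) has_real_derivative partial_x \<phi> (x, y)) (at x)"
    by (simp add: partial_x_def DERIV_deriv_iff_real_differentiable)
  have "(\<lambda>t. \<phi> (x, t)) differentiable (at y)"
    using differentiable_chain_at[of "\<lambda>t. (x, t)" y \<phi>] d by (auto simp: o_def intro!: derivative_intros)
  then show "((\<lambda>t. \<phi> (x, t)) has_real_derivative partial_y \<phi> (x, y)) (at y)"
    by (simp add: partial_y_def DERIV_deriv_iff_real_differentiable)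
qed

text \<open>\<open>classical_D\<close> applies the x-derivatives last, so further ones are merged
  without interchanging partial derivatives.\<close>

lemma classical_D_x_left: "classical_D (k, 0) (classical_D \<alpha> \<phi>) = classical_D ((k, 0) + \<alpha>) \<phi>"
  by (simp add: classical_D_def funpow_add)

text \<open>The test functions are C^1 and vanish at the end points, without compact support: slices
  of planar test functions are of this kind.\<close>

definition weak_deriv1 :: "real \<Rightarrow> real \<Rightarrow> (real \<Rightarrow> real) \<Rightarrow> (real \<Rightarrow> real) \<Rightarrow> bool" where
  "weak_deriv1 l r f f' \<longleftrightarrow> f \<in> borel_measurable borel \<and> f' \<in> borel_measurable borel \<and>
     (\<exists>K. \<forall>x\<in>{l<..<r}. \<bar>f x\<bar> \<le> K \<and> \<bar>f' x\<bar> \<le> K) \<and>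
     (\<forall>\<psi> \<psi>'. (\<forall>x. (\<psi> has_real_derivative \<psi>' x) (at x)) \<longrightarrow> continuous_on UNIV \<psi>' \<longrightarrow> \<psi> l = 0 \<longrightarrow> \<psi> r = 0 \<longrightarrow>
       (\<integral>x. indicator {l<..<r} x * f x * \<psi>' x \<partial>lborel) = - (\<integral>x. indicator {l<..<r} x * f' x * \<psi> x \<partial>lborel))"

lemma integrable_bounded_Ioo:
  fixes f :: "real \<Rightarrow> real"
  assumes [measurable]: "f \<in> borel_measurable borel" and K: "\<And>x. x \<in> {l<..<r} \<Longrightarrow> \<bar>f x\<bar> \<le> K"
  shows "integrable lborel (\<lambda>x. indicator {l<..<r} x * f x)"
proof (rule Bochner_Integration.integrable_bound[of lborel "\<lambda>x. indicator {l<..<r} x * K"])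
  show "integrable lborel (\<lambda>x. indicator {l<..<r} x * K)" using integrable_indicator_Ioo[of l r] by simp
  show "AE x in lborel. norm (indicator {l<..<r} x * f x) \<le> norm (indicator {l<..<r} x * K)"
    using K by (intro AE_I2) (force simp: indicator_def)
qed measurable

text \<open>Integration by parts through the fundamental theorem with finitely many exceptional
  points. The exceptional set leaves room for a jump of the derivative at the knot of a
  spline.\<close>

lemma weak_deriv1I:
  assumes lr: "l < r" and "finite S" and f: "continuous_on {l..r} f"
    and f': "\<And>x. x \<in> {l<..<r} - S \<Longrightarrow> (f has_real_derivative f' x) (at x)"
    and [measurable]: "f \<in> borel_measurable borel" "f' \<in> borel_measurable borel"
    and K: "\<And>x. x \<in> {l<..<r} \<Longrightarrow> \<bar>f' x\<bar> \<le> K"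
  shows "weak_deriv1 l r f f'"
  unfolding weak_deriv1_def
proof (intro conjI allI impI)
  have "compact (f ` {l..r})" by (intro compact_continuous_image f) auto
  then obtain K0 where K0: "\<And>x. x \<in> {l..r} \<Longrightarrow> \<bar>f x\<bar> \<le> K0"
    unfolding compact_eq_bounded_closed bounded_iff by force
  show "\<exists>K. \<forall>x\<in>{l<..<r}. \<bar>f x\<bar> \<le> K \<and> \<bar>f' x\<bar> \<le> K"
    using K K0 by (intro exI[of _ "max K K0"]) (auto simp: le_max_iff_disj)
  fix \<psi> \<psi>' :: "real \<Rightarrow> real"
  assume D: "\<forall>x. (\<psi> has_real_derivative \<psi>' x) (at x)" and c': "continuous_on UNIV \<psi>'"
    and z: "\<psi> l = 0" "\<psi> r = 0"
  have c: "continuous_on A \<psi>" for A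
    using D by (auto intro!: continuous_at_imp_continuous_on DERIV_isCont)
  have [measurable]: "\<psi> \<in> borel_measurable borel" "\<psi>' \<in> borel_measurable borel"
    by (auto intro!: borel_measurable_continuous_onI c c')
  have "compact (\<psi> ` {l..r})" "compact (\<psi>' ` {l..r})"
    by (auto intro!: compact_continuous_image c continuous_on_subset[OF c'])
  then obtain K1 K2 where K1: "\<And>x. x \<in> {l..r} \<Longrightarrow> \<bar>\<psi> x\<bar> \<le> K1" and K2: "\<And>x. x \<in> {l..r} \<Longrightarrow> \<bar>\<psi>' x\<bar> \<le> K2"
    unfolding compact_eq_bounded_closed bounded_iff by force
  have i1: "integrable lborel (\<lambda>x. indicator {l<..<r} x * (f x * \<psi>' x))"
    by (rule integrable_bounded_Ioo[where K = "K0 * K2"]) (auto simp: abs_mult intro!: mult_mono K0 K2 order_trans[OF abs_ge_zero K0])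
  have i2: "integrable lborel (\<lambda>x. indicator {l<..<r} x * (f' x * \<psi> x))"
    by (rule integrable_bounded_Ioo[where K = "K * K1"]) (auto simp: abs_mult intro!: mult_mono K K1 order_trans[OF abs_ge_zero K])
  have "((\<lambda>x. f' x * \<psi> x + f x * \<psi>' x) has_integral (f r * \<psi> r - f l * \<psi> l)) {l..r}"
  proof (rule fundamental_theorem_of_calculus_interior_strong[OF \<open>finite S\<close>])
    fix x assume "x \<in> {l<..<r} - S"
    from f'[OF this] D show "((\<lambda>x. f x * \<psi> x) has_vector_derivative f' x * \<psi> x + f x * \<psi>' x) (at x)"
      unfolding has_real_derivative_iff_has_vector_derivative[symmetric]
      by (auto intro!: derivative_eq_intros)
  qed (use lr in \<open>auto intro!: continuous_intros f c\<close>)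
  then have 0: "((\<lambda>x. f' x * \<psi> x + f x * \<psi>' x) has_integral 0) {l<..<r}"
    using has_integral_open_interval[of "\<lambda>x. f' x * \<psi> x + f x * \<psi>' x" 0 l r] z by (simp add: box_real cbox_interval)
  have s: "set_integrable lborel {l<..<r} (\<lambda>x. f' x * \<psi> x + f x * \<psi>' x)"
    using Bochner_Integration.integrable_add[OF i2 i1] by (simp add: set_integrable_def distrib_left)
  have "(\<integral>x. indicator {l<..<r} x * (f' x * \<psi> x) + indicator {l<..<r} x * (f x * \<psi>' x) \<partial>lborel) = 0"
    using set_borel_integral_eq_integral(2)[OF s] integral_unique[OF 0]
    by (simp add: set_lebesgue_integral_def distrib_left)
  then show "(\<integral>x. indicator {l<..<r} x * f x * \<psi>' x \<partial>lborel) = - (\<integral>x. indicator {l<..<r} x * f' x * \<psi> x \<partial>lborel)"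
    using i1 i2 by (simp add: mult.assoc)
qed fact+

section \<open>Square integrable versions and uniqueness of weak derivatives\<close>

context rectangle begin

text \<open>The link between the two settings: f is any function as in the statement, possibly only
  Lebesgue measurable and arbitrary off the open rectangle, and Z is a Borel function on the plane
  to which the earlier results apply.\<close>

definition version :: "(plane \<Rightarrow> real) \<Rightarrow> (plane \<Rightarrow> real) \<Rightarrow> bool" where
  "version f Z \<longleftrightarrow> L2 Z \<and> (AE p in lborel. p \<in> Om \<longrightarrow> f p = Z p)"

lemma Om_lebesgue [simp]: "Om \<in> sets lebesgue"
  using Om_borel by simp

lemma Om_frontier: "AE p in lborel. p \<notin> ({a..b} \<times> {c..d}) - Om"
proof -
  have "AE p in lborel. fst (p :: plane) \<noteq> a \<and> fst p \<noteq> b" "AE p in lborel. snd (p :: plane) \<noteq> c \<and> snd p \<noteq> d"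
    using AE_fst_plane[of "\<lambda>x. x \<noteq> a \<and> x \<noteq> b"] AE_snd_plane[of "\<lambda>x. x \<noteq> c \<and> x \<noteq> d"]
      AE_lborel_singleton[of a] AE_lborel_singleton[of b] AE_lborel_singleton[of c] AE_lborel_singleton[of d]
    by auto
  then show ?thesis by eventually_elim (auto simp: Om_def)
qed

text \<open>S lies between the open rectangle, on which the weak derivatives live, and the closed
  one, over which norms are taken. The difference is a null set.\<close>

lemma version_restrict:
  assumes v: "version f Z" and S: "S \<in> sets lebesgue" "Om \<subseteq> S" "S \<subseteq> {a..b} \<times> {c..d}"
    and [measurable]: "\<psi> \<in> borel_measurable borel"
  shows "f \<in> borel_measurable (lebesgue_on S)"
    and "AE p in lebesgue. indicator S p * f p = Z p"
proof -
  have Z: "L1 Z" using v by (simp add: version_def L2_def)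
  have "AE p in lborel. indicator S p * f p = Z p"
    using v[unfolded version_def, THEN conjunct2] Om_frontier
  proof eventually_elim
    fix p assume "p \<in> Om \<longrightarrow> f p = Z p" "p \<notin> {a..b} \<times> {c..d} - Om"
    then show "indicator S p * f p = Z p"
      using S Z[unfolded L1_def, THEN conjunct2, rule_format, of p]
      by (cases "p \<in> S"; cases "p \<in> Om") auto
  qed
  then show ae: "AE p in lebesgue. indicator S p * f p = Z p" by (rule AE_completion)
  have "Z \<in> borel_measurable lebesgue"
    by (rule measurable_completion) (use L1_measurable[OF Z] in simp)
  then have "(\<lambda>p. indicator S p * f p) \<in> borel_measurable lebesgue"
    by (rule borel_measurable_AE) (use ae in \<open>auto elim: eventually_mono\<close>)
  then show "f \<in> borel_measurable (lebesgue_on S)"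
    using S(1) by (subst borel_measurable_restrict_space_iff) auto
qed

lemma version_integral:
  assumes v: "version f Z" and S: "S \<in> sets lebesgue" "Om \<subseteq> S" "S \<subseteq> {a..b} \<times> {c..d}"
    and [measurable]: "\<psi> \<in> borel_measurable borel"
  shows "(\<integral>p. f p * \<psi> p \<partial>lebesgue_on S) = (\<integral>p. Z p * \<psi> p \<partial>lborel)"
    and "(\<integral>p. (f p)\<^sup>2 \<partial>lebesgue_on S) = (\<integral>p. (Z p)\<^sup>2 \<partial>lborel)"
    and "integrable (lebesgue_on S) (\<lambda>p. (f p)\<^sup>2)"
    and "integrable (lebesgue_on S) f"
proof -
  have Z: "L1 Z" and Z2: "integrable lborel (\<lambda>p. (Z p)\<^sup>2)" using v by (auto simp: version_def L2_def)
  have [measurable]: "Z \<in> borel_measurable borel" by (rule L1_measurable[OF Z])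
  note ae = version_restrict(2)[OF v S borel_measurable_const]
  have m: "(\<lambda>p. indicator S p * f p) \<in> borel_measurable lebesgue"
    using version_restrict(1)[OF v S borel_measurable_const] S(1)
    by (subst (asm) borel_measurable_restrict_space_iff) auto
  have [measurable]: "\<psi> \<in> borel_measurable lebesgue" "Z \<in> borel_measurable lebesgue"
    by (auto intro!: measurable_completion)
  have "(\<integral>p. f p * \<psi> p \<partial>lebesgue_on S) = (\<integral>p. (indicator S p * f p) * \<psi> p \<partial>lebesgue)"
    using S(1) by (subst integral_restrict_space) (auto simp: mult.assoc)
  also have "\<dots> = (\<integral>p. Z p * \<psi> p \<partial>lebesgue)"
    by (rule integral_cong_AE) (use ae m in \<open>auto elim: eventually_mono\<close>)
  also have "\<dots> = (\<integral>p. Z p * \<psi> p \<partial>lborel)" by (rule integral_completion) measurable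
  finally show "(\<integral>p. f p * \<psi> p \<partial>lebesgue_on S) = (\<integral>p. Z p * \<psi> p \<partial>lborel)" .
  have ae2: "AE p in lebesgue. (Z p)\<^sup>2 = indicator S p *\<^sub>R (f p)\<^sup>2"
    using ae by eventually_elim (auto simp: indicator_def split: if_splits)
  have m2: "(\<lambda>p. indicator S p *\<^sub>R (f p)\<^sup>2) \<in> borel_measurable lebesgue"
  proof -
    have "(\<lambda>p. (indicator S p * f p)\<^sup>2) \<in> borel_measurable lebesgue" by (rule borel_measurable_power[OF m])
    also have "(\<lambda>p. (indicator S p * f p)\<^sup>2) = (\<lambda>p. indicator S p *\<^sub>R (f p)\<^sup>2)"
      by (auto simp: indicator_def)
    finally show ?thesis .
  qed
  have "(\<integral>p. (f p)\<^sup>2 \<partial>lebesgue_on S) = (\<integral>p. indicator S p *\<^sub>R (f p)\<^sup>2 \<partial>lebesgue)"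
    using S(1) by (subst integral_restrict_space) auto
  also have "\<dots> = (\<integral>p. (Z p)\<^sup>2 \<partial>lebesgue)"
    by (rule integral_cong_AE) (use ae2 m2 in \<open>auto elim: eventually_mono\<close>)
  also have "\<dots> = (\<integral>p. (Z p)\<^sup>2 \<partial>lborel)" by (rule integral_completion) measurable
  finally show "(\<integral>p. (f p)\<^sup>2 \<partial>lebesgue_on S) = (\<integral>p. (Z p)\<^sup>2 \<partial>lborel)" .
  have "integrable lebesgue (\<lambda>p. (Z p)\<^sup>2)" using Z2 by (simp add: integrable_completion)
  then have "integrable lebesgue (\<lambda>p. indicator S p *\<^sub>R (f p)\<^sup>2)"
    using m2 by (subst integrable_cong_AE[of _ _ "\<lambda>p. (Z p)\<^sup>2"]) (use ae2 in \<open>auto elim: eventually_mono\<close>)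
  then show "integrable (lebesgue_on S) (\<lambda>p. (f p)\<^sup>2)"
    using S(1) by (subst integrable_restrict_space) auto
  have "integrable lebesgue Z" using Z by (simp add: integrable_completion L1_def)
  then have "integrable lebesgue (\<lambda>p. indicator S p * f p)"
    using m by (subst integrable_cong_AE[of _ _ Z]) (use ae in auto)
  then show "integrable (lebesgue_on S) f"
    using S(1) by (subst integrable_restrict_space) auto
qed

lemma Om_subset: "Om \<subseteq> {a..b} \<times> {c..d}"
  by (auto simp: Om_def)

lemma version_L2_space: "version f Z \<Longrightarrow> f \<in> L2_space Om"
  using version_restrict(1)[of f Z Om "\<lambda>p. 0"] version_integral(3)[of f Z Om "\<lambda>p. 0"] Om_subset
  by (simp add: L2_space_def)

lemma version_L2_norm: "version f Z \<Longrightarrow> L2_norm_on ({a..b} \<times> {c..d}) f = l2 Z"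
proof -
  have "{a..b} \<times> {c..d} \<in> sets (borel :: plane measure)" by (intro borel_closed closed_Times) auto
  then show "version f Z \<Longrightarrow> L2_norm_on ({a..b} \<times> {c..d}) f = l2 Z"
    using version_integral(2)[of f Z "{a..b} \<times> {c..d}" "\<lambda>p. 0"] Om_subset by (simp add: L2_norm_on_def l2_def)
qed

text \<open>A Lebesgue measurable function agrees almost everywhere with a Borel function, which is
  then truncated to the rectangle.\<close>

lemma L2_space_version:
  assumes "f \<in> L2_space Om" obtains Z where "version f Z"
proof -
  have f: "f \<in> borel_measurable (lebesgue_on Om)" "integrable (lebesgue_on Om) (\<lambda>p. (f p)\<^sup>2)"
    using assms by (auto simp: L2_space_def)
  have m: "(\<lambda>p. indicator Om p * f p) \<in> borel_measurable lebesgue"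
    using f(1) by (subst (asm) borel_measurable_restrict_space_iff) auto
  then obtain g where g[measurable]: "g \<in> borel_measurable lborel" and ae: "AE p in lborel. indicator Om p * f p = g p"
    using completion_ex_borel_measurable_real by blast
  define Z where "Z p = indicator Om p * g p" for p
  have [measurable]: "Z \<in> borel_measurable borel" using g unfolding Z_def by measurable
  have aeZ: "AE p in lborel. p \<in> Om \<longrightarrow> f p = Z p"
    using ae by eventually_elim (auto simp: Z_def)
  have aeZ2: "AE p in lebesgue. (Z p)\<^sup>2 = indicator Om p *\<^sub>R (f p)\<^sup>2"
    by (rule AE_completion) (use aeZ in \<open>eventually_elim, auto simp: Z_def indicator_def\<close>)
  have i: "integrable lebesgue (\<lambda>p. indicator Om p *\<^sub>R (f p)\<^sup>2)"
    using f(2) by (subst (asm) integrable_restrict_space) auto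
  have "integrable lebesgue (\<lambda>p. (Z p)\<^sup>2)"
    using i by (subst integrable_cong_AE[of _ _ "\<lambda>p. indicator Om p *\<^sub>R (f p)\<^sup>2"])
      (use aeZ2 borel_measurable_integrable[OF i] in \<open>auto intro!: measurable_completion\<close>)
  then have Z2: "integrable lborel (\<lambda>p. (Z p)\<^sup>2)" by (simp add: integrable_completion)
  have "integrable lborel Z"
  proof (rule Bochner_Integration.integrable_bound[OF Bochner_Integration.integrable_add[OF measure_Om(1) Z2]])
    \<comment> \<open>Square integrable functions are integrable because the rectangle has finite
      area.\<close>
    have "\<bar>z\<bar> \<le> 1 + z\<^sup>2" for z :: real
      using zero_le_power2[of "\<bar>z\<bar> - 1"] zero_le_power2[of z] by (simp add: power2_diff)
    then show "AE p in lborel. norm (Z p) \<le> norm (indicator Om p + (Z p)\<^sup>2)"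
      by (intro AE_I2) (auto simp: indicator_def Z_def)
  qed measurable
  then have "L2 Z" using Z2 by (simp add: L2_def L1_def Z_def)
  then show ?thesis using aeZ that by (auto simp: version_def)
qed

lemma version_locally_integrable:
  assumes v: "version f Z" shows "locally_integrable Om f"
  unfolding locally_integrable_def
proof (intro allI impI)
  fix K assume K: "compact K \<and> K \<subseteq> Om"
  have "integrable lebesgue (\<lambda>p. indicator Om p *\<^sub>R f p)"
    using version_integral(4)[OF v Om_lebesgue order_refl Om_subset borel_measurable_const]
    by (subst (asm) integrable_restrict_space) auto
  then have "f absolutely_integrable_on Om" by (simp add: set_integrable_def)
  then show "f absolutely_integrable_on K"
    by (rule set_integrable_subset) (use K in \<open>auto intro!: borel_closed compact_imp_closed\<close>)
qed

lemma has_weak_derivative_version_iff: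
  assumes "version u U" "version w W"
  shows "has_weak_derivative Om \<gamma> u w \<longleftrightarrow> (\<forall>\<phi>\<in>test_functions Om.
     (\<integral>p. U p * classical_D \<gamma> \<phi> p \<partial>lborel) = (-1) ^ mi_order \<gamma> * (\<integral>p. W p * \<phi> p \<partial>lborel))"
proof -
  have "(\<integral>p. f p * \<psi> p \<partial>lebesgue_on Om) = (\<integral>p. F p * \<psi> p \<partial>lborel)"
    if "version f F" "\<psi> \<in> test_functions Om" for f F \<psi>
    by (rule version_integral(1)[OF that(1) Om_lebesgue order_refl Om_subset test_function_borel[OF that(2)]])
  note * = this[OF assms(1) classical_D_test] this[OF assms(2)]
  show ?thesis
    unfolding has_weak_derivative_def
    using version_locally_integrable[OF assms(1)] version_locally_integrable[OF assms(2)] by (simp add: *)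
qed

lemma L2_lincomb:
  assumes "L2 f" "L2 g" shows "L2 (\<lambda>p. r * f p + s * g p)"
proof -
  have f: "integrable lborel (\<lambda>p. (f p)\<^sup>2)" and g: "integrable lborel (\<lambda>p. (g p)\<^sup>2)" and L: "L1 f" "L1 g"
    using assms by (auto simp: L2_def)
  have [measurable]: "f \<in> borel_measurable borel" "g \<in> borel_measurable borel"
    using L by (auto dest: L1_measurable)
  have i: "integrable lborel (\<lambda>p. 2 * (r\<^sup>2 * (f p)\<^sup>2) + 2 * (s\<^sup>2 * (g p)\<^sup>2))" using f g by simp
  have "integrable lborel (\<lambda>p. (r * f p + s * g p)\<^sup>2)"
  proof (rule Bochner_Integration.integrable_bound[OF i])
    have e: "(x + y)\<^sup>2 \<le> 2 * x\<^sup>2 + 2 * y\<^sup>2" for x y :: real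
      using zero_le_power2[of "x - y"] by (simp add: power2_eq_square algebra_simps)
    have "(r * f p + s * g p)\<^sup>2 \<le> 2 * (r\<^sup>2 * (f p)\<^sup>2) + 2 * (s\<^sup>2 * (g p)\<^sup>2)" for p
      using e[of "r * f p" "s * g p"] by (simp add: power_mult_distrib)
    then show "AE p in lborel. norm ((r * f p + s * g p)\<^sup>2) \<le> norm (2 * (r\<^sup>2 * (f p)\<^sup>2) + 2 * (s\<^sup>2 * (g p)\<^sup>2))"
      by (intro AE_I2) simp
  qed measurable
  then show ?thesis using L by (auto simp: L2_def L1_def)
qed

lemma version_lincomb:
  assumes "version f F" "version g G" shows "version (\<lambda>p. r * f p + s * g p) (\<lambda>p. r * F p + s * G p)"
  using assms(1)[unfolded version_def] assms(2)[unfolded version_def]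
  unfolding version_def by (auto intro: L2_lincomb elim: eventually_elim2)

lemma integrable_test_mult:
  assumes "integrable lborel f" "\<phi> \<in> test_functions \<Omega>" shows "integrable lborel (\<lambda>p. f p * \<phi> p)"
proof -
  obtain K where "\<And>p. \<bar>\<phi> p\<bar> \<le> K" using test_function_bounded[OF assms(2)] by blast
  then show ?thesis
    by (intro integrable_bounded_mult[OF assms(1), where K = K]) (use test_function_borel[OF assms(2)] in auto)
qed

lemma has_weak_derivative_lincomb:
  assumes v: "version u U" "version w W" "version u' U'" "version w' W'"
    and w: "has_weak_derivative Om \<gamma> u w" "has_weak_derivative Om \<gamma> u' w'"
  shows "has_weak_derivative Om \<gamma> (\<lambda>p. r * u p + s * u' p) (\<lambda>p. r * w p + s * w' p)"
proof -
  have i: "integrable lborel U" "integrable lborel W" "integrable lborel U'" "integrable lborel W'"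
    using v by (auto simp: version_def L2_def L1_def)
  have lin: "(\<integral>p. (r * F p + s * G p) * \<psi> p \<partial>lborel) =
      r * (\<integral>p. F p * \<psi> p \<partial>lborel) + s * (\<integral>p. G p * \<psi> p \<partial>lborel)"
    if F: "integrable lborel F" and G: "integrable lborel G" and \<psi>: "\<psi> \<in> test_functions Om" for F G \<psi>
    using integrable_test_mult[OF F \<psi>] integrable_test_mult[OF G \<psi>] by (simp add: distrib_right mult.assoc)
  show ?thesis
    unfolding has_weak_derivative_version_iff[OF version_lincomb[OF v(1,3)] version_lincomb[OF v(2,4)]]
  proof
    fix \<phi> assume \<phi>: "\<phi> \<in> test_functions Om"
    have 1: "(\<integral>p. U p * classical_D \<gamma> \<phi> p \<partial>lborel) = (-1) ^ mi_order \<gamma> * (\<integral>p. W p * \<phi> p \<partial>lborel)"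
      "(\<integral>p. U' p * classical_D \<gamma> \<phi> p \<partial>lborel) = (-1) ^ mi_order \<gamma> * (\<integral>p. W' p * \<phi> p \<partial>lborel)"
      using w \<phi> unfolding has_weak_derivative_version_iff[OF v(1,2)] has_weak_derivative_version_iff[OF v(3,4)]
      by blast+
    show "(\<integral>p. (r * U p + s * U' p) * classical_D \<gamma> \<phi> p \<partial>lborel) =
        (-1) ^ mi_order \<gamma> * (\<integral>p. (r * W p + s * W' p) * \<phi> p \<partial>lborel)"
      unfolding lin[OF i(1,3) classical_D_test[OF \<phi>]] lin[OF i(2,4) \<phi>] 1 by (simp add: algebra_simps)
  qed
qed

lemma integrable_lebesgue_borel:
  fixes f :: "plane \<Rightarrow> real"
  assumes "integrable lebesgue f"
  obtains g where "integrable lborel g" "AE p in lborel. f p = g p"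
proof -
  obtain g where g[measurable]: "g \<in> borel_measurable lborel" and ae: "AE p in lborel. f p = g p"
    using completion_ex_borel_measurable_real[OF borel_measurable_integrable[OF assms]] by blast
  have "integrable lebesgue g"
    using assms by (subst integrable_cong_AE[of _ _ f])
      (use AE_completion[OF ae] assms in \<open>auto intro!: measurable_completion\<close>)
  then have "integrable lborel g" by (simp add: integrable_completion)
  then show ?thesis using ae by (rule that)
qed

text \<open>Weak derivatives are only locally integrable, so the comparison is made on a compact
  subrectangle: there both are integrable, and the fundamental lemma for the smaller rectangle
  applies to their difference.\<close>

lemma weak_derivative_unique_inner:
  assumes w: "has_weak_derivative Om \<gamma> u w" "has_weak_derivative Om \<gamma> u w'"
    and l: "a < l" "l < r" "r < b" "c < l'" "l' < r'" "r' < d"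
  shows "AE p in lborel. p \<in> {l<..<r} \<times> {l'<..<r'} \<longrightarrow> w p = w' p"
proof -
  define K where "K = {l..r} \<times> {l'..r'}"
  have K: "compact K" "K \<subseteq> Om" using l by (auto simp: K_def Om_def intro: compact_Times)
  interpret R: rectangle l r l' r' by unfold_locales (use l in auto)
  have *: "\<exists>g. integrable lborel g \<and> (AE p in lborel. indicator K p * v p = g p) \<and>
      (\<forall>A\<in>tests l r. \<forall>B\<in>tests l' r'. (\<integral>p. v p * tensor A B p \<partial>lebesgue_on Om) = (\<integral>p. g p * tensor A B p \<partial>lborel))"
    if v: "locally_integrable Om v" for v
  proof -
    have i: "integrable lebesgue (\<lambda>p. indicator K p * v p)"
      using v K by (auto simp: locally_integrable_def set_integrable_def)
    obtain g where g: "integrable lborel g" "AE p in lborel. indicator K p * v p = g p"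
      using integrable_lebesgue_borel[OF i] by blast
    have "(\<integral>p. v p * tensor A B p \<partial>lebesgue_on Om) = (\<integral>p. g p * tensor A B p \<partial>lborel)"
      if A: "A \<in> tests l r" and B: "B \<in> tests l' r'" for A B
    proof -
      have [measurable]: "tensor A B \<in> borel_measurable borel" by (rule tensor_measurable[OF A B])
      have [measurable]: "g \<in> borel_measurable borel" using g(1) by auto
      have "tensor A B \<in> borel_measurable lebesgue" "g \<in> borel_measurable lebesgue"
        by (auto intro!: measurable_completion)
      note m = this borel_measurable_integrable[OF i]
      have "(\<integral>p. v p * tensor A B p \<partial>lebesgue_on Om) = (\<integral>p. indicator Om p *\<^sub>R (v p * tensor A B p) \<partial>lebesgue)"
        by (subst integral_restrict_space) auto
      also have "\<dots> = (\<integral>p. (indicator K p * v p) * tensor A B p \<partial>lebesgue)"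
      proof (rule Bochner_Integration.integral_cong[OF refl])
        fix p
        have "tensor A B p = 0" if "p \<notin> K"
          using that tests_eq_0[OF A, of "fst p"] tests_eq_0[OF B, of "snd p"]
          by (auto simp: K_def tensor_def case_prod_unfold mem_Times_iff)
        then show "indicator Om p *\<^sub>R (v p * tensor A B p) = (indicator K p * v p) * tensor A B p"
          using K(2) by (auto simp: indicator_def)
      qed
      also have "\<dots> = (\<integral>p. g p * tensor A B p \<partial>lebesgue)"
        by (rule integral_cong_AE) (use AE_completion[OF g(2)] m in \<open>auto elim: eventually_mono\<close>)
      also have "\<dots> = (\<integral>p. g p * tensor A B p \<partial>lborel)" by (rule integral_completion) measurable
      finally show ?thesis .
    qed
    with g show ?thesis by blast
  qed
  have li: "locally_integrable Om w" "locally_integrable Om w'" using w by (auto simp: has_weak_derivative_def)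
  obtain g where g: "integrable lborel g" "AE p in lborel. indicator K p * w p = g p"
      "\<And>A B. A \<in> tests l r \<Longrightarrow> B \<in> tests l' r' \<Longrightarrow> (\<integral>p. w p * tensor A B p \<partial>lebesgue_on Om) = (\<integral>p. g p * tensor A B p \<partial>lborel)"
    using *[OF li(1)] by blast
  obtain g' where g': "integrable lborel g'" "AE p in lborel. indicator K p * w' p = g' p"
      "\<And>A B. A \<in> tests l r \<Longrightarrow> B \<in> tests l' r' \<Longrightarrow> (\<integral>p. w' p * tensor A B p \<partial>lebesgue_on Om) = (\<integral>p. g' p * tensor A B p \<partial>lborel)"
    using *[OF li(2)] by blast
  define z where "z p = indicator R.Om p * (g p - g' p)" for p
  have "integrable lborel z"
    unfolding z_def using integrable_mult_indicator[OF _ Bochner_Integration.integrable_diff[OF g(1) g'(1)], of R.Om]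
    by (simp add: R.Om_borel)
  then have "R.L1 z" by (simp add: R.L1_def z_def)
  then have "AE p in lborel. z p = 0"
  proof (rule R.fundamental_lemma)
    fix A B assume A: "A \<in> tests l r" and B: "B \<in> tests l' r'"
    have "tensor A B \<in> test_functions Om"
      unfolding Om_def using A B l by (intro tensor_test_functions) (auto elim: tests_mono)
    then have "(\<integral>p. w p * tensor A B p \<partial>lebesgue_on Om) = (\<integral>p. w' p * tensor A B p \<partial>lebesgue_on Om)"
      using w by (auto simp: has_weak_derivative_def)
    then have e: "(\<integral>p. g p * tensor A B p \<partial>lborel) = (\<integral>p. g' p * tensor A B p \<partial>lborel)"
      using g(3)[OF A B] g'(3)[OF A B] by simp
    have "(\<integral>p. z p * tensor A B p \<partial>lborel) = (\<integral>p. g p * tensor A B p - g' p * tensor A B p \<partial>lborel)"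
    proof (rule Bochner_Integration.integral_cong[OF refl])
      fix p
      have "tensor A B p = 0" if "p \<notin> R.Om"
        using that tests_eq_0[OF A, of "fst p"] tests_eq_0[OF B, of "snd p"]
        by (auto simp: R.Om_def tensor_def case_prod_unfold mem_Times_iff)
      then show "z p * tensor A B p = g p * tensor A B p - g' p * tensor A B p"
        by (auto simp: z_def indicator_def left_diff_distrib)
    qed
    also have "\<dots> = 0"
      using integrable_tensor[OF g(1) A B] integrable_tensor[OF g'(1) A B] e by simp
    finally show "(\<integral>p. z p * tensor A B p \<partial>lborel) = 0" .
  qed
  then show ?thesis using g(2) g'(2)
    by eventually_elim (auto simp: z_def R.Om_def K_def indicator_def)
qed

lemma weak_derivative_unique:
  assumes w: "has_weak_derivative Om \<gamma> u w" "has_weak_derivative Om \<gamma> u w'"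
  shows "AE p in lborel. p \<in> Om \<longrightarrow> w p = w' p"
proof -
  \<comment> \<open>The denominators start at 3, so that the margins stay below half of the side
    lengths and every inner rectangle is nonempty. Countably many of them exhaust the open
    rectangle.\<close>
  define e where "e n = (b - a) / (real n + 3)" for n
  define e' where "e' n = (d - c) / (real n + 3)" for n
  have pos: "0 < e n" "e n < (b - a) / 2" "0 < e' n" "e' n < (d - c) / 2" for n
  proof -
    have "0 < s / (real n + 3) \<and> s / (real n + 3) < s / 2" if "0 < s" for s
      using that by (intro conjI divide_pos_pos divide_strict_left_mono) auto
    from this[of "b - a"] this[of "d - c"] show "0 < e n" "e n < (b - a) / 2" "0 < e' n" "e' n < (d - c) / 2"
      using ab cd by (auto simp: e_def e'_def)
  qed
  have "AE p in lborel. p \<in> {a + e n<..<b - e n} \<times> {c + e' n<..<d - e' n} \<longrightarrow> w p = w' p" for n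
    by (rule weak_derivative_unique_inner[OF w]) (use pos[of n] in auto)
  then have "AE p in lborel. \<forall>n. p \<in> {a + e n<..<b - e n} \<times> {c + e' n<..<d - e' n} \<longrightarrow> w p = w' p"
    unfolding AE_all_countable by blast
  then show ?thesis
  proof (rule eventually_mono, intro impI)
    fix p assume *: "\<forall>n. p \<in> {a + e n<..<b - e n} \<times> {c + e' n<..<d - e' n} \<longrightarrow> w p = w' p" and "p \<in> Om"
    then obtain x y where p: "p = (x, y)" "a < x" "x < b" "c < y" "y < d" by (auto simp: Om_def)
    have lim: "(\<lambda>n. s / (real n + 3)) \<longlonglongrightarrow> 0" for s
      by (rule real_tendsto_divide_at_top[OF tendsto_const])
        (rule filterlim_at_top_mono[OF filterlim_real_sequentially], auto intro: always_eventually)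
    have "eventually (\<lambda>n. e n < x - a \<and> e n < b - x \<and> e' n < y - c \<and> e' n < d - y) sequentially"
      using lim[of "b - a"] lim[of "d - c"] p unfolding e_def e'_def
      by (intro eventually_conj order_tendstoD(2)) auto
    then obtain n where "e n < x - a" "e n < b - x" "e' n < y - c" "e' n < d - y"
      by (auto simp: eventually_sequentially)
    then have "p \<in> {a + e n<..<b - e n} \<times> {c + e' n<..<d - e' n}" by (auto simp: p(1))
    then show "w p = w' p" using * by blast
  qed
qed

lemma version_cong:
  assumes "version w Z" "AE p in lborel. p \<in> Om \<longrightarrow> w' p = w p" shows "version w' Z"
  using assms unfolding version_def by (auto elim: eventually_elim2)

lemma has_weak_derivative_imp_version:
  assumes "has_weak_derivative Om \<gamma> u w" "has_weak_derivative Om \<gamma> u w'" "version w' Z"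
  shows "version w Z"
  by (rule version_cong[OF assms(3) weak_derivative_unique[OF assms(1,2)]])

text \<open>The derivative picked by \<open>SOME\<close> agrees almost everywhere with the given one
  by uniqueness, so it inherits square integrability and the version.\<close>

lemma weak_D_version:
  assumes "has_weak_derivative Om \<gamma> u w" "version w Z"
  shows "has_weak_derivative Om \<gamma> u (weak_D Om \<gamma> u)" "version (weak_D Om \<gamma> u) Z"
proof -
  show "has_weak_derivative Om \<gamma> u (weak_D Om \<gamma> u)"
    unfolding weak_D_def by (rule someI[where P = "has_weak_derivative Om \<gamma> u", OF assms(1)])
  then show "version (weak_D Om \<gamma> u) Z"
    by (rule has_weak_derivative_imp_version[OF _ assms])
qed

text \<open>For products an additional x-derivative just replaces A by \<open>deriv A\<close>.
  Comparing the two defining identities of u on the same test function leaves one sign.\<close>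

lemma weak_x_of_weak_derivative:
  assumes v: "version u U" "version w W" "version w' W'"
    and w: "has_weak_derivative Om (m, n) u w" "has_weak_derivative Om (Suc m, n) u w'"
  shows "weak_x W W'"
  unfolding weak_x_def
proof (intro ballI)
  fix A B assume A: "A \<in> tests a b" and B: "B \<in> tests c d"
  have t: "tensor A B \<in> test_functions Om" "tensor (deriv A) B \<in> test_functions Om"
    unfolding Om_def using A B by (auto intro: tensor_test_functions tests_deriv)
  have e: "classical_D (Suc m, n) (tensor A B) = classical_D (m, n) (tensor (deriv A) B)"
    using A B by (simp add: classical_D_tensor tests_smooth smooth_deriv funpow_swap1)
  have 1: "(\<integral>p. U p * classical_D (m, n) (tensor (deriv A) B) p \<partial>lborel) =
      (-1) ^ (m + n) * (\<integral>p. W p * tensor (deriv A) B p \<partial>lborel)"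
    using w(1) t(2) unfolding has_weak_derivative_version_iff[OF v(1,2)] by (simp add: mi_order_def)
  have 2: "(\<integral>p. U p * classical_D (Suc m, n) (tensor A B) p \<partial>lborel) =
      (-1) ^ (Suc m + n) * (\<integral>p. W' p * tensor A B p \<partial>lborel)"
    using w(2) t(1) unfolding has_weak_derivative_version_iff[OF v(1,3)] by (simp add: mi_order_def)
  have "(-1) ^ (m + n) * (\<integral>p. W p * tensor (deriv A) B p \<partial>lborel) =
      (-1) ^ (m + n) * - (\<integral>p. W' p * tensor A B p \<partial>lborel)"
    using 1 2 unfolding e by simp
  then show "(\<integral>p. W p * tensor (deriv A) B p \<partial>lborel) = - (\<integral>p. W' p * tensor A B p \<partial>lborel)"
    by (simp only: mult_cancel_left) simp
qed

lemma weak_y_of_weak_derivative: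
  assumes v: "version u U" "version w W" "version w' W'"
    and w: "has_weak_derivative Om (m, n) u w" "has_weak_derivative Om (m, Suc n) u w'"
  shows "weak_y W W'"
  unfolding weak_y_def
proof (intro ballI)
  fix A B assume A: "A \<in> tests a b" and B: "B \<in> tests c d"
  have t: "tensor A B \<in> test_functions Om" "tensor A (deriv B) \<in> test_functions Om"
    unfolding Om_def using A B by (auto intro: tensor_test_functions tests_deriv)
  have e: "classical_D (m, Suc n) (tensor A B) = classical_D (m, n) (tensor A (deriv B))"
    using A B by (simp add: classical_D_tensor tests_smooth smooth_deriv funpow_swap1)
  have 1: "(\<integral>p. U p * classical_D (m, n) (tensor A (deriv B)) p \<partial>lborel) =
      (-1) ^ (m + n) * (\<integral>p. W p * tensor A (deriv B) p \<partial>lborel)"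
    using w(1) t(2) unfolding has_weak_derivative_version_iff[OF v(1,2)] by (simp add: mi_order_def)
  have 2: "(\<integral>p. U p * classical_D (m, Suc n) (tensor A B) p \<partial>lborel) =
      (-1) ^ (m + Suc n) * (\<integral>p. W' p * tensor A B p \<partial>lborel)"
    using w(2) t(1) unfolding has_weak_derivative_version_iff[OF v(1,3)] by (simp add: mi_order_def)
  have "(-1) ^ (m + n) * (\<integral>p. W p * tensor A (deriv B) p \<partial>lborel) =
      (-1) ^ (m + n) * - (\<integral>p. W' p * tensor A B p \<partial>lborel)"
    using 1 2 unfolding e by simp
  then show "(\<integral>p. W p * tensor A (deriv B) p \<partial>lborel) = - (\<integral>p. W' p * tensor A B p \<partial>lborel)"
    by (simp only: mult_cancel_left) simp
qed

text \<open>The identity of the x-derivative is tested with a derivative of \<phi>, itself a test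
  function. This allows iterated weak derivatives to be read as derivatives of u.\<close>

lemma weak_derivative_of_x_derivative:
  assumes v: "version u U" "version w W" "version w' W'"
    and w: "has_weak_derivative Om (k, 0) u w" "has_weak_derivative Om ((k, 0) + \<alpha>) u w'"
  shows "has_weak_derivative Om \<alpha> w w'"
  unfolding has_weak_derivative_version_iff[OF v(2,3)]
proof
  fix \<phi> assume \<phi>: "\<phi> \<in> test_functions Om"
  have 1: "(\<integral>p. U p * classical_D ((k, 0) + \<alpha>) \<phi> p \<partial>lborel) = (-1) ^ k * (\<integral>p. W p * classical_D \<alpha> \<phi> p \<partial>lborel)"
    using w(1) classical_D_test[OF \<phi>, of \<alpha>] unfolding has_weak_derivative_version_iff[OF v(1,2)]
    by (simp add: mi_order_def classical_D_x_left[symmetric])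
  have 2: "(\<integral>p. U p * classical_D ((k, 0) + \<alpha>) \<phi> p \<partial>lborel) = (-1) ^ (k + mi_order \<alpha>) * (\<integral>p. W' p * \<phi> p \<partial>lborel)"
    using w(2) \<phi> unfolding has_weak_derivative_version_iff[OF v(1,3)] by (simp add: mi_order_def add.assoc)
  show "(\<integral>p. W p * classical_D \<alpha> \<phi> p \<partial>lborel) = (-1) ^ mi_order \<alpha> * (\<integral>p. W' p * \<phi> p \<partial>lborel)"
    using 1 2 by (simp add: power_add)
qed

section \<open>Weak derivatives of products\<close>

definition bdd :: "real \<Rightarrow> real \<Rightarrow> (real \<Rightarrow> real) \<Rightarrow> bool" where
  "bdd l r f \<longleftrightarrow> f \<in> borel_measurable borel \<and> (\<exists>K. \<forall>x\<in>{l<..<r}. \<bar>f x\<bar> \<le> K)"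

lemma bounded_imp_L2:
  assumes [measurable]: "h \<in> borel_measurable borel" and K: "\<And>p. p \<in> Om \<Longrightarrow> \<bar>h p\<bar> \<le> K"
  shows "L2 (\<lambda>p. indicator Om p * h p)"
    and "l2 (\<lambda>p. indicator Om p * h p) \<le> sqrt ((b - a) * (d - c)) * K"
proof -
  have i: "integrable lborel (\<lambda>p. indicator Om p * C)" for C :: real using measure_Om(1) by simp
  have 1: "integrable lborel (\<lambda>p. indicator Om p * h p)"
    by (rule Bochner_Integration.integrable_bound[OF i[of K]])
      (use K in \<open>auto simp: indicator_def intro!: AE_I2 order_trans[OF K]\<close>)
  have sq: "(indicator Om p * h p)\<^sup>2 \<le> indicator Om p * K\<^sup>2" for p
    using K[of p] by (auto simp: indicator_def abs_le_square_iff[symmetric])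
  have 2: "integrable lborel (\<lambda>p. (indicator Om p * h p)\<^sup>2)"
    by (rule Bochner_Integration.integrable_bound[OF i[of "K\<^sup>2"]]) (use sq in \<open>auto intro!: AE_I2\<close>)
  show "L2 (\<lambda>p. indicator Om p * h p)" using 1 2 by (simp add: L2_def L1_def)
  have "(\<integral>p. (indicator Om p * h p)\<^sup>2 \<partial>lborel) \<le> (\<integral>p. indicator Om p * K\<^sup>2 \<partial>lborel)"
    by (rule integral_mono[OF 2 i sq])
  also have "\<dots> = (b - a) * (d - c) * K\<^sup>2" using measure_Om(2) by simp
  finally have "l2 (\<lambda>p. indicator Om p * h p) \<le> sqrt ((b - a) * (d - c) * K\<^sup>2)"
    unfolding l2_def by (rule real_sqrt_le_mono)
  moreover have "0 \<le> K"
    using K[of "((a + b) / 2, (c + d) / 2)"] ab cd by (force simp: Om_def)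
  ultimately show "l2 (\<lambda>p. indicator Om p * h p) \<le> sqrt ((b - a) * (d - c)) * K"
    by (simp add: real_sqrt_mult)
qed

lemma bdd_tensor:
  assumes f: "bdd a b f" and g: "bdd c d g"
  shows "tensor f g \<in> borel_measurable borel" "\<exists>K. \<forall>p\<in>Om. \<bar>tensor f g p\<bar> \<le> K"
    "version (tensor f g) (\<lambda>p. indicator Om p * tensor f g p)"
proof -
  have [measurable]: "f \<in> borel_measurable borel" "g \<in> borel_measurable borel" using f g by (auto simp: bdd_def)
  have "(\<lambda>p::plane. f (fst p) * g (snd p)) \<in> borel_measurable (borel \<Otimes>\<^sub>M borel)" by measurable
  then show m: "tensor f g \<in> borel_measurable borel" by (simp add: tensor_def case_prod_unfold borel_prod)
  obtain K1 where K1: "\<forall>x\<in>{a<..<b}. \<bar>f x\<bar> \<le> K1" using f unfolding bdd_def by blast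
  obtain K2 where K2: "\<forall>x\<in>{c<..<d}. \<bar>g x\<bar> \<le> K2" using g unfolding bdd_def by blast
  have B: "\<bar>tensor f g p\<bar> \<le> K1 * K2" if "p \<in> Om" for p
  proof -
    have "\<bar>f (fst p)\<bar> \<le> K1" "\<bar>g (snd p)\<bar> \<le> K2" using that K1 K2 by (auto simp: Om_def)
    then show ?thesis
      unfolding tensor_def case_prod_unfold abs_mult
      by (intro mult_mono order_trans[OF abs_ge_zero]) auto
  qed
  then show "\<exists>K. \<forall>p\<in>Om. \<bar>tensor f g p\<bar> \<le> K" by blast
  show "version (tensor f g) (\<lambda>p. indicator Om p * tensor f g p)"
    using bounded_imp_L2(1)[OF m B] by (simp add: version_def)
qed

lemma tensor_weak_x:
  assumes f: "weak_deriv1 a b f f'" and g: "bdd c d g" and \<phi>: "\<phi> \<in> test_functions Om"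
  shows "(\<integral>p. indicator Om p * tensor f g p * partial_x \<phi> p \<partial>lborel) =
    - (\<integral>p. indicator Om p * tensor f' g p * \<phi> p \<partial>lborel)"
proof -
  have ff: "bdd a b f" "bdd a b f'" using f by (auto simp: weak_deriv1_def bdd_def)
  have i1: "integrable lborel (\<lambda>p. indicator Om p * tensor f g p * partial_x \<phi> p)"
    using bdd_tensor(3)[OF ff(1) g]
    by (intro integrable_test_mult[OF _ test_functions_partial(1)[OF \<phi>]]) (simp add: version_def L2_def L1_def)
  have i2: "integrable lborel (\<lambda>p. indicator Om p * tensor f' g p * \<phi> p)"
    using bdd_tensor(3)[OF ff(2) g]
    by (intro integrable_test_mult[OF _ \<phi>]) (simp add: version_def L2_def L1_def)
  have "(\<integral>x. indicator Om (x, y) * tensor f g (x, y) * partial_x \<phi> (x, y) \<partial>lborel) =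
      - (\<integral>x. indicator Om (x, y) * tensor f' g (x, y) * \<phi> (x, y) \<partial>lborel)" for y
  proof -
    have "continuous_on UNIV (\<lambda>x. partial_x \<phi> (x, y))"
      by (rule continuous_on_compose2[OF test_function_continuous[OF test_functions_partial(1)[OF \<phi>], of UNIV]])
        (auto intro!: continuous_intros)
    then have e: "(\<integral>x. indicator {a<..<b} x * f x * partial_x \<phi> (x, y) \<partial>lborel) =
        - (\<integral>x. indicator {a<..<b} x * f' x * \<phi> (x, y) \<partial>lborel)"
      using f[unfolded weak_deriv1_def] test_function_DERIV(1)[OF \<phi>, of y]
        test_function_eq_0[OF \<phi>, of "(a, y)"] test_function_eq_0[OF \<phi>, of "(b, y)"] by (auto simp: Om_def)
    have r: "(\<integral>x. indicator Om (x, y) * tensor k g (x, y) * \<psi> (x, y) \<partial>lborel) =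
        indicator {c<..<d} y * g y * (\<integral>x. indicator {a<..<b} x * k x * \<psi> (x, y) \<partial>lborel)" for k \<psi>
    proof -
      have "(\<lambda>x. indicator Om (x, y) * tensor k g (x, y) * \<psi> (x, y)) =
          (\<lambda>x. indicator {c<..<d} y * g y * (indicator {a<..<b} x * k x * \<psi> (x, y)))"
        by (auto simp: fun_eq_iff Om_def tensor_def indicator_def)
      then show ?thesis by simp
    qed
    show ?thesis unfolding r e by simp
  qed
  then show ?thesis
    unfolding fubini_plane(6)[OF i1, symmetric] fubini_plane(6)[OF i2, symmetric] by simp
qed

lemma tensor_weak_y:
  assumes f: "bdd a b f" and g: "weak_deriv1 c d g g'" and \<phi>: "\<phi> \<in> test_functions Om"
  shows "(\<integral>p. indicator Om p * tensor f g p * partial_y \<phi> p \<partial>lborel) =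
    - (\<integral>p. indicator Om p * tensor f g' p * \<phi> p \<partial>lborel)"
proof -
  have gg: "bdd c d g" "bdd c d g'" using g by (auto simp: weak_deriv1_def bdd_def)
  have i1: "integrable lborel (\<lambda>p. indicator Om p * tensor f g p * partial_y \<phi> p)"
    using bdd_tensor(3)[OF f gg(1)]
    by (intro integrable_test_mult[OF _ test_functions_partial(2)[OF \<phi>]]) (simp add: version_def L2_def L1_def)
  have i2: "integrable lborel (\<lambda>p. indicator Om p * tensor f g' p * \<phi> p)"
    using bdd_tensor(3)[OF f gg(2)]
    by (intro integrable_test_mult[OF _ \<phi>]) (simp add: version_def L2_def L1_def)
  have "(\<integral>y. indicator Om (x, y) * tensor f g (x, y) * partial_y \<phi> (x, y) \<partial>lborel) =
      - (\<integral>y. indicator Om (x, y) * tensor f g' (x, y) * \<phi> (x, y) \<partial>lborel)" for x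
  proof -
    have "continuous_on UNIV (\<lambda>y. partial_y \<phi> (x, y))"
      by (rule continuous_on_compose2[OF test_function_continuous[OF test_functions_partial(2)[OF \<phi>], of UNIV]])
        (auto intro!: continuous_intros)
    then have e: "(\<integral>y. indicator {c<..<d} y * g y * partial_y \<phi> (x, y) \<partial>lborel) =
        - (\<integral>y. indicator {c<..<d} y * g' y * \<phi> (x, y) \<partial>lborel)"
      using g[unfolded weak_deriv1_def] test_function_DERIV(2)[OF \<phi>, of x]
        test_function_eq_0[OF \<phi>, of "(x, c)"] test_function_eq_0[OF \<phi>, of "(x, d)"] by (auto simp: Om_def)
    have r: "(\<integral>y. indicator Om (x, y) * tensor f k (x, y) * \<psi> (x, y) \<partial>lborel) =
        indicator {a<..<b} x * f x * (\<integral>y. indicator {c<..<d} y * k y * \<psi> (x, y) \<partial>lborel)" for k \<psi>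
    proof -
      have "(\<lambda>y. indicator Om (x, y) * tensor f k (x, y) * \<psi> (x, y)) =
          (\<lambda>y. indicator {a<..<b} x * f x * (indicator {c<..<d} y * k y * \<psi> (x, y)))"
        by (auto simp: fun_eq_iff Om_def tensor_def indicator_def)
      then show ?thesis by simp
    qed
    show ?thesis unfolding r e by simp
  qed
  then show ?thesis
    unfolding fubini_plane(3)[OF i1, symmetric] fubini_plane(3)[OF i2, symmetric] by simp
qed

text \<open>The x-derivatives are outermost, so they are moved off first, with a y-derivative of
  \<phi> as test function; the y-derivatives follow. Here all test functions are needed, not just
  products, but each step is a one-variable identity on slices.\<close>

lemma tensor_has_weak_derivative:
  assumes f: "\<And>i. i < m \<Longrightarrow> weak_deriv1 a b (f i) (f (Suc i))" "\<And>i. i \<le> m \<Longrightarrow> bdd a b (f i)"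
    and g: "\<And>i. i < n \<Longrightarrow> weak_deriv1 c d (g i) (g (Suc i))" "\<And>i. i \<le> n \<Longrightarrow> bdd c d (g i)"
  shows "has_weak_derivative Om (m, n) (tensor (f 0) (g 0)) (tensor (f m) (g n))"
proof -
  have X: "(\<integral>p. indicator Om p * tensor (f 0) (g 0) p * (partial_x ^^ k) \<phi> p \<partial>lborel) =
      (-1) ^ k * (\<integral>p. indicator Om p * tensor (f k) (g 0) p * \<phi> p \<partial>lborel)"
    if "k \<le> m" "\<phi> \<in> test_functions Om" for k \<phi>
    using that
  proof (induction k arbitrary: \<phi>)
    case (Suc k)
    have "(\<integral>p. indicator Om p * tensor (f k) (g 0) p * partial_x \<phi> p \<partial>lborel) =
        - (\<integral>p. indicator Om p * tensor (f (Suc k)) (g 0) p * \<phi> p \<partial>lborel)"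
      using Suc.prems by (intro tensor_weak_x f g) auto
    then show ?case
      using Suc.IH[OF _ test_functions_partial(1)[OF Suc.prems(2)]] Suc.prems(1) by (simp add: funpow_swap1)
  qed simp
  have Y: "(\<integral>p. indicator Om p * tensor (f m) (g 0) p * (partial_y ^^ k) \<phi> p \<partial>lborel) =
      (-1) ^ k * (\<integral>p. indicator Om p * tensor (f m) (g k) p * \<phi> p \<partial>lborel)"
    if "k \<le> n" "\<phi> \<in> test_functions Om" for k \<phi>
    using that
  proof (induction k arbitrary: \<phi>)
    case (Suc k)
    have "(\<integral>p. indicator Om p * tensor (f m) (g k) p * partial_y \<phi> p \<partial>lborel) =
        - (\<integral>p. indicator Om p * tensor (f m) (g (Suc k)) p * \<phi> p \<partial>lborel)"
      using Suc.prems by (intro tensor_weak_y f g) auto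
    then show ?case
      using Suc.IH[OF _ test_functions_partial(2)[OF Suc.prems(2)]] Suc.prems(1) by (simp add: funpow_swap1)
  qed simp
  show ?thesis
    unfolding has_weak_derivative_version_iff[OF bdd_tensor(3)[OF f(2) g(2)] bdd_tensor(3)[OF f(2) g(2)], of 0 0 m n, simplified]
    using X[OF order_refl test_functions_higher_partial(2)] Y[OF order_refl]
    by (simp add: classical_D_def mi_order_def power_add)
qed

end

section \<open>The reference interpolation\<close>

lemma DERIV_abs_real: "y \<noteq> 0 \<Longrightarrow> (abs has_real_derivative sgn y) (at (y::real))"
proof (cases "y > 0")
  case True
  have "((\<lambda>y::real. y) has_real_derivative sgn y) (at y)"
    using True by (auto intro!: derivative_eq_intros)
  then show ?thesis
    by (rule has_field_derivative_transform_within_open[where S = "{0<..}"]) (use True in auto)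
next
  case False
  assume "y \<noteq> 0"
  have "((\<lambda>y::real. - y) has_real_derivative sgn y) (at y)"
    using False \<open>y \<noteq> 0\<close> by (auto intro!: derivative_eq_intros)
  then show ?thesis
    by (rule has_field_derivative_transform_within_open[where S = "{..<0}"]) (use False \<open>y \<noteq> 0\<close> in auto)
qed

lemma DERIV_mult_abs: "((\<lambda>y::real. y * \<bar>y\<bar>) has_real_derivative 2 * \<bar>y\<bar>) (at y)"
proof (cases "y = 0")
  case True
  have "((\<lambda>h::real. \<bar>h\<bar>) \<longlongrightarrow> 0) (at 0)" using tendsto_rabs_zero[OF tendsto_ident_at] by simp
  then have "((\<lambda>h::real. h * \<bar>h\<bar> / h) \<longlongrightarrow> 0) (at 0)"
    by (rule Lim_transform_eventually) (auto simp: eventually_at_filter)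
  then show ?thesis using True by (simp add: DERIV_def)
next
  case False
  from DERIV_mult[OF DERIV_ident DERIV_abs_real[OF this]]
  show ?thesis by (simp add: abs_sgn mult.commute)
qed

text \<open>Two quadratics joined in a C^1 way at 0 form the span of 1, y, y^2 and y|y|. This basis
  avoids case distinctions; E is half the jump of the leading coefficient.\<close>

lemma hermite_spline_data_abs:
  fixes A B C E :: real
  defines "g \<equiv> (\<lambda>y. A + B * y + C * y\<^sup>2 + E * (y * \<bar>y\<bar>))"
  assumes "\<alpha> 1 = A + B + C + E" "\<alpha> (-1) = A - B + C - E" "\<delta> 1 = B + 2 * C + 2 * E" "\<delta> (-1) = B - 2 * C + 2 * E"
  shows "hermite_spline_data \<alpha> \<delta> (restrict g {-1..1})"
proof -
  define g' where "g' = (\<lambda>y. B + 2 * C * y + 2 * E * \<bar>y\<bar>)"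
  have "(g has_real_derivative g' y) (at y)" for y
    unfolding g_def g'_def
    by (rule derivative_eq_intros DERIV_mult_abs refl | simp)+
  then have D: "(restrict g {-1..1} has_real_derivative g' y) (at y within {-1..1})" if "y \<in> {-1..1}" for y
    by (intro has_field_derivative_transform_within[OF has_field_derivative_at_within zero_less_one that, of g]) auto
  have "restrict g {-1..1} \<in> C1_quadratic_splines"
    unfolding C1_quadratic_splines_def
  proof (intro CollectI conjI)
    show "\<exists>f'. continuous_on {- 1..1} f' \<and>
        (\<forall>x\<in>{- 1..1}. (restrict g {- 1..1} has_real_derivative f' x) (at x within {- 1..1}))"
      using D by (intro exI[of _ g']) (auto simp: g'_def intro!: continuous_intros)
    show "\<exists>p. degree p \<le> 2 \<and> (\<forall>x\<in>{- 1..0}. restrict g {- 1..1} x = poly p x)"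
      by (rule exI[of _ "[:A, B, C - E:]"])
        (auto simp: g_def degree_pCons_eq_if power2_eq_square algebra_simps)
    show "\<exists>q. degree q \<le> 2 \<and> (\<forall>x\<in>{0..1}. restrict g {- 1..1} x = poly q x)"
      by (rule exI[of _ "[:A, B, C + E:]"])
        (auto simp: g_def degree_pCons_eq_if power2_eq_square algebra_simps)
  qed simp
  then show ?thesis
    using D[of 1] D[of "-1"] assms(2-5) by (auto simp: hermite_spline_data_def g_def g'_def)
qed

text \<open>\<open>spline s n\<close> is the \<open>n\<close>-th derivative of the spline with value 1 at \<open>1\<close>, value 1 at \<open>-1\<close>,
  slope 1 at \<open>1\<close>, slope 1 at \<open>-1\<close> for \<open>s = 0, 1, 2, 3\<close>.\<close>

definition spline :: "nat \<Rightarrow> nat \<Rightarrow> real \<Rightarrow> real" where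
  "spline s n y =
    (if s = 0 then (if n = 0 then 1/2 + y - y * \<bar>y\<bar> / 2 else if n = 1 then 1 - \<bar>y\<bar> else - sgn y)
     else if s = 1 then (if n = 0 then 1/2 - y + y * \<bar>y\<bar> / 2 else if n = 1 then \<bar>y\<bar> - 1 else sgn y)
     else if s = 2 then (if n = 0 then - 1/4 - y/2 + y\<^sup>2/4 + y * \<bar>y\<bar> / 2 else if n = 1 then - 1/2 + y/2 + \<bar>y\<bar> else 1/2 + sgn y)
     else (if n = 0 then 1/4 - y/2 - y\<^sup>2/4 + y * \<bar>y\<bar> / 2 else if n = 1 then - 1/2 - y/2 + \<bar>y\<bar> else - 1/2 + sgn y))"

text \<open>The coefficients solve the four interpolation conditions in the basis 1, y, y^2, y|y|;
  uniqueness of the Hermite spline identifies the results with the functions defined by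
  \<open>THE\<close>.\<close>

lemma phi_psi_hat:
  assumes "y \<in> {-1..1}"
  shows "phi_hat 1 y = spline 0 0 y" "phi_hat (-1) y = spline 1 0 y"
    "psi_hat 1 y = spline 2 0 y" "psi_hat (-1) y = spline 3 0 y"
proof -
  have "phi_hat 1 = restrict (\<lambda>y. 1/2 + 1 * y + 0 * y\<^sup>2 + (-1/2) * (y * \<bar>y\<bar>)) {-1..1}"
    by (rule hermite_spline_unique[OF phi_hat_data hermite_spline_data_abs]) auto
  moreover have "phi_hat (-1) = restrict (\<lambda>y. 1/2 + (-1) * y + 0 * y\<^sup>2 + (1/2) * (y * \<bar>y\<bar>)) {-1..1}"
    by (rule hermite_spline_unique[OF phi_hat_data hermite_spline_data_abs]) auto
  moreover have "psi_hat 1 = restrict (\<lambda>y. -1/4 + (-1/2) * y + (1/4) * y\<^sup>2 + (1/2) * (y * \<bar>y\<bar>)) {-1..1}"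
    by (rule hermite_spline_unique[OF psi_hat_data hermite_spline_data_abs]) auto
  moreover have "psi_hat (-1) = restrict (\<lambda>y. 1/4 + (-1/2) * y + (-1/4) * y\<^sup>2 + (1/2) * (y * \<bar>y\<bar>)) {-1..1}"
    by (rule hermite_spline_unique[OF psi_hat_data hermite_spline_data_abs]) auto
  ultimately show "phi_hat 1 y = spline 0 0 y" "phi_hat (-1) y = spline 1 0 y"
    "psi_hat 1 y = spline 2 0 y" "psi_hat (-1) y = spline 3 0 y"
    using assms by (simp_all add: spline_def)
qed

lemma spline_DERIV: "y \<noteq> 0 \<Longrightarrow> n < 2 \<Longrightarrow> (spline s n has_real_derivative spline s (Suc n) y) (at y)"
proof -
  assume y: "y \<noteq> 0" and "n < 2"
  then consider "n = 0" | "n = 1" by linarith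
  then show ?thesis
  proof cases
    case 1
    show ?thesis
      unfolding 1 spline_def[abs_def]
      by (auto intro!: derivative_eq_intros DERIV_abs_real y simp: abs_sgn[symmetric] field_simps)
  next
    case 2
    show ?thesis
      unfolding 2 spline_def[abs_def]
      by (auto intro!: derivative_eq_intros DERIV_abs_real y)
  qed
qed

lemma spline_continuous: "n < 2 \<Longrightarrow> continuous_on S (spline s n)"
  by (cases "n = 0"; cases "n = 1"; cases "s = 0"; cases "s = 1"; cases "s = 2")
    (auto simp: spline_def[abs_def] intro!: continuous_intros)

lemma spline_bound: "y \<in> {-1..1} \<Longrightarrow> \<bar>spline s n y\<bar> \<le> 2"
proof -
  assume y: "y \<in> {-1..1}"
  have 3: "\<bar>y\<bar> \<le> 1" using y by auto
  obtain e where e: "e = y\<^sup>2" "0 \<le> e" "e \<le> 1" using 3 by (simp add: abs_square_le_1)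
  have "\<bar>y * \<bar>y\<bar>\<bar> \<le> 1" using e by (simp add: abs_mult power2_eq_square)
  then have 1: "y * \<bar>y\<bar> \<le> 1" "- 1 \<le> y * \<bar>y\<bar>" by linarith+
  have 2: "sgn y \<le> 1" "- 1 \<le> sgn y" by (simp_all add: sgn_if)
  show ?thesis
    unfolding spline_def e(1)[symmetric] using 1 2 3 e(2,3) by (auto simp: abs_le_iff simp del: sgn_le_0_iff)
qed

lemma spline_borel [measurable]: "spline s n \<in> borel_measurable borel"
  unfolding spline_def[abs_def] by measurable

text \<open>\<open>lagr i n\<close> is the \<open>n\<close>-th derivative of the Lagrange polynomial of the node \<open>-1, 0, 1\<close> for
  \<open>i = 0, 1, 2\<close>.\<close>

definition lagr :: "nat \<Rightarrow> nat \<Rightarrow> real \<Rightarrow> real" where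
  "lagr i n x =
    (if i = 0 then (if n = 0 then x * (x - 1) / 2 else if n = 1 then x - 1/2 else if n = 2 then 1 else 0)
     else if i = 1 then (if n = 0 then 1 - x\<^sup>2 else if n = 1 then - 2 * x else if n = 2 then - 2 else 0)
     else (if n = 0 then x * (x + 1) / 2 else if n = 1 then x + 1/2 else if n = 2 then 1 else 0))"

lemma lagrange_hat_lagr:
  "lagrange_hat (-1) x = lagr 0 0 x" "lagrange_hat 0 x = lagr 1 0 x" "lagrange_hat 1 x = lagr 2 0 x"
proof -
  have "{-1, 0, 1::real} - {-1} = {0, 1}" "{-1, 0, 1::real} - {0} = {-1, 1}" "{-1, 0, 1::real} - {1} = {-1, 0}"
    by auto
  then show "lagrange_hat (-1) x = lagr 0 0 x" "lagrange_hat 0 x = lagr 1 0 x" "lagrange_hat 1 x = lagr 2 0 x"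
    by (simp_all add: lagrange_hat_def lagr_def power2_eq_square field_simps)
qed

lemma lagr_DERIV: "(lagr i n has_real_derivative lagr i (Suc n) x) (at x)"
proof -
  consider "n = 0" | "n = 1" | "n = 2" | "n > 2" by linarith
  then show ?thesis
    by cases (auto simp: lagr_def[abs_def] field_simps intro!: derivative_eq_intros)
qed

lemma lagr_bound: "x \<in> {-1..1} \<Longrightarrow> \<bar>lagr i n x\<bar> \<le> 2"
proof -
  assume x: "x \<in> {-1..1}"
  then have "\<bar>x\<bar> \<le> 1" by auto
  then obtain e where e: "e = x\<^sup>2" "0 \<le> e" "e \<le> 1" by (simp add: abs_square_le_1)
  have m: "x * (x - 1) / 2 = e / 2 - x / 2" "x * (x + 1) / 2 = e / 2 + x / 2"
    by (simp_all add: e power2_eq_square field_simps)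
  show ?thesis
    unfolding lagr_def m e(1)[symmetric] using e(2,3) \<open>\<bar>x\<bar> \<le> 1\<close> by (auto simp: abs_le_iff)
qed

text \<open>\<open>V i s\<close> is the datum at the i-th x-node that multiplies
  \<open>spline s\<close>, with slopes taken in the reference variable. The orders m and n of
  differentiation are parameters, since the derivatives of the basis are explicit.\<close>

definition interp_ref :: "(nat \<Rightarrow> nat \<Rightarrow> real) \<Rightarrow> nat \<Rightarrow> nat \<Rightarrow> real \<Rightarrow> real \<Rightarrow> real" where
  "interp_ref V m n \<xi> \<eta> = (\<Sum>i<3. lagr i m \<xi> * (\<Sum>s<4. V i s * spline s n \<eta>))"

lemma sum_3: "(\<Sum>i<3. f i) = f 0 + f 1 + f 2" for f :: "nat \<Rightarrow> real"
  by (simp add: eval_nat_numeral)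

lemma sum_4: "(\<Sum>i<4. f i) = f 0 + f 1 + f 2 + f 3" for f :: "nat \<Rightarrow> real"
  by (simp add: eval_nat_numeral)

lemma interp_hat_eq:
  assumes "\<eta> \<in> {-1..1}"
  shows "interp_hat v (\<xi>, \<eta>) = interp_ref
    (\<lambda>i s. if s = 0 then v (real i - 1, 1) else if s = 1 then v (real i - 1, -1)
       else if s = 2 then vector_derivative (\<lambda>t. v (real i - 1, t)) (at 1 within {-1..1})
       else vector_derivative (\<lambda>t. v (real i - 1, t)) (at (-1) within {-1..1})) 0 0 \<xi> \<eta>"
proof -
  have "(\<Sum>i\<in>{-1, 0, 1}. f i) = f (-1) + f 0 + f (1::real)" for f :: "real \<Rightarrow> real" by (simp add: add.assoc)
  moreover have "(\<Sum>i\<in>{-1, 1}. f i) = f (-1) + f (1::real)" for f :: "real \<Rightarrow> real" by simp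
  ultimately show ?thesis
    unfolding interp_hat_def interp_ref_def sum_3 sum_4
    by (simp add: phi_psi_hat[OF assms] lagrange_hat_lagr algebra_simps)
qed

lemma interp_ref_diff:
  "interp_ref V m n \<xi> \<eta> - interp_ref V' m n \<xi> \<eta> = interp_ref (\<lambda>i s. V i s - V' i s) m n \<xi> \<eta>"
  unfolding interp_ref_def sum_3 sum_4 by (simp add: algebra_simps)

lemma spline_reproduces:
  "(A + B + C) * spline 0 0 \<eta> + (A - B + C) * spline 1 0 \<eta> + (B + 2 * C) * spline 2 0 \<eta> +
    (B - 2 * C) * spline 3 0 \<eta> = A + B * \<eta> + C * \<eta>\<^sup>2"
  by (simp add: spline_def field_simps)

text \<open>At each x-node the spline reproduces the quadratic in y, and the Lagrange basis then
  reproduces the quadratic in x. The shifts by 1/3 give squares with mean zero on the reference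
  interval.\<close>

lemma interp_ref_quadratic:
  fixes c00 c10 c01 c20 c11 c02 :: real
  defines "P \<equiv> \<lambda>\<xi> \<eta>. c00 + c10 * \<xi> + c01 * \<eta> + c20 * (\<xi>\<^sup>2 - 1/3) + c11 * (\<xi> * \<eta>) + c02 * (\<eta>\<^sup>2 - 1/3)"
    and "Q \<equiv> \<lambda>\<xi> \<eta>. c01 + c11 * \<xi> + 2 * c02 * \<eta>"
  shows "interp_ref (\<lambda>i s. if s = 0 then P (real i - 1) 1 else if s = 1 then P (real i - 1) (-1)
      else if s = 2 then Q (real i - 1) 1 else Q (real i - 1) (-1)) 0 0 \<xi> \<eta> = P \<xi> \<eta>"
proof -
  have e: "P \<nu> 1 * spline 0 0 \<eta> + P \<nu> (-1) * spline 1 0 \<eta> + Q \<nu> 1 * spline 2 0 \<eta> + Q \<nu> (-1) * spline 3 0 \<eta> = P \<nu> \<eta>" for \<nu>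
    using spline_reproduces[of "c00 + c10 * \<nu> + c20 * (\<nu>\<^sup>2 - 1/3) - c02 / 3" "c01 + c11 * \<nu>" c02 \<eta>]
    by (simp add: P_def Q_def algebra_simps)
  have "lagr 0 0 \<xi> * P (-1) \<eta> + lagr 1 0 \<xi> * P 0 \<eta> + lagr 2 0 \<xi> * P 1 \<eta> = P \<xi> \<eta>"
    by (simp add: P_def lagr_def field_simps power2_eq_square)
  then show ?thesis
    unfolding interp_ref_def sum_3 sum_4 using e[of "-1"] e[of 0] e[of 1] by simp
qed

section \<open>Dependence of each derivative on differences of the data\<close>

lemma abs_sum3_le:
  fixes f :: "nat \<Rightarrow> real"
  assumes "\<And>i. i < 3 \<Longrightarrow> \<bar>f i\<bar> \<le> (K::real)" shows "\<bar>\<Sum>i<3. f i\<bar> \<le> 3 * K"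
  using assms[of 0] assms[of 1] assms[of 2] unfolding sum_3 by auto

context
  fixes V :: "nat \<Rightarrow> nat \<Rightarrow> real" and \<xi> \<eta> :: real
  assumes \<xi>: "\<xi> \<in> {-1..1}" and \<eta>: "\<eta> \<in> {-1..1}"
begin

lemma mult_bound2:
  assumes "\<bar>u\<bar> \<le> 2" "\<bar>v\<bar> \<le> K" shows "\<bar>u * v\<bar> \<le> 2 * (K::real)"
  unfolding abs_mult using assms by (intro mult_mono) auto

lemma spline_combination_bound:
  assumes "\<And>s. s < 4 \<Longrightarrow> \<bar>X s\<bar> \<le> K" shows "\<bar>\<Sum>s<4. X s * spline s n \<eta>\<bar> \<le> 8 * K"
proof -
  have "\<bar>X s * spline s n \<eta>\<bar> \<le> 2 * K" if "s < 4" for s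
    using mult_bound2[OF spline_bound[OF \<eta>, of s n] assms[OF that]] by (simp add: mult.commute)
  from this[of 0] this[of 1] this[of 2] this[of 3] show ?thesis unfolding sum_4 by (auto simp: abs_le_iff)
qed

lemma interp_ref_00_bound:
  assumes "\<And>i s. i < 3 \<Longrightarrow> s < 4 \<Longrightarrow> \<bar>V i s\<bar> \<le> K" shows "\<bar>interp_ref V 0 0 \<xi> \<eta>\<bar> \<le> 48 * K"
proof -
  \<comment> \<open>Four spline terms bounded by 2 give 8, the Lagrange factor 2, and the three
    nodes together 48. The remaining cases need at most this constant and use it as well.\<close>
  have "\<bar>lagr i 0 \<xi> * (\<Sum>s<4. V i s * spline s 0 \<eta>)\<bar> \<le> 2 * (8 * K)" if "i < 3" for i
    using assms that by (intro mult_bound2 lagr_bound \<xi> spline_combination_bound) auto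
  from abs_sum3_le[OF this] show ?thesis by (simp add: interp_ref_def)
qed

text \<open>The Lagrange polynomials sum to 1, so their derivatives sum to 0 and the middle node can
  be eliminated.\<close>

lemma interp_ref_difference:
  assumes "0 < m" "m \<le> 2"
  shows "interp_ref V m n \<xi> \<eta> = lagr 0 m \<xi> * (\<Sum>s<4. (V 0 s - V 1 s) * spline s n \<eta>) +
    lagr 2 m \<xi> * (\<Sum>s<4. (V 2 s - V 1 s) * spline s n \<eta>)"
proof -
  have "m = 1 \<or> m = 2" using assms by linarith
  then have "lagr 1 m \<xi> = - lagr 0 m \<xi> - lagr 2 m \<xi>" by (auto simp: lagr_def)
  note e = this
  show ?thesis unfolding interp_ref_def sum_3 sum_4 e by (simp add: algebra_simps)
qed

lemma interp_ref_m0_bound: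
  assumes m: "0 < m" "m \<le> 2" and "\<And>i s. i < 3 \<Longrightarrow> s < 4 \<Longrightarrow> \<bar>V i s - V 1 s\<bar> \<le> K"
  shows "\<bar>interp_ref V m 0 \<xi> \<eta>\<bar> \<le> 48 * K"
proof -
  have "\<bar>lagr i m \<xi> * (\<Sum>s<4. (V i s - V 1 s) * spline s 0 \<eta>)\<bar> \<le> 2 * (8 * K)" if "i < 3" for i
    using assms(3) that by (intro mult_bound2 lagr_bound \<xi> spline_combination_bound) auto
  from this[of 0] this[of 2] assms(3)[of 1 0] show ?thesis
    unfolding interp_ref_difference[OF m] by (auto simp: abs_le_iff)
qed

text \<open>The two splines for the values have opposite first derivatives, so the values enter only
  through their difference.\<close>

lemma spline_combination_1_bound:
  assumes "\<bar>X 0 - X 1\<bar> \<le> K" "\<bar>X 2\<bar> \<le> K" "\<bar>X 3\<bar> \<le> K"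
  shows "\<bar>\<Sum>s<4. X s * spline s 1 \<eta>\<bar> \<le> 6 * K"
proof -
  have e: "(\<Sum>s<4. X s * spline s 1 \<eta>) = spline 0 1 \<eta> * (X 0 - X 1) + spline 2 1 \<eta> * X 2 + spline 3 1 \<eta> * X 3"
    unfolding sum_4 by (simp add: spline_def algebra_simps)
  show ?thesis
    unfolding e using mult_bound2[OF spline_bound[OF \<eta>, of 0 1] assms(1)]
      mult_bound2[OF spline_bound[OF \<eta>, of 2 1] assms(2)] mult_bound2[OF spline_bound[OF \<eta>, of 3 1] assms(3)]
    by (auto simp: abs_le_iff)
qed

lemma interp_ref_01_bound:
  assumes "\<And>i. i < 3 \<Longrightarrow> \<bar>V i 0 - V i 1\<bar> \<le> K" "\<And>i. i < 3 \<Longrightarrow> \<bar>V i 2\<bar> \<le> K" "\<And>i. i < 3 \<Longrightarrow> \<bar>V i 3\<bar> \<le> K"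
  shows "\<bar>interp_ref V 0 1 \<xi> \<eta>\<bar> \<le> 48 * K"
proof -
  have "\<bar>lagr i 0 \<xi> * (\<Sum>s<4. V i s * spline s 1 \<eta>)\<bar> \<le> 2 * (6 * K)" if "i < 3" for i
    using assms that by (intro mult_bound2 lagr_bound \<xi> spline_combination_1_bound) auto
  from this[of 0] this[of 1] this[of 2] assms(1)[of 0] show ?thesis
    unfolding interp_ref_def sum_3 by (auto simp: abs_le_iff)
qed

lemma interp_ref_11_bound:
  assumes "\<And>i. i < 3 \<Longrightarrow> \<bar>(V i 0 - V 1 0) - (V i 1 - V 1 1)\<bar> \<le> K"
    "\<And>i. i < 3 \<Longrightarrow> \<bar>V i 2 - V 1 2\<bar> \<le> K" "\<And>i. i < 3 \<Longrightarrow> \<bar>V i 3 - V 1 3\<bar> \<le> K"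
  shows "\<bar>interp_ref V 1 1 \<xi> \<eta>\<bar> \<le> 48 * K"
proof -
  have "\<bar>lagr i 1 \<xi> * (\<Sum>s<4. (V i s - V 1 s) * spline s 1 \<eta>)\<bar> \<le> 2 * (6 * K)" if "i < 3" for i
    using assms that by (intro mult_bound2 lagr_bound \<xi> spline_combination_1_bound) auto
  from this[of 0] this[of 2] assms(1)[of 0] show ?thesis
    unfolding interp_ref_difference[OF zero_less_one one_le_numeral] by (auto simp: abs_le_iff)
qed

text \<open>Second derivatives annihilate affine functions, so only the deviation of the end slopes
  from the mean slope matters; the mean slope is half the difference of the values because the
  reference interval has length 2.\<close>

lemma interp_ref_02_bound:
  assumes "\<And>i. i < 3 \<Longrightarrow> \<bar>V i 2 - (V i 0 - V i 1) / 2\<bar> \<le> K" "\<And>i. i < 3 \<Longrightarrow> \<bar>V i 3 - (V i 0 - V i 1) / 2\<bar> \<le> K"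
  shows "\<bar>interp_ref V 0 2 \<xi> \<eta>\<bar> \<le> 48 * K"
proof -
  have "\<bar>lagr i 0 \<xi> * (\<Sum>s<4. V i s * spline s 2 \<eta>)\<bar> \<le> 2 * (4 * K)" if "i < 3" for i
  proof (intro mult_bound2 lagr_bound \<xi>)
    have e: "(\<Sum>s<4. V i s * spline s 2 \<eta>) = spline 2 2 \<eta> * (V i 2 - (V i 0 - V i 1) / 2) +
        spline 3 2 \<eta> * (V i 3 - (V i 0 - V i 1) / 2)"
      unfolding sum_4 by (simp add: spline_def field_simps)
    show "\<bar>\<Sum>s<4. V i s * spline s 2 \<eta>\<bar> \<le> 4 * K"
      unfolding e using mult_bound2[OF spline_bound[OF \<eta>, of 2 2] assms(1)[OF that]]
        mult_bound2[OF spline_bound[OF \<eta>, of 3 2] assms(2)[OF that]]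
      by (auto simp: abs_le_iff)
  qed
  from this[of 0] this[of 1] this[of 2] assms(1)[of 0] show ?thesis
    unfolding interp_ref_def sum_3 by (auto simp: abs_le_iff)
qed

end

subsection \<open>Scaling\<close>

definition ref_coord :: "real \<Rightarrow> real \<Rightarrow> real \<Rightarrow> real" where
  "ref_coord l r x = (2 * x - l - r) / (r - l)"

lemma ref_coord_mem: "l < r \<Longrightarrow> x \<in> {l..r} \<Longrightarrow> ref_coord l r x \<in> {-1..1}"
  by (auto simp: ref_coord_def field_simps)

lemma ref_coord_DERIV: "l < r \<Longrightarrow> (ref_coord l r has_real_derivative 2 / (r - l)) (at x)"
  unfolding ref_coord_def[abs_def] by (rule DERIV_cdivide) (auto intro!: derivative_eq_intros)

lemma ref_coord_continuous: "l < r \<Longrightarrow> continuous_on S (ref_coord l r)"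
  unfolding ref_coord_def[abs_def] by (auto intro!: continuous_intros)

lemma ref_coord_borel [measurable]: "ref_coord l r \<in> borel_measurable borel"
  unfolding ref_coord_def[abs_def] by measurable

text \<open>The powers of the scaling factor make consecutive members of a family of derivatives fit
  together by the chain rule. The one exceptional point is the midpoint, which is mapped to the knot
  0.\<close>

lemma weak_deriv1_scaled:
  assumes lr: "l < r" and g: "continuous_on UNIV g" "g \<in> borel_measurable borel" "g' \<in> borel_measurable borel"
    and D: "\<And>x. x \<noteq> 0 \<Longrightarrow> (g has_real_derivative g' x) (at x)"
    and K: "\<And>x. x \<in> {-1..1} \<Longrightarrow> \<bar>g' x\<bar> \<le> K"
  shows "weak_deriv1 l r (\<lambda>x. (2 / (r - l)) ^ n * g (ref_coord l r x)) (\<lambda>x. (2 / (r - l)) ^ Suc n * g' (ref_coord l r x))"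
proof (rule weak_deriv1I[OF lr, where S = "{(l + r) / 2}" and K = "\<bar>(2 / (r - l)) ^ Suc n\<bar> * K"])
  show "(\<lambda>x. (2 / (r - l)) ^ n * g (ref_coord l r x)) \<in> borel_measurable borel"
    "(\<lambda>x. (2 / (r - l)) ^ Suc n * g' (ref_coord l r x)) \<in> borel_measurable borel"
    by (intro borel_measurable_times borel_measurable_const measurable_compose[OF ref_coord_borel] g)+
  show "continuous_on {l..r} (\<lambda>x. (2 / (r - l)) ^ n * g (ref_coord l r x))"
    by (intro continuous_intros continuous_on_compose2[OF g(1) ref_coord_continuous[OF lr]]) auto
  show "((\<lambda>x. (2 / (r - l)) ^ n * g (ref_coord l r x)) has_real_derivative
      (2 / (r - l)) ^ Suc n * g' (ref_coord l r x)) (at x)" if "x \<in> {l<..<r} - {(l + r) / 2}" for x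
  proof -
    have "ref_coord l r x \<noteq> 0" using that lr by (auto simp: ref_coord_def field_simps)
    from DERIV_cmult[OF DERIV_chain'[OF ref_coord_DERIV[OF lr] D[OF this]], of "(2 / (r - l)) ^ n"]
    show ?thesis by (simp add: algebra_simps)
  qed
  show "\<bar>(2 / (r - l)) ^ Suc n * g' (ref_coord l r x)\<bar> \<le> \<bar>(2 / (r - l)) ^ Suc n\<bar> * K" if "x \<in> {l<..<r}" for x
    unfolding abs_mult using that by (intro mult_left_mono K ref_coord_mem lr) auto
qed simp

text \<open>\<open>legendre i n\<close> is the \<open>n\<close>-th derivative of the \<open>i\<close>-th polynomial of \<open>1, x, x\<^sup>2 - 1/3\<close>.\<close>

definition legendre :: "nat \<Rightarrow> nat \<Rightarrow> real \<Rightarrow> real" where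
  "legendre i n x =
    (if i = 0 then (if n = 0 then 1 else 0)
     else if i = 1 then (if n = 0 then x else if n = 1 then 1 else 0)
     else (if n = 0 then x\<^sup>2 - 1/3 else if n = 1 then 2 * x else if n = 2 then 2 else 0))"

lemma legendre_DERIV: "(legendre i n has_real_derivative legendre i (Suc n) x) (at x)"
proof -
  consider "n = 0" | "n = 1" | "n = 2" | "n > 2" by linarith
  then show ?thesis
    by cases (auto simp: legendre_def[abs_def] intro!: derivative_eq_intros)
qed

lemma legendre_bound: "x \<in> {-1..1} \<Longrightarrow> \<bar>legendre i n x\<bar> \<le> 2"
proof -
  assume x: "x \<in> {-1..1}"
  then have "\<bar>x\<bar> \<le> 1" by auto
  then obtain e where e: "e = x\<^sup>2" "0 \<le> e" "e \<le> 1" by (simp add: abs_square_le_1)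
  show ?thesis
    unfolding legendre_def e(1)[symmetric] using e(2,3) \<open>\<bar>x\<bar> \<le> 1\<close> by (auto simp: abs_le_iff)
qed

text \<open>A derivative of order n < i has mean zero by orthogonality to constants or by parity,
  and for n > i it vanishes. Only n = i survives, which makes the moment conditions
  diagonal.\<close>

lemma integral_legendre:
  assumes "l < r" "i \<le> 2"
  shows "(\<integral>x. indicator {l<..<r} x * legendre i n (ref_coord l r x) \<partial>lborel) =
    (if n = i then (r - l) * (if i = 2 then 2 else 1) else 0)"
proof -
  \<comment> \<open>Explicit antiderivatives; their difference between 1 and -1 is nonzero only for
    n = i.\<close>
  define \<psi> where "\<psi> = (if i = 0 then (\<lambda>x. if n = 0 then x else 0) else if i = 1 then (\<lambda>x. if n = 0 then (x\<^sup>2 - 1) / 2 else if n = 1 then x else 0)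
    else (\<lambda>x::real. if n = 0 then (x ^ 3 - x) / 3 else if n = 1 then x\<^sup>2 else if n = 2 then 2 * x else 0))"
  have D: "(\<psi> has_real_derivative legendre i n x) (at x)" for x
    unfolding \<psi>_def legendre_def[abs_def] using assms(2) by (auto intro!: derivative_eq_intros simp: field_simps)
  have D': "((\<lambda>x. (r - l) / 2 * \<psi> (ref_coord l r x)) has_real_derivative legendre i n (ref_coord l r x)) (at x)" for x
    using DERIV_cmult[OF DERIV_chain'[OF ref_coord_DERIV[OF assms(1)] D], of "(r - l) / 2"] assms(1)
    by simp
  have C: "isCont (\<lambda>x. legendre i n (ref_coord l r x)) x" for x
    using DERIV_isCont[OF DERIV_chain'[OF ref_coord_DERIV[OF assms(1)] legendre_DERIV]] by blast
  have r: "ref_coord l r l = -1" "ref_coord l r r = 1"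
    using assms(1) by (auto simp: ref_coord_def field_simps)
  have "(\<integral>x. legendre i n (ref_coord l r x) * indicator {l..r} x \<partial>lborel) =
      (r - l) / 2 * \<psi> (ref_coord l r r) - (r - l) / 2 * \<psi> (ref_coord l r l)"
    by (rule integral_FTC_Icc_real) (use assms(1) D' C in auto)
  moreover have "(\<integral>x. indicator {l<..<r} x * legendre i n (ref_coord l r x) \<partial>lborel) =
      (\<integral>x. legendre i n (ref_coord l r x) * indicator {l..r} x \<partial>lborel)"
  proof (rule integral_cong_AE)
    have [measurable]: "legendre i n \<in> borel_measurable borel"
      unfolding legendre_def[abs_def] by measurable
    show "(\<lambda>x. indicator {l<..<r} x * legendre i n (ref_coord l r x)) \<in> borel_measurable lborel"
      "(\<lambda>x. legendre i n (ref_coord l r x) * indicator {l..r} x) \<in> borel_measurable lborel" by measurable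
    show "AE x in lborel. indicator {l<..<r} x * legendre i n (ref_coord l r x) = legendre i n (ref_coord l r x) * indicator {l..r} x"
      using AE_lborel_singleton[of l] AE_lborel_singleton[of r]
      by eventually_elim (auto simp: indicator_def)
  qed
  moreover have "(r - l) / 2 * \<psi> 1 - (r - l) / 2 * \<psi> (-1) = (if n = i then (r - l) * (if i = 2 then 2 else 1) else 0)"
  proof -
    have "i = 0 \<or> i = 1 \<or> i = 2" using assms(2) by linarith
    then show ?thesis by (elim disjE) (auto simp: \<psi>_def field_simps)
  qed
  ultimately show ?thesis by (simp add: r)
qed

section \<open>The error estimate\<close>

lemma C1_on_add:
  assumes "C1_on S f" "C1_on S g" shows "C1_on S (\<lambda>p. f p + g p)"
proof -
  obtain f1 f2 where f: "continuous_on S f1" "continuous_on S f2"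
      "\<And>p. p \<in> S \<Longrightarrow> (f has_derivative (\<lambda>h. f1 p * fst h + f2 p * snd h)) (at p within S)"
    using assms(1) by (auto simp: C1_on_def)
  obtain g1 g2 where g: "continuous_on S g1" "continuous_on S g2"
      "\<And>p. p \<in> S \<Longrightarrow> (g has_derivative (\<lambda>h. g1 p * fst h + g2 p * snd h)) (at p within S)"
    using assms(2) by (auto simp: C1_on_def)
  show ?thesis
    unfolding C1_on_def
  proof (intro exI conjI ballI)
    show "continuous_on S (\<lambda>p. f1 p + g1 p)" "continuous_on S (\<lambda>p. f2 p + g2 p)"
      by (intro continuous_intros f g)+
    show "((\<lambda>p. f p + g p) has_derivative (\<lambda>h. (f1 p + g1 p) * fst h + (f2 p + g2 p) * snd h)) (at p within S)"
      if "p \<in> S" for p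
      using has_derivative_add[OF f(3)[OF that] g(3)[OF that]] by (simp add: algebra_simps)
  qed
qed

lemma C1_on_tensor:
  assumes "\<And>x. (f has_real_derivative f' x) (at x)" "continuous_on UNIV f'"
    "\<And>x. (g has_real_derivative g' x) (at x)" "continuous_on UNIV g'"
  shows "C1_on S (tensor f g)"
  unfolding C1_on_def
proof (intro exI conjI ballI)
  have c: "continuous_on UNIV f" "continuous_on UNIV g"
    using assms(1,3) by (auto intro!: continuous_at_imp_continuous_on DERIV_isCont)
  show "continuous_on S (\<lambda>p. f' (fst p) * g (snd p))" "continuous_on S (\<lambda>p. f (fst p) * g' (snd p))"
    by (auto intro!: continuous_intros continuous_on_compose2[OF c(1)] continuous_on_compose2[OF c(2)]
        continuous_on_compose2[OF assms(2)] continuous_on_compose2[OF assms(4)])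
  fix p assume "p \<in> S"
  have D: "((\<lambda>p. k (fst p)) has_derivative (\<lambda>h. k' (fst p) * fst h)) (at p)"
     "((\<lambda>p. k (snd p)) has_derivative (\<lambda>h. k' (snd p) * snd h)) (at p)"
    if "\<And>x. (k has_real_derivative k' x) (at x)" for k k' and p :: plane
    using has_derivative_compose[OF has_derivative_fst[OF has_derivative_ident], of k "(*) (k' (fst p))" p UNIV]
      has_derivative_compose[OF has_derivative_snd[OF has_derivative_ident], of k "(*) (k' (snd p))" p UNIV]
      that by (auto simp: has_field_derivative_def)
  have "((\<lambda>p. f (fst p) * g (snd p)) has_derivative
      (\<lambda>h. f (fst p) * (g' (snd p) * snd h) + f' (fst p) * fst h * g (snd p))) (at p)"
    by (rule has_derivative_mult[OF D(1)[OF assms(1)] D(2)[OF assms(3)]])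
  moreover have "(\<lambda>h. f (fst p) * (g' (snd p) * snd h) + f' (fst p) * fst h * g (snd p)) =
      (\<lambda>h. f' (fst p) * g (snd p) * fst h + f (fst p) * g' (snd p) * snd h)"
    by (auto simp: fun_eq_iff)
  ultimately show "(tensor f g has_derivative (\<lambda>h. f' (fst p) * g (snd p) * fst h + f (fst p) * g' (snd p) * snd h)) (at p within S)"
    by (simp add: tensor_def case_prod_unfold has_derivative_at_withinI)
qed

lemma C1_on_continuous: "C1_on S f \<Longrightarrow> continuous_on S f"
  by (auto simp: C1_on_def continuous_on_eq_continuous_within intro: has_derivative_continuous)

context rectangle begin

lemma has_weak_derivative_0: "has_weak_derivative Om \<gamma> (\<lambda>p. 0) (\<lambda>p. 0)" "version (\<lambda>p. 0) (\<lambda>p. 0)"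
proof -
  show v: "version (\<lambda>p. 0) (\<lambda>p. 0)" by (simp add: version_def L2_def L1_def)
  show "has_weak_derivative Om \<gamma> (\<lambda>p. 0) (\<lambda>p. 0)"
    unfolding has_weak_derivative_version_iff[OF v v] by simp
qed

lemma tensor_sum_version:
  assumes "finite I" and f: "\<And>i. i \<in> I \<Longrightarrow> bdd a b (f i)" and g: "\<And>i. i \<in> I \<Longrightarrow> bdd c d (g i)"
  shows "version (\<lambda>p. \<Sum>i\<in>I. tensor (f i) (g i) p) (\<lambda>p. indicator Om p * (\<Sum>i\<in>I. tensor (f i) (g i) p))"
  using assms
proof (induction I rule: finite_induct)
  case empty
  then show ?case using has_weak_derivative_0(2) by simp
next
  case (insert j I)
  show ?case
    using version_lincomb[OF bdd_tensor(3)[OF insert.prems(1,2)] insert.IH, of j j 1 1] insert.prems insert.hyps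
    by (simp add: distrib_left)
qed

lemma tensor_sum_has_weak_derivative:
  assumes "finite I"
    and f: "\<And>i k. i \<in> I \<Longrightarrow> k < m \<Longrightarrow> weak_deriv1 a b (f i k) (f i (Suc k))" "\<And>i k. i \<in> I \<Longrightarrow> bdd a b (f i k)"
    and g: "\<And>i k. i \<in> I \<Longrightarrow> k < n \<Longrightarrow> weak_deriv1 c d (g i k) (g i (Suc k))" "\<And>i k. i \<in> I \<Longrightarrow> bdd c d (g i k)"
  shows "has_weak_derivative Om (m, n) (\<lambda>p. \<Sum>i\<in>I. tensor (f i 0) (g i 0) p) (\<lambda>p. \<Sum>i\<in>I. tensor (f i m) (g i n) p)"
  using assms
proof (induction I rule: finite_induct)
  case empty
  then show ?case using has_weak_derivative_0(1) by simp
next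
  case (insert j I)
  have v: "version (\<lambda>p. \<Sum>i\<in>I. tensor (f i m) (g i n) p) (\<lambda>p. indicator Om p * (\<Sum>i\<in>I. tensor (f i m) (g i n) p))" for m n
    by (rule tensor_sum_version) (use insert in auto)
  have w: "has_weak_derivative Om (m, n) (\<lambda>p. \<Sum>i\<in>I. tensor (f i 0) (g i 0) p) (\<lambda>p. \<Sum>i\<in>I. tensor (f i m) (g i n) p)"
    by (rule insert.IH) (use insert.prems in auto)
  have vj: "version (tensor (f j m) (g j n)) (\<lambda>p. indicator Om p * tensor (f j m) (g j n) p)" for m n
    by (rule bdd_tensor(3)) (use insert.prems in auto)
  have wj: "has_weak_derivative Om (m, n) (tensor (f j 0) (g j 0)) (tensor (f j m) (g j n))"
    by (rule tensor_has_weak_derivative) (use insert.prems in auto)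
  show ?case
    using has_weak_derivative_lincomb[OF vj vj v v wj w, of 1 1] insert.hyps by simp
qed

lemma weak_deriv1_imp_bdd: "weak_deriv1 l r f f' \<Longrightarrow> bdd l r f" "weak_deriv1 l r f f' \<Longrightarrow> bdd l r f'"
  by (auto simp: weak_deriv1_def bdd_def)

subsection \<open>The quadratic part\<close>

definition quadratic_index :: "(nat \<times> nat) set" where
  "quadratic_index = {(0, 0), (1, 0), (0, 1), (2, 0), (1, 1), (0, 2)}"

text \<open>A polynomial of degree at most 2 in scaled Legendre coordinates, with coefficients C,
  together with its derivatives. The coefficient is placed in the x-factor so that the whole remains
  a sum of products.\<close>

definition quadratic :: "(nat \<times> nat \<Rightarrow> real) \<Rightarrow> nat \<times> nat \<Rightarrow> plane \<Rightarrow> real" where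
  "quadratic C \<gamma> p = (\<Sum>i\<in>quadratic_index.
     tensor (\<lambda>x. (2 / (b - a)) ^ fst \<gamma> * (C i * legendre (fst i) (fst \<gamma>) (ref_coord a b x)))
       (\<lambda>y. (2 / (d - c)) ^ snd \<gamma> * legendre (snd i) (snd \<gamma>) (ref_coord c d y)) p)"

lemma legendre_continuous: "continuous_on S (legendre i n)"
  using legendre_DERIV[THEN DERIV_isCont] by (auto intro!: continuous_at_imp_continuous_on)

lemma legendre_borel: "legendre i n \<in> borel_measurable borel"
  by (intro borel_measurable_continuous_onI legendre_continuous)

lemma weak_deriv1_legendre:
  assumes "l < r"
  shows "weak_deriv1 l r (\<lambda>x. (2 / (r - l)) ^ n * (K * legendre i n (ref_coord l r x)))
    (\<lambda>x. (2 / (r - l)) ^ Suc n * (K * legendre i (Suc n) (ref_coord l r x)))"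
proof (rule weak_deriv1_scaled[OF assms, where K = "\<bar>K\<bar> * 2" and g = "\<lambda>x. K * legendre i n x" and g' = "\<lambda>x. K * legendre i (Suc n) x"])
  show "((\<lambda>x. K * legendre i n x) has_real_derivative K * legendre i (Suc n) x) (at x)" for x
    by (rule DERIV_cmult[OF legendre_DERIV])
  show "\<bar>K * legendre i (Suc n) x\<bar> \<le> \<bar>K\<bar> * 2" if "x \<in> {-1..1}" for x
    unfolding abs_mult by (intro mult_left_mono legendre_bound that) simp
qed (intro continuous_intros legendre_continuous borel_measurable_times borel_measurable_const legendre_borel)+

lemma finite_quadratic_index: "finite quadratic_index"
  by (simp add: quadratic_index_def)

lemma quadratic_has_weak_derivative:
  "has_weak_derivative Om \<gamma> (quadratic C (0, 0)) (quadratic C \<gamma>)"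
  "version (quadratic C \<gamma>) (\<lambda>p. indicator Om p * quadratic C \<gamma> p)"
proof -
  note wx = weak_deriv1_legendre[OF ab]
  note wy = weak_deriv1_legendre[OF cd, where K = 1, simplified mult_1]
  note * = tensor_sum_has_weak_derivative[OF finite_quadratic_index,
    where f = "\<lambda>i n x. (2 / (b - a)) ^ n * (C i * legendre (fst i) n (ref_coord a b x))"
      and g = "\<lambda>i n y. (2 / (d - c)) ^ n * legendre (snd i) n (ref_coord c d y)",
    OF wx weak_deriv1_imp_bdd(1)[OF wx] wy weak_deriv1_imp_bdd(1)[OF wy]]
  note ** = tensor_sum_version[OF finite_quadratic_index,
    where f = "\<lambda>i x. (2 / (b - a)) ^ fst \<gamma> * (C i * legendre (fst i) (fst \<gamma>) (ref_coord a b x))"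
      and g = "\<lambda>i y. (2 / (d - c)) ^ snd \<gamma> * legendre (snd i) (snd \<gamma>) (ref_coord c d y)",
    OF weak_deriv1_imp_bdd(1)[OF wx] weak_deriv1_imp_bdd(1)[OF wy]]
  show "has_weak_derivative Om \<gamma> (quadratic C (0, 0)) (quadratic C \<gamma>)"
    using *[of "fst \<gamma>" "snd \<gamma>"] by (simp add: quadratic_def[abs_def])
  show "version (quadratic C \<gamma>) (\<lambda>p. indicator Om p * quadratic C \<gamma> p)"
    using ** by (simp add: quadratic_def[abs_def])
qed

lemma quadratic_order_3: "mi_order \<gamma> = 3 \<Longrightarrow> quadratic C \<gamma> p = 0"
  unfolding quadratic_def quadratic_index_def tensor_def
  by (cases \<gamma>) (auto simp: mi_order_def legendre_def case_prod_unfold)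

text \<open>The mean of the derivative of order \<gamma> sees the coefficient with index \<gamma>
  only, so moments can be prescribed one at a time.\<close>

lemma quadratic_integral:
  assumes "mi_order \<gamma> \<le> 2"
  obtains K where "K \<noteq> 0" "\<And>C. (\<integral>p. indicator Om p * quadratic C \<gamma> p \<partial>lborel) = K * C \<gamma>"
proof -
  obtain m n where \<gamma>: "\<gamma> = (m, n)" by fastforce
  define Ix where "Ix i = (\<integral>x. indicator {a<..<b} x * legendre i m (ref_coord a b x) \<partial>lborel)" for i
  define Iy where "Iy i = (\<integral>x. indicator {c<..<d} x * legendre i n (ref_coord c d x) \<partial>lborel)" for i
  define q where "q = (2 / (b - a)) ^ m * (2 / (d - c)) ^ n"
  have bx: "integrable lborel (\<lambda>x. indicator {l<..<r} x * legendre i k (ref_coord l r x))" if "l < r" for l r i k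
  proof (rule integrable_bounded_Ioo[where K = 2])
    show "\<bar>legendre i k (ref_coord l r x)\<bar> \<le> 2" if "x \<in> {l<..<r}" for x
      by (rule legendre_bound, rule ref_coord_mem) (use that in auto)
  qed (rule measurable_compose[OF ref_coord_borel legendre_borel])
  have t: "integrable lborel (\<lambda>p. indicator Om p * (legendre i m (ref_coord a b (fst p)) * legendre j n (ref_coord c d (snd p))))"
      "(\<integral>p. indicator Om p * (legendre i m (ref_coord a b (fst p)) * legendre j n (ref_coord c d (snd p))) \<partial>lborel) = Ix i * Iy j" for i j
  proof -
    have e: "(\<lambda>p. indicator Om p * (legendre i m (ref_coord a b (fst p)) * legendre j n (ref_coord c d (snd p)))) =
        (\<lambda>p. (indicator {a<..<b} (fst p) * legendre i m (ref_coord a b (fst p))) * (indicator {c<..<d} (snd p) * legendre j n (ref_coord c d (snd p))))"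
      by (auto simp: fun_eq_iff Om_def indicator_times)
    show "integrable lborel (\<lambda>p. indicator Om p * (legendre i m (ref_coord a b (fst p)) * legendre j n (ref_coord c d (snd p))))"
      unfolding e by (rule integrable_prod_plane(1)[OF bx[OF ab] bx[OF cd]])
    show "(\<integral>p. indicator Om p * (legendre i m (ref_coord a b (fst p)) * legendre j n (ref_coord c d (snd p))) \<partial>lborel) = Ix i * Iy j"
      unfolding e Ix_def Iy_def by (rule integrable_prod_plane(2)[OF bx[OF ab] bx[OF cd]])
  qed
  have I: "(\<integral>p. indicator Om p * quadratic C \<gamma> p \<partial>lborel) = (\<Sum>i\<in>quadratic_index. q * C i * (Ix (fst i) * Iy (snd i)))" for C
  proof -
    have "(\<lambda>p. indicator Om p * quadratic C \<gamma> p) = (\<lambda>p. \<Sum>i\<in>quadratic_index. q * C i *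
        (indicator Om p * (legendre (fst i) m (ref_coord a b (fst p)) * legendre (snd i) n (ref_coord c d (snd p)))))"
      by (auto simp: fun_eq_iff quadratic_def \<gamma> q_def tensor_def case_prod_unfold sum_distrib_left intro!: sum.cong)
    then show ?thesis using t by (simp add: Bochner_Integration.integral_sum)
  qed
  have mn: "m \<le> 2" "n \<le> 2" "m + n \<le> 2" using assms by (auto simp: \<gamma> mi_order_def)
  have ix: "Ix i = 0" if "i \<noteq> m" "i \<le> 2" for i using that integral_legendre[OF ab that(2), of m] by (simp add: Ix_def)
  have iy: "Iy i = 0" if "i \<noteq> n" "i \<le> 2" for i using that integral_legendre[OF cd that(2), of n] by (simp add: Iy_def)
  have "(\<Sum>i\<in>quadratic_index. q * C i * (Ix (fst i) * Iy (snd i))) = q * (Ix m * Iy n) * C \<gamma>" for C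
  proof -
    have "\<gamma> \<in> quadratic_index"
      using mn unfolding \<gamma> quadratic_index_def by (auto simp: numeral_2_eq_2 le_Suc_eq)
    moreover have "(\<Sum>i\<in>quadratic_index - {\<gamma>}. q * C i * (Ix (fst i) * Iy (snd i))) = 0"
    proof (rule sum.neutral, rule ballI)
      fix i assume that: "i \<in> quadratic_index - {\<gamma>}"
      have "fst i \<le> 2" "snd i \<le> 2" "fst i \<noteq> m \<or> snd i \<noteq> n"
        using that by (auto simp: quadratic_index_def \<gamma>)
      then show "q * C i * (Ix (fst i) * Iy (snd i)) = 0" using ix iy by auto
    qed
    ultimately have "(\<Sum>i\<in>quadratic_index. q * C i * (Ix (fst i) * Iy (snd i))) = q * C \<gamma> * (Ix (fst \<gamma>) * Iy (snd \<gamma>))"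
      using finite_quadratic_index by (subst sum.remove[of _ \<gamma>]) auto
    then show ?thesis by (simp add: \<gamma>)
  qed
  moreover have "q * (Ix m * Iy n) \<noteq> 0"
    using integral_legendre[OF ab mn(1), of m] integral_legendre[OF cd mn(2), of n] ab cd
    by (auto simp: q_def Ix_def Iy_def)
  ultimately show ?thesis using that[of "q * (Ix m * Iy n)"] I by simp
qed

lemma quadratic_C1_on: "C1_on S (quadratic C (0, 0))"
proof -
  have D: "((\<lambda>x. K * legendre i 0 (ref_coord l r x)) has_real_derivative K * (legendre i 1 (ref_coord l r x) * (2 / (r - l)))) (at x)"
    if "l < r" for K i l r x
    using DERIV_cmult[OF DERIV_chain'[OF ref_coord_DERIV[OF that] legendre_DERIV[of i 0]], of K] by simp
  have ct: "continuous_on UNIV (\<lambda>x. K * (legendre i 1 (ref_coord l r x) * (2 / (r - l))))" if "l < r" for K i l r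
    by (intro continuous_intros continuous_on_compose2[OF legendre_continuous ref_coord_continuous[OF that]]) auto
  have t: "C1_on S (tensor (\<lambda>x. C i * legendre (fst i) 0 (ref_coord a b x)) (\<lambda>y. 1 * legendre (snd i) 0 (ref_coord c d y)))" for i
    by (rule C1_on_tensor[OF D[OF ab] ct[OF ab] D[OF cd] ct[OF cd]])
  have "C1_on S (\<lambda>p. \<Sum>i\<in>I. tensor (\<lambda>x. C i * legendre (fst i) 0 (ref_coord a b x)) (\<lambda>y. legendre (snd i) 0 (ref_coord c d y)) p)" if "finite I" for I
    using that
  proof (induction I rule: finite_induct)
    case empty
    have "C1_on S (\<lambda>p. 0)"
      unfolding C1_on_def by (intro exI[of _ "\<lambda>p. 0"]) (auto intro!: derivative_eq_intros)
    then show ?case by simp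
  next
    case (insert i I)
    then show ?case using C1_on_add[OF t[of i] insert.IH] by simp
  qed
  from this[OF finite_quadratic_index] show ?thesis by (simp add: quadratic_def[abs_def])
qed

lemma quadratic_DERIV_y: "((\<lambda>y. quadratic C (0, 0) (x, y)) has_real_derivative quadratic C (0, 1) (x, y)) (at y within S)"
  unfolding quadratic_def tensor_def
proof (simp, rule DERIV_sum)
  fix i
  show "((\<lambda>y. C i * legendre (fst i) 0 (ref_coord a b x) * legendre (snd i) 0 (ref_coord c d y)) has_real_derivative
      C i * legendre (fst i) 0 (ref_coord a b x) * (2 * legendre (snd i) (Suc 0) (ref_coord c d y)) / (d - c)) (at y within S)"
    using DERIV_cmult[OF DERIV_chain'[OF ref_coord_DERIV[OF cd] legendre_DERIV[of "snd i" 0]],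
        of "C i * legendre (fst i) 0 (ref_coord a b x)", THEN has_field_derivative_at_within]
    by (simp add: mult_ac)
qed

subsection \<open>The interpolant\<close>

definition node :: "nat \<Rightarrow> real" where
  "node i = (a + b) / 2 + (b - a) / 2 * (real i - 1)"

lemma node_mem: "i < 3 \<Longrightarrow> node i \<in> {a..b}"
proof -
  assume "i < 3"
  then have "i = 0 \<or> i = 1 \<or> i = 2" by linarith
  then show ?thesis using ab by (auto simp: node_def field_simps)
qed

lemma ref_coord_node: "ref_coord a b (node i) = real i - 1"
  using ab by (simp add: ref_coord_def node_def field_simps)

lemma ref_coord_ends: "ref_coord c d d = 1" "ref_coord c d c = -1"
  using cd by (auto simp: ref_coord_def field_simps)

text \<open>The factor (d - c) / 2 turns a y-derivative into a derivative in the reference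
  variable.\<close>

definition node_data :: "(plane \<Rightarrow> real) \<Rightarrow> (plane \<Rightarrow> real) \<Rightarrow> nat \<Rightarrow> nat \<Rightarrow> real" where
  "node_data v vy i s = (if s = 0 then v (node i, d) else if s = 1 then v (node i, c)
     else if s = 2 then (d - c) / 2 * vy (node i, d) else (d - c) / 2 * vy (node i, c))"

definition interpolant :: "(nat \<Rightarrow> nat \<Rightarrow> real) \<Rightarrow> nat \<times> nat \<Rightarrow> plane \<Rightarrow> real" where
  "interpolant V \<gamma> p = (2 / (b - a)) ^ fst \<gamma> * (2 / (d - c)) ^ snd \<gamma> *
     interp_ref V (fst \<gamma>) (snd \<gamma>) (ref_coord a b (fst p)) (ref_coord c d (snd p))"

lemma lagr_continuous: "continuous_on S (lagr i n)"
  using lagr_DERIV[THEN DERIV_isCont] by (auto intro!: continuous_at_imp_continuous_on)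

text \<open>In y the second derivative of a spline is bounded with a jump at the midline. The first
  derivative is still continuous, which is what one more weak differentiation takes.\<close>

lemma interpolant_has_weak_derivative:
  assumes "mi_order \<gamma> \<le> 2"
  shows "has_weak_derivative Om \<gamma> (interpolant V (0, 0)) (interpolant V \<gamma>)"
    "version (interpolant V \<gamma>) (\<lambda>p. indicator Om p * interpolant V \<gamma> p)"
    "interpolant V \<gamma> \<in> borel_measurable borel"
proof -
  define f where "f i n x = (2 / (b - a)) ^ n * lagr i n (ref_coord a b x)" for i n x
  define g where "g i n y = (2 / (d - c)) ^ n * (\<Sum>s<4. V i s * spline s n (ref_coord c d y))" for i n y
  have lb: "lagr i n \<in> borel_measurable borel" for i n
    by (intro borel_measurable_continuous_onI lagr_continuous)
  have wx: "weak_deriv1 a b (f i n) (f i (Suc n))" for i n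
    unfolding f_def
    by (rule weak_deriv1_scaled[OF ab lagr_continuous lb lb lagr_DERIV lagr_bound])
  have sb: "(\<lambda>y. \<Sum>s<4. V i s * spline s n y) \<in> borel_measurable borel" for i n by measurable
  have wy: "weak_deriv1 c d (g i n) (g i (Suc n))" if "n < 2" for i n
    unfolding g_def
  proof (rule weak_deriv1_scaled[OF cd _ sb sb])
    show "continuous_on UNIV (\<lambda>y. \<Sum>s<4. V i s * spline s n y)"
      by (intro continuous_intros spline_continuous that)
    show "((\<lambda>y. \<Sum>s<4. V i s * spline s n y) has_real_derivative (\<Sum>s<4. V i s * spline s (Suc n) y)) (at y)"
      if "y \<noteq> 0" for y
      by (intro DERIV_sum DERIV_cmult spline_DERIV that \<open>n < 2\<close>)
    show "\<bar>\<Sum>s<4. V i s * spline s (Suc n) y\<bar> \<le> (\<Sum>s<4. \<bar>V i s\<bar> * 2)" if "y \<in> {-1..1}" for y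
      by (rule order_trans[OF sum_abs], intro sum_mono) (simp add: abs_mult mult_left_mono spline_bound[OF that])
  qed
  have bx: "bdd a b (f i n)" for i n by (rule weak_deriv1_imp_bdd(1)[OF wx])
  have bdy: "bdd c d (g i n)" for i n
  proof -
    have m: "g i n \<in> borel_measurable borel"
      unfolding g_def by (intro borel_measurable_times borel_measurable_const measurable_compose[OF ref_coord_borel sb])
    have "\<bar>g i n y\<bar> \<le> \<bar>(2 / (d - c)) ^ n\<bar> * (\<Sum>s<4. \<bar>V i s\<bar> * 2)" if "y \<in> {c<..<d}" for y
    proof -
      have "ref_coord c d y \<in> {-1..1}" using that by (intro ref_coord_mem cd) auto
      then have "\<bar>\<Sum>s<4. V i s * spline s n (ref_coord c d y)\<bar> \<le> (\<Sum>s<4. \<bar>V i s\<bar> * 2)"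
        by (intro order_trans[OF sum_abs] sum_mono) (simp add: abs_mult mult_left_mono spline_bound del: atLeastAtMost_iff)
      then show ?thesis unfolding g_def abs_mult[of "_ ^ n"] by (intro mult_left_mono) auto
    qed
    then have "\<exists>K. \<forall>y\<in>{c<..<d}. \<bar>g i n y\<bar> \<le> K" by blast
    then show ?thesis using m by (simp add: bdd_def)
  qed
  have e: "interpolant V \<gamma> p = (\<Sum>i<3. tensor (f i (fst \<gamma>)) (g i (snd \<gamma>)) p)" for \<gamma> p
    unfolding interpolant_def interp_ref_def f_def g_def tensor_def case_prod_unfold
    by (simp add: sum_distrib_left mult_ac)
  have n: "snd \<gamma> \<le> 2" using assms by (simp add: mi_order_def)
  note * = tensor_sum_has_weak_derivative[of "{..<3}" "fst \<gamma>" f "snd \<gamma>" g]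
    and ** = tensor_sum_version[of "{..<3}" "\<lambda>i. f i (fst \<gamma>)" "\<lambda>i. g i (snd \<gamma>)"]
  show "has_weak_derivative Om \<gamma> (interpolant V (0, 0)) (interpolant V \<gamma>)"
    using *[OF _ wx bx wy bdy] n by (simp add: e[abs_def])
  show "version (interpolant V \<gamma>) (\<lambda>p. indicator Om p * interpolant V \<gamma> p)"
    using **[OF _ bx bdy] by (simp add: e[abs_def])
  show "interpolant V \<gamma> \<in> borel_measurable borel"
    unfolding e[abs_def] by (intro borel_measurable_sum bdd_tensor(1) bx bdy)
qed

lemma interpolant_l2_bound:
  assumes "mi_order \<gamma> \<le> 2"
    and "\<And>\<xi> \<eta>. \<xi> \<in> {-1..1} \<Longrightarrow> \<eta> \<in> {-1..1} \<Longrightarrow> \<bar>interp_ref V (fst \<gamma>) (snd \<gamma>) \<xi> \<eta>\<bar> \<le> 48 * K"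
  shows "l2 (\<lambda>p. indicator Om p * interpolant V \<gamma> p) \<le>
    48 * (2 / (b - a)) ^ fst \<gamma> * (2 / (d - c)) ^ snd \<gamma> * (sqrt ((b - a) * (d - c)) * K)"
proof -
  have "\<bar>interpolant V \<gamma> p\<bar> \<le> (2 / (b - a)) ^ fst \<gamma> * (2 / (d - c)) ^ snd \<gamma> * (48 * K)" if "p \<in> Om" for p
  proof -
    have "0 \<le> (2 / (b - a)) ^ fst \<gamma> * (2 / (d - c)) ^ snd \<gamma>" using ab cd by simp
    moreover have "ref_coord a b (fst p) \<in> {-1..1}" "ref_coord c d (snd p) \<in> {-1..1}"
      using that by (auto intro!: ref_coord_mem ab cd simp: Om_def simp del: atLeastAtMost_iff) auto
    ultimately show ?thesis
      unfolding interpolant_def abs_mult[of "_ * _" "interp_ref _ _ _ _ _"]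
      using assms(2) by (intro mult_mono) auto
  qed
  from bounded_imp_L2(2)[OF interpolant_has_weak_derivative(3)[OF assms(1)] this]
  show ?thesis by (simp add: mult_ac)
qed

lemma interpolant_quadratic:
  "interpolant (node_data (quadratic C (0, 0)) (quadratic C (0, 1))) (0, 0) p = quadratic C (0, 0) p"
proof -
  obtain x y where p: "p = (x, y)" by fastforce
  define P where "P \<xi> \<eta> = C (0, 0) + C (1, 0) * \<xi> + C (0, 1) * \<eta> + C (2, 0) * (\<xi>\<^sup>2 - 1/3) +
      C (1, 1) * (\<xi> * \<eta>) + C (0, 2) * (\<eta>\<^sup>2 - 1/3)" for \<xi> \<eta>
  define Q where "Q \<xi> \<eta> = C (0, 1) + C (1, 1) * \<xi> + 2 * C (0, 2) * \<eta>" for \<xi> \<eta>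
  have q0: "quadratic C (0, 0) (x, y) = P (ref_coord a b x) (ref_coord c d y)" for x y
    by (simp add: quadratic_def quadratic_index_def tensor_def legendre_def P_def)
  have q1: "(d - c) / 2 * quadratic C (0, 1) (x, y) = Q (ref_coord a b x) (ref_coord c d y)" for x y
  proof -
    have "quadratic C (0, 1) (x, y) = 2 / (d - c) * Q (ref_coord a b x) (ref_coord c d y)"
      by (simp add: quadratic_def quadratic_index_def tensor_def legendre_def Q_def algebra_simps add_divide_distrib)
    then show ?thesis using cd by simp
  qed
  have "node_data (quadratic C (0, 0)) (quadratic C (0, 1)) =
      (\<lambda>i s. if s = 0 then P (real i - 1) 1 else if s = 1 then P (real i - 1) (-1)
        else if s = 2 then Q (real i - 1) 1 else Q (real i - 1) (-1))"
    unfolding node_data_def q0 q1 ref_coord_node ref_coord_ends by (rule refl)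
  then show ?thesis
    using interp_ref_quadratic[of "C (0, 0)" "C (1, 0)" "C (0, 1)" "C (2, 0)" "C (1, 1)" "C (0, 2)" "ref_coord a b x" "ref_coord c d y",
      folded P_def Q_def]
    by (simp add: interpolant_def p q0)
qed

lemma interpolant_node_data_add:
  "interpolant (node_data (\<lambda>p. v p + w p) (\<lambda>p. v' p + w' p)) (0, 0) p =
    interpolant (node_data v v') (0, 0) p + interpolant (node_data w w') (0, 0) p"
proof -
  have "node_data v v' i s = node_data (\<lambda>p. v p + w p) (\<lambda>p. v' p + w' p) i s - node_data w w' i s" for i s
    by (simp add: node_data_def algebra_simps)
  then have "node_data v v' = (\<lambda>i s. node_data (\<lambda>p. v p + w p) (\<lambda>p. v' p + w' p) i s - node_data w w' i s)"
    by (intro ext)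
  then have "interp_ref (node_data v v') m n \<xi> \<eta> =
      interp_ref (node_data (\<lambda>p. v p + w p) (\<lambda>p. v' p + w' p)) m n \<xi> \<eta> - interp_ref (node_data w w') m n \<xi> \<eta>" for m n \<xi> \<eta>
    by (simp only: interp_ref_diff)
  then show ?thesis unfolding interpolant_def by simp
qed

end

text \<open>\<open>Nij\<close> stands for the norm of the derivative of order (i, j) of the
  remainder. The Poincare inequalities are iterated down to the third order, where the side lengths
  form the right powers; the left sides are the norm of the remainder plus the bound for the
  interpolant. The constant 10000 merely dominates all resulting coefficients.\<close>

lemma interpolation_arithmetic:
  fixes h k :: real
  assumes hk: "0 < h" "0 < k"
    and pos: "0 \<le> N30" "0 \<le> N21" "0 \<le> N12" "0 \<le> N03"
    and p00: "N00 \<le> 3 * (h * N10 + k * N01)"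
    and p10: "N10 \<le> 3 * (h * N20 + k * N11)" and p01: "N01 \<le> 3 * (h * N11 + k * N02)"
    and p20: "N20 \<le> 3 * (h * N30 + k * N21)" and p11: "N11 \<le> 3 * (h * N21 + k * N12)"
    and p02: "N02 \<le> 3 * (h * N12 + k * N03)"
  shows "N00 + 48 * ((N00 + h * N10 + k * N01 + 2 * h * k * N11) + k * (N01 + h * N11 + k * N02 + 2 * h * k * N12))
      \<le> 10000 * (h ^ 3 * N30 + h\<^sup>2 * k * N21 + h * k\<^sup>2 * N12 + k ^ 3 * N03)" (is ?A00)
    and "N10 + 96 * ((N10 + h * N20 + k * N11 + 2 * h * k * N21) + k * (N11 + k * N12))
      \<le> 10000 * (h\<^sup>2 * N30 + h * k * N21 + k\<^sup>2 * N12)" (is ?A10)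
    and "N01 + 96 * (N01 + h * N11 + k * N02 + 2 * h * k * N12)
      \<le> 10000 * (h\<^sup>2 * N21 + h * k * N12 + k\<^sup>2 * N03)" (is ?A01)
    and "N11 + 192 * (N11 + (N11 + k * N12)) \<le> 10000 * (h * N21 + k * N12)" (is ?A11)
    and "N02 + 192 * (N02 + h * N12) \<le> 10000 * (h * N12 + k * N03)" (is ?A02)
    and "h * N20 + 192 * ((N10 + h * N20 + k * N11 + 2 * h * k * N21) + k * (N11 + k * N12))
      \<le> 10000 * (h\<^sup>2 * N30 + h * k * N21 + k\<^sup>2 * N12)" (is ?A20)
proof -
  note s = power2_eq_square power3_eq_cube algebra_simps
  have hN20: "h * N20 \<le> 3 * (h\<^sup>2 * N30 + h * k * N21)"
    using mult_left_mono[OF p20, of h] hk by (simp add: s)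
  have hN11: "h * N11 \<le> 3 * (h\<^sup>2 * N21 + h * k * N12)"
    using mult_left_mono[OF p11, of h] hk by (simp add: s)
  have kN11: "k * N11 \<le> 3 * (h * k * N21 + k\<^sup>2 * N12)"
    using mult_left_mono[OF p11, of k] hk by (simp add: s)
  have kN02: "k * N02 \<le> 3 * (h * k * N12 + k\<^sup>2 * N03)"
    using mult_left_mono[OF p02, of k] hk by (simp add: s)
  have N10: "N10 \<le> 9 * (h\<^sup>2 * N30 + 2 * (h * k * N21) + k\<^sup>2 * N12)"
    using p10 hN20 kN11 unfolding distrib_left by linarith
  have N01: "N01 \<le> 9 * (h\<^sup>2 * N21 + 2 * (h * k * N12) + k\<^sup>2 * N03)"
    using p01 hN11 kN02 unfolding distrib_left by linarith
  have hN10: "h * N10 \<le> 9 * (h ^ 3 * N30 + 2 * (h\<^sup>2 * k * N21) + h * k\<^sup>2 * N12)"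
    using mult_left_mono[OF N10, of h] hk by (simp add: s)
  have kN01: "k * N01 \<le> 9 * (h\<^sup>2 * k * N21 + 2 * (h * k\<^sup>2 * N12) + k ^ 3 * N03)"
    using mult_left_mono[OF N01, of k] hk by (simp add: s)
  have hkN11: "h * k * N11 \<le> 3 * (h\<^sup>2 * k * N21 + h * k\<^sup>2 * N12)"
    using mult_left_mono[OF p11, of "h * k"] hk by (simp add: s)
  have kkN02: "k\<^sup>2 * N02 \<le> 3 * (h * k\<^sup>2 * N12 + k ^ 3 * N03)"
    using mult_left_mono[OF p02, of "k\<^sup>2"] hk by (simp add: s)
  have n: "0 \<le> h * N21" "0 \<le> k * N12" "0 \<le> h * N12" "0 \<le> k * N03"
    "0 \<le> h\<^sup>2 * N30" "0 \<le> h * k * N21" "0 \<le> k\<^sup>2 * N12" "0 \<le> h\<^sup>2 * N21" "0 \<le> h * k * N12" "0 \<le> k\<^sup>2 * N03"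
    "0 \<le> h ^ 3 * N30" "0 \<le> h\<^sup>2 * k * N21" "0 \<le> h * k\<^sup>2 * N12" "0 \<le> k ^ 3 * N03"
    using hk pos by simp_all
  \<comment> \<open>Products are brought to one normal form, so that linear arithmetic sees equal
    monomials as equal atoms.\<close>
  have e: "2 * h * k * N = 2 * (h * k * N)" "k * (N11 + k * N12) = k * N11 + k\<^sup>2 * N12"
    "k * (N01 + h * N11 + k * N02 + 2 * (h * k * N12)) = k * N01 + h * k * N11 + k\<^sup>2 * N02 + 2 * (h * k\<^sup>2 * N12)" for N
    by (simp_all add: s)
  show ?A00 unfolding e using p00 hN10 kN01 hkN11 kkN02 n unfolding distrib_left by linarith
  show ?A10 unfolding e using N10 hN20 kN11 n unfolding distrib_left by linarith
  show ?A01 unfolding e using N01 hN11 kN02 n unfolding distrib_left by linarith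
  show ?A11 using p11 n unfolding distrib_left by linarith
  show ?A02 using p02 n unfolding distrib_left by linarith
  show ?A20 unfolding e using N10 hN20 kN11 n unfolding distrib_left by linarith
qed

lemma sum_mi_order: "(\<Sum>\<alpha> | mi_order \<alpha> = n. f \<alpha>) = (\<Sum>i\<le>n. f (i, n - i))"
proof -
  have "{\<alpha>. mi_order \<alpha> = n} = (\<lambda>i. (i, n - i)) ` {..n}"
    by (auto simp: mi_order_def image_iff)
  then show ?thesis by (simp add: sum.reindex inj_on_def)
qed

section \<open>Norm bounds for the interpolant of the remainder\<close>

context rectangle begin

text \<open>A triangle inequality with the factor 2, read off from (x - y)^2 <= 2x^2 + 2y^2. The
  coefficients 1 and -1 are written out to match the lemmas on linear combinations.\<close>

lemma l2_diff_le:
  assumes "L2 f" "L2 g" shows "l2 (\<lambda>p. 1 * f p + (-1) * g p) \<le> 2 * (l2 f + l2 g)"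
proof -
  have f: "integrable lborel (\<lambda>p. (f p)\<^sup>2)" and g: "integrable lborel (\<lambda>p. (g p)\<^sup>2)" using assms by (auto simp: L2_def)
  have i: "integrable lborel (\<lambda>p. 2 * (f p)\<^sup>2 + 2 * (g p)\<^sup>2)" using f g by simp
  have d: "integrable lborel (\<lambda>p. (1 * f p + (-1) * g p)\<^sup>2)" using L2_lincomb[OF assms, of 1 "-1"] by (simp add: L2_def)
  have e: "(1 * x + (-1) * y)\<^sup>2 \<le> 2 * x\<^sup>2 + 2 * y\<^sup>2" for x y :: real
    using zero_le_power2[of "x + y"] by (simp add: power2_eq_square algebra_simps)
  have 1: "(l2 (\<lambda>p. 1 * f p + (-1) * g p))\<^sup>2 \<le> (\<integral>p. 2 * (f p)\<^sup>2 + 2 * (g p)\<^sup>2 \<partial>lborel)"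
    unfolding l2_power2[of "\<lambda>p. 1 * f p + (-1) * g p"] by (rule integral_mono[OF d i e])
  have 2: "(\<integral>p. 2 * (f p)\<^sup>2 + 2 * (g p)\<^sup>2 \<partial>lborel) = 2 * (l2 f)\<^sup>2 + 2 * (l2 g)\<^sup>2"
    unfolding l2_power2[of f] l2_power2[of g] using f g by simp
  have 3: "2 * x\<^sup>2 + 2 * y\<^sup>2 \<le> (2 * (x + y))\<^sup>2" if "0 \<le> x" "0 \<le> y" for x y :: real
    using mult_nonneg_nonneg[OF that] zero_le_power2[of x] zero_le_power2[of y]
    by (simp add: power2_eq_square algebra_simps)
  have "(l2 (\<lambda>p. 1 * f p + (-1) * g p))\<^sup>2 \<le> (2 * (l2 f + l2 g))\<^sup>2"
    using 1 3[OF l2_nonneg[of f] l2_nonneg[of g]] unfolding 2 by (rule order_trans)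
  then show ?thesis
    by (rule power2_le_imp_le) (simp add: l2_nonneg)
qed

text \<open>The square root of the area. It is the factor by which Cauchy-Schwarz passes from L^1 to
  L^2 norms and also the norm of the constant 1, so it cancels between the pointwise bounds and the
  norm of the interpolant.\<close>

definition side :: real where
  "side = sqrt ((b - a) * (d - c))"

lemma side: "0 < side" "side * side = (b - a) * (d - c)"
  using ab cd by (auto simp: side_def)

context
  fixes v f f1 f2 f12
  assumes R: "represents v f f1 f2 f12" and L: "L2 f" "L2 f1" "L2 f2" "L2 f12"
begin

lemma side_sup_bound:
  assumes "x \<in> {a..b}" "y \<in> {c..d}"
  shows "side * \<bar>v (x, y)\<bar> \<le> l2 f + (b - a) * l2 f1 + (d - c) * l2 f2 + 2 * (b - a) * (d - c) * l2 f12"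
proof -
  note n = L[THEN L1_norm_le_l2, folded side_def]
  have "side * (side * \<bar>v (x, y)\<bar>) = (b - a) * (d - c) * \<bar>v (x, y)\<bar>"
    unfolding side(2)[symmetric] by simp
  moreover have "\<dots> \<le> side * l2 f + (b - a) * (side * l2 f1) + (d - c) * (side * l2 f2) + 2 * (b - a) * (d - c) * (side * l2 f12)"
    using ab cd by (intro order_trans[OF sup_bound[OF R assms]] add_mono mult_left_mono n) auto
  moreover have "\<dots> = side * (l2 f + (b - a) * l2 f1 + (d - c) * l2 f2 + 2 * (b - a) * (d - c) * l2 f12)"
    by (simp only: distrib_left mult.assoc mult.left_commute[of _ side])
  ultimately have "side * (side * \<bar>v (x, y)\<bar>) \<le> side * (l2 f + (b - a) * l2 f1 + (d - c) * l2 f2 + 2 * (b - a) * (d - c) * l2 f12)"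
    by (simp only:)
  then show ?thesis using side(1) by (simp only: mult_le_cancel_left_pos)
qed

lemma side_difference_x_bound:
  assumes "x1 \<in> {a..b}" "x2 \<in> {a..b}"
  shows "side * \<bar>v (x2, y) - v (x1, y)\<bar> \<le> (b - a) * (l2 f1 + (d - c) * l2 f12)"
proof -
  let ?D = "\<bar>v (x2, y) - v (x1, y)\<bar>"
  note n = L(2,4)[THEN L1_norm_le_l2, folded side_def]
  have "(d - c) * ?D \<le> side * l2 f1 + (d - c) * (side * l2 f12)"
    using cd by (intro order_trans[OF difference_x_bound[OF R assms]] add_mono mult_left_mono n) auto
  then have "side * ((d - c) * ?D) \<le> side * (side * l2 f1 + (d - c) * (side * l2 f12))"
    using side(1) by (simp only: mult_le_cancel_left_pos)
  also have "\<dots> = (side * side) * (l2 f1 + (d - c) * l2 f12)"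
    by (simp add: algebra_simps)
  finally have "(d - c) * (side * ?D) \<le> (d - c) * ((b - a) * (l2 f1 + (d - c) * l2 f12))"
    unfolding side(2) by (simp only: mult_ac)
  then show ?thesis using cd by (simp only: mult_le_cancel_left_pos diff_gt_0_iff_gt)
qed

lemma side_difference_y_bound:
  assumes "y1 \<in> {c..d}" "y2 \<in> {c..d}"
  shows "side * \<bar>v (x, y2) - v (x, y1)\<bar> \<le> (d - c) * (l2 f2 + (b - a) * l2 f12)"
proof -
  let ?D = "\<bar>v (x, y2) - v (x, y1)\<bar>"
  note n = L(3,4)[THEN L1_norm_le_l2, folded side_def]
  have "(b - a) * ?D \<le> side * l2 f2 + (b - a) * (side * l2 f12)"
    using ab by (intro order_trans[OF difference_y_bound[OF R assms]] add_mono mult_left_mono n) auto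
  then have "side * ((b - a) * ?D) \<le> side * (side * l2 f2 + (b - a) * (side * l2 f12))"
    using side(1) by (simp only: mult_le_cancel_left_pos)
  also have "\<dots> = (side * side) * (l2 f2 + (b - a) * l2 f12)"
    by (simp add: algebra_simps)
  finally have "(b - a) * (side * ?D) \<le> (b - a) * ((d - c) * (l2 f2 + (b - a) * l2 f12))"
    unfolding side(2) by (simp only: mult_ac)
  then show ?thesis using ab by (simp only: mult_le_cancel_left_pos diff_gt_0_iff_gt)
qed

lemma side_mixed_bound:
  "side * \<bar>v (x2, y2) - v (x1, y2) - v (x2, y1) + v (x1, y1)\<bar> \<le> (b - a) * (d - c) * l2 f12"
proof -
  have "\<bar>v (x2, y2) - v (x1, y2) - v (x2, y1) + v (x1, y1)\<bar> \<le> side * l2 f12"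
    using R L1_norm_le_l2[OF L(4), folded side_def] unfolding represents_def by (blast intro: order_trans)
  from mult_left_mono[OF this, of side] show ?thesis
    using side(1) by (simp only: mult.assoc[symmetric] side(2) less_imp_le)
qed

end

lemma represents_lipschitz_x:
  assumes R: "represents v f f1 f2 f12" and R1: "represents v1 f1 g1 g2 g12"
    and T: "\<And>x y. x \<in> {a..b} \<Longrightarrow> y \<in> {c..d} \<Longrightarrow> \<bar>v1 (x, y)\<bar> \<le> T"
    and x: "x1 \<in> {a..b}" "x2 \<in> {a..b}" and y: "y \<in> {c..d}"
  shows "\<bar>v (x2, y) - v (x1, y)\<bar> \<le> (b - a) * T"
proof -
  have "norm (v (x2, y) - v (x1, y)) \<le> T * norm (x2 - x1)"
    by (rule field_differentiable_bound[OF _ represents_DERIV_x[OF R R1 _ y]]) (use x y T in auto)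
  also have "\<dots> \<le> T * (b - a)"
    using x T[OF x(1) y] by (intro mult_left_mono) auto
  finally show ?thesis by (simp add: mult.commute)
qed

lemma represents_lipschitz_y:
  assumes R: "represents v f f1 f2 f12" and R2: "represents v2 f2 g1 g2 g12"
    and T: "\<And>x y. x \<in> {a..b} \<Longrightarrow> y \<in> {c..d} \<Longrightarrow> \<bar>v2 (x, y)\<bar> \<le> T"
    and x: "x \<in> {a..b}" and y: "y1 \<in> {c..d}" "y2 \<in> {c..d}"
  shows "\<bar>v (x, y2) - v (x, y1)\<bar> \<le> (d - c) * T"
proof -
  have "norm (v (x, y2) - v (x, y1)) \<le> T * norm (y2 - y1)"
    by (rule field_differentiable_bound[OF _ represents_DERIV_y[OF R R2 x]]) (use x y T in auto)
  also have "\<dots> \<le> T * (d - c)"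
    using y T[OF x y(1)] by (intro mult_left_mono) auto
  finally show ?thesis by (simp add: mult.commute)
qed

text \<open>The mean slope between the end points is attained by the derivative at some t, which
  turns deviations from the mean slope into differences of \<open>v2\<close>.\<close>

lemma represents_mean_value_y:
  assumes R: "represents v f f1 f2 f12" and R2: "represents v2 f2 g1 g2 g12" and x: "x \<in> {a..b}"
  obtains t where "t \<in> {c..d}" "v (x, d) - v (x, c) = (d - c) * v2 (x, t)"
proof -
  have "\<exists>t\<in>{c<..<d}. v (x, d) - v (x, c) = (v2 (x, t)) * (d - c)"
    by (rule mvt_simple[OF cd]) (use represents_DERIV_y[OF R R2 x] in \<open>auto simp: has_field_derivative_def\<close>)
  then obtain t where "t \<in> {c<..<d}" "v (x, d) - v (x, c) = v2 (x, t) * (d - c)" by blast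
  then show ?thesis using that[of t] by (simp add: mult.commute)
qed

text \<open>Each bound below is \<open>side\<close> times a bound for the finitely many functionals of the
  data on which the corresponding derivative of the interpolant depends.\<close>

lemma interpolant_node_data_bounds:
  assumes R: "represents q W00 W10 W01 W11" and R1: "represents q1 W10 W20 W11 W21"
    and R2: "represents q2 W01 W11 W02 W12"
    and L: "L2 W00" "L2 W10" "L2 W01" "L2 W20" "L2 W11" "L2 W02" "L2 W21" "L2 W12"
  defines "h \<equiv> b - a" and "k \<equiv> d - c"
  defines "S0 \<equiv> l2 W00 + h * l2 W10 + k * l2 W01 + 2 * h * k * l2 W11"
    and "S1 \<equiv> l2 W10 + h * l2 W20 + k * l2 W11 + 2 * h * k * l2 W21"
    and "S2 \<equiv> l2 W01 + h * l2 W11 + k * l2 W02 + 2 * h * k * l2 W12"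
    and "I \<equiv> \<lambda>\<gamma>. l2 (\<lambda>p. indicator Om p * interpolant (node_data q q2) \<gamma> p)"
  shows "I (0, 0) \<le> 48 * (S0 + k * S2)"
    and "I (1, 0) \<le> 96 * (S1 + k * (l2 W11 + k * l2 W12))"
    and "h * I (2, 0) \<le> 192 * (S1 + k * (l2 W11 + k * l2 W12))"
    and "I (0, 1) \<le> 96 * S2"
    and "I (1, 1) \<le> 192 * (l2 W11 + (l2 W11 + k * l2 W12))"
    and "I (0, 2) \<le> 192 * (l2 W02 + h * l2 W12)"
proof -
  let ?V = "node_data q q2"
  have hk: "0 < h" "0 < k" using ab cd by (auto simp: h_def k_def)
  have sp: "0 < side" by (rule side(1))
  have dv: "\<bar>z\<bar> \<le> r / side" if "side * \<bar>z\<bar> \<le> r" for z r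
    using that sp by (simp add: field_simps)
  have dk: "\<bar>k / 2 * z\<bar> \<le> k * r / side" if "side * \<bar>z\<bar> \<le> r" for z r
  proof -
    have "0 \<le> side * \<bar>z\<bar>" using sp by simp
    then have "k / 2 * (side * \<bar>z\<bar>) \<le> k * r" using that hk by (intro mult_mono) auto
    then show ?thesis using hk by (intro dv) (simp add: abs_mult mult_ac)
  qed
  have ends: "c \<in> {c..d}" "d \<in> {c..d}" using cd by auto
  have b0: "side * \<bar>q (x, y)\<bar> \<le> S0" and b1: "side * \<bar>q1 (x, y)\<bar> \<le> S1" and b2: "side * \<bar>q2 (x, y)\<bar> \<le> S2"
    if "x \<in> {a..b}" "y \<in> {c..d}" for x y
    using side_sup_bound[OF R L(1,2,3,5) that] side_sup_bound[OF R1 L(2,4,5,7) that] side_sup_bound[OF R2 L(3,5,6,8) that]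
    by (simp_all add: S0_def S1_def S2_def h_def k_def)
  have S: "0 \<le> S0" "0 \<le> S1" "0 \<le> S2" using hk by (auto simp: S0_def S1_def S2_def l2_nonneg intro!: add_nonneg_nonneg mult_nonneg_nonneg)
  have IB: "I \<gamma> \<le> 48 * (2 / h) ^ fst \<gamma> * (2 / k) ^ snd \<gamma> * r"
    if "mi_order \<gamma> \<le> 2" "\<And>\<xi> \<eta>. \<xi> \<in> {-1..1} \<Longrightarrow> \<eta> \<in> {-1..1} \<Longrightarrow> \<bar>interp_ref ?V (fst \<gamma>) (snd \<gamma>) \<xi> \<eta>\<bar> \<le> 48 * (r / side)" for \<gamma> r
    using interpolant_l2_bound[OF that, folded side_def] sp by (simp add: I_def h_def k_def)
  have s4: "s = 0 \<or> s = 1 \<or> s = 2 \<or> s = 3" if "s < 4" for s :: nat using that by linarith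
  have V: "?V i 0 = q (node i, d)" "?V i 1 = q (node i, c)" "?V i 2 = k / 2 * q2 (node i, d)" "?V i 3 = k / 2 * q2 (node i, c)" for i
    by (simp_all add: node_data_def k_def)
  have mono: "x / side \<le> y / side" if "x \<le> y" for x y using that sp by (simp add: divide_right_mono)
  have one: "node 1 \<in> {a..b}" by (rule node_mem) simp

  have "\<bar>?V i s\<bar> \<le> (S0 + k * S2) / side" if i: "i < 3" and "s < 4" for i s
  proof -
    have "\<bar>q (node i, y)\<bar> \<le> (S0 + k * S2) / side" "\<bar>k / 2 * q2 (node i, y)\<bar> \<le> (S0 + k * S2) / side" if "y \<in> {c..d}" for y
    proof -
      have *: "S0 \<le> S0 + k * S2" "k * S2 \<le> S0 + k * S2" using S hk by auto
      show "\<bar>q (node i, y)\<bar> \<le> (S0 + k * S2) / side"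
        by (rule order_trans[OF dv[OF b0[OF node_mem[OF i] that]] mono[OF *(1)]])
      show "\<bar>k / 2 * q2 (node i, y)\<bar> \<le> (S0 + k * S2) / side"
        by (rule order_trans[OF dk[OF b2[OF node_mem[OF i] that]] mono[OF *(2)]])
    qed
    note B = this
    have "\<bar>?V i 0\<bar> \<le> (S0 + k * S2) / side" "\<bar>?V i 1\<bar> \<le> (S0 + k * S2) / side"
      "\<bar>?V i 2\<bar> \<le> (S0 + k * S2) / side" "\<bar>?V i 3\<bar> \<le> (S0 + k * S2) / side"
      unfolding V by (rule B, rule ends)+
    then show ?thesis using s4[OF \<open>s < 4\<close>] by (elim disjE) (simp_all only:)
  qed
  then have "\<bar>interp_ref ?V 0 0 \<xi> \<eta>\<bar> \<le> 48 * ((S0 + k * S2) / side)" if "\<xi> \<in> {-1..1}" "\<eta> \<in> {-1..1}" for \<xi> \<eta>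
    by (intro interp_ref_00_bound that) auto
  then show "I (0, 0) \<le> 48 * (S0 + k * S2)" using IB[of "(0, 0)" "S0 + k * S2"] by (simp add: mi_order_def)

  \<comment> \<open>A difference bound instead of a bound for the derivative: a pointwise bound for
    the mixed second derivative would require a derivative of order four.\<close>
  have q2x: "side * \<bar>q2 (node i, y) - q2 (node 1, y)\<bar> \<le> h * (l2 W11 + k * l2 W12)" if "i < 3" for i y
    using side_difference_x_bound[OF R2 L(3,5,6,8) one node_mem[OF that], of y] by (simp add: h_def k_def)
  \<comment> \<open>The factor h cancels the scaling 2 / h of one x-derivative and leaves 2 * 48.
    For two x-derivatives one division by h remains, so h times the norm is bounded, by 4 *
    48.\<close>
  define r10 where "r10 = h * (S1 + k * (l2 W11 + k * l2 W12))"
  have "\<bar>?V i s - ?V 1 s\<bar> \<le> r10 / side" if i: "i < 3" and "s < 4" for i s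
  proof -
    have "\<bar>q (node i, y) - q (node 1, y)\<bar> \<le> h * (S1 / side)" if y: "y \<in> {c..d}" for y
      unfolding h_def by (rule represents_lipschitz_x[OF R R1 _ one node_mem[OF i] y]) (intro dv b1)
    moreover have "h * (S1 / side) \<le> r10 / side"
      unfolding times_divide_eq_right
      using hk l2_nonneg by (intro mono) (auto simp: r10_def intro!: add_nonneg_nonneg mult_nonneg_nonneg)
    ultimately have B1: "\<bar>q (node i, y) - q (node 1, y)\<bar> \<le> r10 / side" if "y \<in> {c..d}" for y
      using that by (blast intro: order_trans)
    have B2: "\<bar>k / 2 * q2 (node i, y) - k / 2 * q2 (node 1, y)\<bar> \<le> r10 / side" for y
    proof -
      have "\<bar>k / 2 * (q2 (node i, y) - q2 (node 1, y))\<bar> \<le> k * (h * (l2 W11 + k * l2 W12)) / side"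
        by (rule dk[OF q2x[OF i]])
      also have "\<dots> \<le> r10 / side"
        using hk S by (intro mono) (simp add: r10_def algebra_simps)
      finally show ?thesis by (simp only: right_diff_distrib)
    qed
    have "\<bar>?V i 0 - ?V 1 0\<bar> \<le> r10 / side" "\<bar>?V i 1 - ?V 1 1\<bar> \<le> r10 / side"
      "\<bar>?V i 2 - ?V 1 2\<bar> \<le> r10 / side" "\<bar>?V i 3 - ?V 1 3\<bar> \<le> r10 / side"
      unfolding V by (rule B1, rule ends, rule B1, rule ends, rule B2, rule B2)
    then show ?thesis using s4[OF \<open>s < 4\<close>] by (elim disjE) (simp_all only:)
  qed
  then have i10: "\<bar>interp_ref ?V m 0 \<xi> \<eta>\<bar> \<le> 48 * (r10 / side)" if "\<xi> \<in> {-1..1}" "\<eta> \<in> {-1..1}" "0 < m" "m \<le> 2" for \<xi> \<eta> m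
    by (intro interp_ref_m0_bound that) auto
  show "I (1, 0) \<le> 96 * (S1 + k * (l2 W11 + k * l2 W12))"
    using IB[of "(1, 0)" r10] i10[of _ _ 1] hk by (simp add: mi_order_def r10_def)
  show "h * I (2, 0) \<le> 192 * (S1 + k * (l2 W11 + k * l2 W12))"
  proof -
    have "I (2, 0) \<le> 48 * (2 / h)\<^sup>2 * r10" using IB[of "(2, 0)" r10] i10[of _ _ 2] by (simp add: mi_order_def)
    then have "h * I (2, 0) \<le> h * (48 * (2 / h)\<^sup>2 * r10)" using hk by simp
    also have "\<dots> = 192 * (S1 + k * (l2 W11 + k * l2 W12))" using hk by (simp add: r10_def power2_eq_square)
    finally show ?thesis .
  qed

  have "\<bar>interp_ref ?V 0 1 \<xi> \<eta>\<bar> \<le> 48 * (k * S2 / side)" if "\<xi> \<in> {-1..1}" "\<eta> \<in> {-1..1}" for \<xi> \<eta>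
  proof (rule interp_ref_01_bound[OF that])
    fix i :: nat assume i: "i < 3"
    have "\<bar>q (node i, d) - q (node i, c)\<bar> \<le> k * (S2 / side)"
      unfolding k_def by (rule represents_lipschitz_y[OF R R2 _ node_mem[OF i] ends]) (intro dv b2)
    then show "\<bar>?V i 0 - ?V i 1\<bar> \<le> k * S2 / side" unfolding V by simp
    show "\<bar>?V i 2\<bar> \<le> k * S2 / side" "\<bar>?V i 3\<bar> \<le> k * S2 / side"
      unfolding V by (intro dk b2 node_mem i ends)+
  qed
  then show "I (0, 1) \<le> 96 * S2" using IB[of "(0, 1)" "k * S2"] hk by (simp add: mi_order_def)

  \<comment> \<open>The values contribute a mixed difference, the slopes a first difference in x;
    both carry h * k, which cancels against the scaling of the mixed derivative.\<close>
  define r11 where "r11 = h * k * (l2 W11 + (l2 W11 + k * l2 W12))"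
  have "\<bar>interp_ref ?V 1 1 \<xi> \<eta>\<bar> \<le> 48 * (r11 / side)" if "\<xi> \<in> {-1..1}" "\<eta> \<in> {-1..1}" for \<xi> \<eta>
  proof (rule interp_ref_11_bound[OF that])
    fix i :: nat assume i: "i < 3"
    have "side * \<bar>q (node i, d) - q (node 1, d) - q (node i, c) + q (node 1, c)\<bar> \<le> h * k * l2 W11"
      using side_mixed_bound[OF R L(1,2,3,5)] by (simp add: h_def k_def)
    also have "\<dots> \<le> r11"
      unfolding r11_def using hk l2_nonneg by (intro mult_left_mono) (auto intro!: add_nonneg_nonneg mult_nonneg_nonneg)
    finally have "\<bar>q (node i, d) - q (node 1, d) - q (node i, c) + q (node 1, c)\<bar> \<le> r11 / side" by (rule dv)
    then show "\<bar>(?V i 0 - ?V 1 0) - (?V i 1 - ?V 1 1)\<bar> \<le> r11 / side" unfolding V by (simp add: algebra_simps)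
    have "\<bar>k / 2 * q2 (node i, y) - k / 2 * q2 (node 1, y)\<bar> \<le> r11 / side" for y
    proof -
      have "\<bar>k / 2 * (q2 (node i, y) - q2 (node 1, y))\<bar> \<le> k * (h * (l2 W11 + k * l2 W12)) / side"
        by (rule dk[OF q2x[OF i]])
      also have "\<dots> \<le> r11 / side"
        using hk l2_nonneg[of W11] by (intro mono) (simp add: r11_def algebra_simps)
      finally show ?thesis by (simp only: right_diff_distrib)
    qed
    then show "\<bar>?V i 2 - ?V 1 2\<bar> \<le> r11 / side" "\<bar>?V i 3 - ?V 1 3\<bar> \<le> r11 / side" unfolding V by simp_all
  qed
  then show "I (1, 1) \<le> 192 * (l2 W11 + (l2 W11 + k * l2 W12))"
    using IB[of "(1, 1)" r11] hk by (simp add: mi_order_def r11_def)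

  \<comment> \<open>One factor k comes from the slopes in the reference variable, the other from the
    y-difference of \<open>q2\<close> between an end point and the mean value point.\<close>
  define r02 where "r02 = k * (k * (l2 W02 + h * l2 W12))"
  have "\<bar>interp_ref ?V 0 2 \<xi> \<eta>\<bar> \<le> 48 * (r02 / side)" if "\<xi> \<in> {-1..1}" "\<eta> \<in> {-1..1}" for \<xi> \<eta>
  proof (rule interp_ref_02_bound[OF that])
    fix i :: nat assume i: "i < 3"
    obtain t where t: "t \<in> {c..d}" "q (node i, d) - q (node i, c) = k * q2 (node i, t)"
      using represents_mean_value_y[OF R R2 node_mem[OF i]] unfolding k_def by blast
    have "\<bar>k / 2 * q2 (node i, y) - (q (node i, d) - q (node i, c)) / 2\<bar> \<le> r02 / side" if y: "y \<in> {c..d}" for y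
    proof -
      have "\<bar>k / 2 * (q2 (node i, y) - q2 (node i, t))\<bar> \<le> r02 / side"
        unfolding r02_def
        by (rule dk) (use side_difference_y_bound[OF R2 L(3,5,6,8) t(1) y, of "node i"] in \<open>simp add: h_def k_def\<close>)
      then show ?thesis unfolding t(2) by (simp add: right_diff_distrib)
    qed
    then show "\<bar>?V i 2 - (?V i 0 - ?V i 1) / 2\<bar> \<le> r02 / side" "\<bar>?V i 3 - (?V i 0 - ?V i 1) / 2\<bar> \<le> r02 / side"
      unfolding V using ends by auto
  qed
  then show "I (0, 2) \<le> 192 * (l2 W02 + h * l2 W12)"
    using IB[of "(0, 2)" r02] hk by (simp add: mi_order_def r02_def power2_eq_square)
qed

end

text \<open>The shape of the final combination: triangle inequality with factor 2, bound for the
  interpolant, arithmetic.\<close>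

lemma double_bound:
  fixes x y z r s :: real
  assumes "x \<le> 2 * (y + z)" "z \<le> r" "y + r \<le> 10000 * s" shows "x \<le> 20000 * s"
proof -
  have "2 * (y + z) \<le> 2 * (10000 * s)" using assms(2,3) by (intro mult_left_mono) auto
  from order_trans[OF assms(1) this] show ?thesis by simp
qed

lemma scaled_double_bound:
  fixes h x y z r s :: real
  assumes "0 < h" "x \<le> 2 * (y + z)" "h * z \<le> r" "h * y + r \<le> 10000 * s" shows "h * x \<le> 20000 * s"
proof (rule double_bound[OF _ assms(3,4)])
  show "h * x \<le> 2 * (h * y + h * z)"
    using mult_left_mono[OF assms(2), of h] assms(1) by (simp add: algebra_simps)
qed

section \<open>Assembling the estimate for the interpolation error\<close>

context rectangle begin

lemma sobolev_H_weak_D: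
  assumes "u \<in> sobolev_H n Om" "mi_order \<gamma> \<le> n"
  obtains Z where "has_weak_derivative Om \<gamma> u (weak_D Om \<gamma> u)" "version (weak_D Om \<gamma> u) Z"
proof -
  obtain w where w: "w \<in> L2_space Om" "has_weak_derivative Om \<gamma> u w"
    using assms unfolding sobolev_H_def by blast
  obtain Z where "version w Z" using w(1) by (rule L2_space_version)
  from weak_D_version[OF w(2) this] show thesis by (rule that)
qed

text \<open>The weak derivative of order zero picked by \<open>SOME\<close> need not be u itself,
  but agrees with u almost everywhere.\<close>

lemma sobolev_H_version:
  assumes u: "u \<in> sobolev_H n Om" and Z: "version (weak_D Om (0, 0) u) Z" shows "version u Z"
proof -
  obtain U where U: "version u U" using u by (auto simp: sobolev_H_def elim: L2_space_version)
  have "has_weak_derivative Om (0, 0) u u"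
    unfolding has_weak_derivative_version_iff[OF U U] by (simp add: classical_D_def mi_order_def)
  moreover have "has_weak_derivative Om (0, 0) u (weak_D Om (0, 0) u)"
    by (rule sobolev_H_weak_D[OF u, of "(0, 0)"]) (simp_all add: mi_order_def)
  ultimately show ?thesis using Z by (rule has_weak_derivative_imp_version)
qed

lemma sobolev_HI:
  assumes "version u U" "\<And>\<gamma>. mi_order \<gamma> \<le> n \<Longrightarrow> has_weak_derivative Om \<gamma> u (w \<gamma>) \<and> version (w \<gamma>) (W \<gamma>)"
  shows "u \<in> sobolev_H n Om"
  using assms version_L2_space unfolding sobolev_H_def by blast

lemma moment_free_remainder:
  assumes u: "u \<in> sobolev_H 3 Om"
  obtains C w W where
    "\<And>\<gamma>. mi_order \<gamma> \<le> 3 \<Longrightarrow> has_weak_derivative Om \<gamma> (\<lambda>p. 1 * u p + (-1) * quadratic C (0, 0) p) (w \<gamma>)"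
    "\<And>\<gamma>. mi_order \<gamma> \<le> 3 \<Longrightarrow> version (w \<gamma>) (W \<gamma>)"
    "version (\<lambda>p. 1 * u p + (-1) * quadratic C (0, 0) p) (W (0, 0))"
    "\<And>\<gamma>. mi_order \<gamma> \<le> 2 \<Longrightarrow> (\<integral>p. W \<gamma> p \<partial>lborel) = 0"
    "\<And>\<gamma>. mi_order \<gamma> = 3 \<Longrightarrow> version (weak_D Om \<gamma> u) (W \<gamma>)"
proof -
  have "\<exists>Z. mi_order \<gamma> \<le> 3 \<longrightarrow> has_weak_derivative Om \<gamma> u (weak_D Om \<gamma> u) \<and> version (weak_D Om \<gamma> u) Z" for \<gamma>
    using sobolev_H_weak_D[OF u, of \<gamma>] by blast
  then have "\<exists>Z. \<forall>\<gamma>. mi_order \<gamma> \<le> 3 \<longrightarrow> has_weak_derivative Om \<gamma> u (weak_D Om \<gamma> u) \<and> version (weak_D Om \<gamma> u) (Z \<gamma>)"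
    by (intro choice allI)
  then obtain Z where Z: "\<And>\<gamma>. mi_order \<gamma> \<le> 3 \<Longrightarrow> has_weak_derivative Om \<gamma> u (weak_D Om \<gamma> u)"
      "\<And>\<gamma>. mi_order \<gamma> \<le> 3 \<Longrightarrow> version (weak_D Om \<gamma> u) (Z \<gamma>)"
    by blast
  have Z0: "version u (Z (0, 0))" by (rule sobolev_H_version[OF u Z(2)]) (simp add: mi_order_def)
  have "\<exists>K. mi_order \<gamma> \<le> 2 \<longrightarrow> K \<noteq> 0 \<and> (\<forall>C. (\<integral>p. indicator Om p * quadratic C \<gamma> p \<partial>lborel) = K * C \<gamma>)" for \<gamma>
    using quadratic_integral[of \<gamma>] by blast
  then have "\<exists>K. \<forall>\<gamma>. mi_order \<gamma> \<le> 2 \<longrightarrow> K \<gamma> \<noteq> 0 \<and> (\<forall>C. (\<integral>p. indicator Om p * quadratic C \<gamma> p \<partial>lborel) = K \<gamma> * C \<gamma>)"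
    by (intro choice allI)
  then obtain K where K: "\<And>\<gamma>. mi_order \<gamma> \<le> 2 \<Longrightarrow> K \<gamma> \<noteq> 0"
      "\<And>\<gamma> C. mi_order \<gamma> \<le> 2 \<Longrightarrow> (\<integral>p. indicator Om p * quadratic C \<gamma> p \<partial>lborel) = K \<gamma> * C \<gamma>"
    by blast
  \<comment> \<open>The moment conditions decouple, so each coefficient is a quotient. The third
    derivatives of the quadratic vanish, so those of the remainder are those of u.\<close>
  define C where "C \<gamma> = (\<integral>p. Z \<gamma> p \<partial>lborel) / K \<gamma>" for \<gamma>
  define W where "W \<gamma> = (\<lambda>p. 1 * Z \<gamma> p + (-1) * (indicator Om p * quadratic C \<gamma> p))" for \<gamma>
  define w where "w \<gamma> = (\<lambda>p. 1 * weak_D Om \<gamma> u p + (-1) * quadratic C \<gamma> p)" for \<gamma>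
  note Q = quadratic_has_weak_derivative[where C = C]
  show thesis
  proof (rule that)
    show "has_weak_derivative Om \<gamma> (\<lambda>p. 1 * u p + (-1) * quadratic C (0, 0) p) (w \<gamma>)" if "mi_order \<gamma> \<le> 3" for \<gamma>
      unfolding w_def by (rule has_weak_derivative_lincomb[OF Z0 Z(2) Q(2) Q(2) Z(1) Q(1), OF that that])
    show "version (w \<gamma>) (W \<gamma>)" if "mi_order \<gamma> \<le> 3" for \<gamma>
      unfolding w_def W_def by (rule version_lincomb[OF Z(2)[OF that] Q(2)])
    show "version (\<lambda>p. 1 * u p + (-1) * quadratic C (0, 0) p) (W (0, 0))"
      unfolding W_def by (rule version_lincomb[OF Z0 Q(2)])
    show "(\<integral>p. W \<gamma> p \<partial>lborel) = 0" if "mi_order \<gamma> \<le> 2" for \<gamma>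
    proof -
      have "integrable lborel (Z \<gamma>)" "integrable lborel (\<lambda>p. indicator Om p * quadratic C \<gamma> p)"
        using Z(2)[of \<gamma>] Q(2)[of \<gamma>] that by (auto simp: version_def L2_def L1_def)
      then have "(\<integral>p. W \<gamma> p \<partial>lborel) = (\<integral>p. Z \<gamma> p \<partial>lborel) - (\<integral>p. indicator Om p * quadratic C \<gamma> p \<partial>lborel)"
        unfolding W_def by simp
      then show ?thesis using K[OF that] by (simp add: C_def)
    qed
    show "version (weak_D Om \<gamma> u) (W \<gamma>)" if "mi_order \<gamma> = 3" for \<gamma>
      using Z(2)[of \<gamma>] that by (simp add: W_def quadratic_order_3)
  qed
qed

text \<open>The function e is prescribed on the open rectangle only: weak derivatives do not see its
  other values, and the interpolation operator has no meaning off the rectangle. For the order (2,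
  0) the inequality is kept multiplied by h to avoid a quotient.\<close>

proposition interpolation_error:
  assumes u: "u \<in> sobolev_H 3 Om"
  defines "h \<equiv> b - a" and "k \<equiv> d - c"
    and "N \<equiv> \<lambda>i j. L2_norm_on ({a..b} \<times> {c..d}) (weak_D Om (i, j) u)"
    and "E \<equiv> \<lambda>e i j. L2_norm_on ({a..b} \<times> {c..d}) (weak_D Om (i, j) e)"
  obtains v vy where "C1_on ({a..b} \<times> {c..d}) v" "AE p in lborel. p \<in> Om \<longrightarrow> u p = v p"
    "\<And>x y. x \<in> {a..b} \<Longrightarrow> y \<in> {c..d} \<Longrightarrow> ((\<lambda>y. v (x, y)) has_real_derivative vy (x, y)) (at y within {c..d})"
    "\<And>e. (\<And>p. p \<in> Om \<Longrightarrow> e p = u p - interpolant (node_data v vy) (0, 0) p) \<Longrightarrow> e \<in> sobolev_H 2 Om \<and>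
      E e 0 0 \<le> 20000 * (h ^ 3 * N 3 0 + h\<^sup>2 * k * N 2 1 + h * k\<^sup>2 * N 1 2 + k ^ 3 * N 0 3) \<and>
      E e 1 0 \<le> 20000 * (h\<^sup>2 * N 3 0 + h * k * N 2 1 + k\<^sup>2 * N 1 2) \<and>
      E e 0 1 \<le> 20000 * (h\<^sup>2 * N 2 1 + h * k * N 1 2 + k\<^sup>2 * N 0 3) \<and>
      E e 1 1 \<le> 20000 * (h * N 2 1 + k * N 1 2) \<and>
      E e 0 2 \<le> 20000 * (h * N 1 2 + k * N 0 3) \<and>
      h * E e 2 0 \<le> 20000 * (h\<^sup>2 * N 3 0 + h * k * N 2 1 + k\<^sup>2 * N 1 2)"
proof (rule moment_free_remainder[OF u])
  fix C w W
  assume w: "\<And>\<gamma>. mi_order \<gamma> \<le> 3 \<Longrightarrow> has_weak_derivative Om \<gamma> (\<lambda>p. 1 * u p + (-1) * quadratic C (0, 0) p) (w \<gamma>)"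
    and W: "\<And>\<gamma>. mi_order \<gamma> \<le> 3 \<Longrightarrow> version (w \<gamma>) (W \<gamma>)"
    and W0: "version (\<lambda>p. 1 * u p + (-1) * quadratic C (0, 0) p) (W (0, 0))"
    and mean: "\<And>\<gamma>. mi_order \<gamma> \<le> 2 \<Longrightarrow> (\<integral>p. W \<gamma> p \<partial>lborel) = 0"
    and W3: "\<And>\<gamma>. mi_order \<gamma> = 3 \<Longrightarrow> version (weak_D Om \<gamma> u) (W \<gamma>)"
  have L: "L2 (W (i, j))" if "i + j \<le> 3" for i j
    using W[of "(i, j)"] that by (simp add: version_def mi_order_def)
  have wx: "weak_x (W (i, j)) (W (Suc i, j))" if "i + j \<le> 2" for i j
    by (rule weak_x_of_weak_derivative[OF W0 W W w w]) (use that in \<open>simp_all add: mi_order_def\<close>)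
  have wy: "weak_y (W (i, j)) (W (i, Suc j))" if "i + j \<le> 2" for i j
    by (rule weak_y_of_weak_derivative[OF W0 W W w w]) (use that in \<open>simp_all add: mi_order_def\<close>)
  have P: "l2 (W (i, j)) \<le> 3 * (h * l2 (W (Suc i, j)) + k * l2 (W (i, Suc j)))" if "i + j \<le> 2" for i j
    unfolding h_def k_def by (rule poincare[OF L L L wx wy mean]) (use that in \<open>simp_all add: mi_order_def\<close>)
  \<comment> \<open>Order at most 1, since the mixed derivative adds two and must stay within order
    3.\<close>
  have "\<exists>v. represents v (W (i, j)) (W (Suc i, j)) (W (i, Suc j)) (W (Suc i, Suc j))" if "i + j \<le> 1" for i j
  proof -
    have l: "L1 (W (i, j))" "L1 (W (Suc i, j))" "L1 (W (i, Suc j))" "L1 (W (Suc i, Suc j))"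
      using L[of i j] L[of "Suc i" j] L[of i "Suc j"] L[of "Suc i" "Suc j"] that by (simp_all add: L2_def)
    have x: "weak_x (W (i, j)) (W (Suc i, j))" "weak_y (W (i, j)) (W (i, Suc j))"
      "weak_y (W (Suc i, j)) (W (Suc i, Suc j))" "weak_x (W (i, Suc j)) (W (Suc i, Suc j))"
      using that by (auto intro!: wx wy)
    show ?thesis
    proof (rule continuous_representative[OF l x])
      fix v assume "continuous_on UNIV v" "AE p in lborel. p \<in> Om \<longrightarrow> W (i, j) p = v p"
        "\<And>x1 x2 y1 y2. \<bar>v (x2, y2) - v (x1, y2) - v (x2, y1) + v (x1, y1)\<bar> \<le> (\<integral>q. \<bar>W (Suc i, Suc j) q\<bar> \<partial>lborel)"
      then show ?thesis
        unfolding represents_def using l x by (intro exI[of _ v] conjI allI)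
    qed
  qed
  then have "\<forall>i j. \<exists>v. i + j \<le> 1 \<longrightarrow> represents v (W (i, j)) (W (Suc i, j)) (W (i, Suc j)) (W (Suc i, Suc j))"
    by blast
  then have "\<exists>q. \<forall>i j. i + j \<le> 1 \<longrightarrow> represents (q i j) (W (i, j)) (W (Suc i, j)) (W (i, Suc j)) (W (Suc i, Suc j))"
    by (intro choice allI) blast
  then obtain q where q: "\<And>i j. i + j \<le> 1 \<Longrightarrow> represents (q i j) (W (i, j)) (W (Suc i, j)) (W (i, Suc j)) (W (Suc i, Suc j))"
    by blast
  have R: "represents (q 0 0) (W (0, 0)) (W (1, 0)) (W (0, 1)) (W (1, 1))"
    and R1: "represents (q 1 0) (W (1, 0)) (W (2, 0)) (W (1, 1)) (W (2, 1))"
    and R2: "represents (q 0 1) (W (0, 1)) (W (1, 1)) (W (0, 2)) (W (1, 2))"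
    using q[of 0 0] q[of 1 0] q[of 0 1] by (simp_all add: numeral_2_eq_2)
  define V where "V = node_data (q 0 0) (q 0 1)"
  define v where "v p = q 0 0 p + quadratic C (0, 0) p" for p
  define vy where "vy p = q 0 1 p + quadratic C (0, 1) p" for p
  define I where "I \<gamma> = l2 (\<lambda>p. indicator Om p * interpolant V \<gamma> p)" for \<gamma>
  show thesis
  proof (rule that)
    show "C1_on ({a..b} \<times> {c..d}) v"
      unfolding v_def by (rule C1_on_add[OF represents_C1_on[OF R R1 R2] quadratic_C1_on])
    have "AE p in lborel. p \<in> Om \<longrightarrow> W (0, 0) p = q 0 0 p" using R by (simp add: represents_def)
    moreover have "AE p in lborel. p \<in> Om \<longrightarrow> 1 * u p + (-1) * quadratic C (0, 0) p = W (0, 0) p"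
      using W0 by (simp add: version_def)
    ultimately show "AE p in lborel. p \<in> Om \<longrightarrow> u p = v p"
      unfolding v_def by eventually_elim auto
    show "((\<lambda>y. v (x, y)) has_real_derivative vy (x, y)) (at y within {c..d})" if "x \<in> {a..b}" "y \<in> {c..d}" for x y
      unfolding v_def vy_def by (rule DERIV_add[OF represents_DERIV_y[OF R R2 that] quadratic_DERIV_y])
  next
    fix e assume e: "\<And>p. p \<in> Om \<Longrightarrow> e p = u p - interpolant (node_data v vy) (0, 0) p"
    \<comment> \<open>Reproduction of quadratics: the error of u equals the error of the
      remainder.\<close>
    have e': "e p = 1 * (1 * u p + (-1) * quadratic C (0, 0) p) + (-1) * interpolant V (0, 0) p" if "p \<in> Om" for p
      using e[OF that] unfolding v_def vy_def V_def interpolant_node_data_add interpolant_quadratic by simp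
    note IV = interpolant_has_weak_derivative[of _ V]
    have I0: "version (interpolant V (0, 0)) (\<lambda>p. indicator Om p * interpolant V (0, 0) p)"
      by (rule IV(2)) (simp add: mi_order_def)
    define f where "f \<gamma> = (\<lambda>p. 1 * w \<gamma> p + (-1) * interpolant V \<gamma> p)" for \<gamma>
    define F where "F \<gamma> = (\<lambda>p. 1 * W \<gamma> p + (-1) * (indicator Om p * interpolant V \<gamma> p))" for \<gamma>
    let ?e = "\<lambda>p. 1 * (1 * u p + (-1) * quadratic C (0, 0) p) + (-1) * interpolant V (0, 0) p"
    have ve': "version ?e (F (0, 0))" unfolding F_def by (rule version_lincomb[OF W0 I0])
    have ve: "version e (F (0, 0))"
      by (rule version_cong[OF ve']) (use e' in auto)
    have fF: "version (f \<gamma>) (F \<gamma>)" if "mi_order \<gamma> \<le> 2" for \<gamma>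
      unfolding f_def F_def by (rule version_lincomb[OF W IV(2)]) (use that in simp_all)
    have De': "has_weak_derivative Om \<gamma> ?e (f \<gamma>)" if "mi_order \<gamma> \<le> 2" for \<gamma>
      unfolding f_def by (rule has_weak_derivative_lincomb[OF W0 W I0 IV(2) w IV(1)]) (use that in simp_all)
    have D: "has_weak_derivative Om \<gamma> e (f \<gamma>)" if "mi_order \<gamma> \<le> 2" for \<gamma>
      using De'[OF that] unfolding has_weak_derivative_version_iff[OF ve fF[OF that]] has_weak_derivative_version_iff[OF ve' fF[OF that]] .
    have Ebound: "E e i j \<le> 2 * (l2 (W (i, j)) + I (i, j))" if "i + j \<le> 2" for i j
    proof -
      have m: "mi_order (i, j) \<le> 2" "mi_order (i, j) \<le> 3" using that by (simp_all add: mi_order_def)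
      have "E e i j = l2 (F (i, j))"
        unfolding E_def by (rule version_L2_norm[OF weak_D_version(2)[OF D[OF m(1)] fF[OF m(1)]]])
      moreover have "L2 (W (i, j))" "L2 (\<lambda>p. indicator Om p * interpolant V (i, j) p)"
        using W[OF m(2)] IV(2)[OF m(1)] by (simp_all only: version_def)
      ultimately show ?thesis
        unfolding F_def I_def by (simp only: l2_diff_le)
    qed
    have N3: "N i j = l2 (W (i, j))" if "i + j = 3" for i j
      unfolding N_def by (rule version_L2_norm[OF W3]) (use that in \<open>simp add: mi_order_def\<close>)
    have Lw: "L2 (W (0, 0))" "L2 (W (1, 0))" "L2 (W (0, 1))" "L2 (W (2, 0))" "L2 (W (1, 1))" "L2 (W (0, 2))" "L2 (W (2, 1))" "L2 (W (1, 2))"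
      by (rule L, simp)+
    have hk: "0 < h" "0 < k" using ab cd by (simp_all add: h_def k_def)
    note B = interpolant_node_data_bounds[OF R R1 R2 Lw, folded V_def h_def k_def, folded I_def]
    have two: "Suc (Suc 0) = 2" "Suc 2 = 3" by simp_all
    have P': "l2 (W (0, 0)) \<le> 3 * (h * l2 (W (1, 0)) + k * l2 (W (0, 1)))"
      "l2 (W (1, 0)) \<le> 3 * (h * l2 (W (2, 0)) + k * l2 (W (1, 1)))"
      "l2 (W (0, 1)) \<le> 3 * (h * l2 (W (1, 1)) + k * l2 (W (0, 2)))"
      "l2 (W (2, 0)) \<le> 3 * (h * l2 (W (3, 0)) + k * l2 (W (2, 1)))"
      "l2 (W (1, 1)) \<le> 3 * (h * l2 (W (2, 1)) + k * l2 (W (1, 2)))"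
      "l2 (W (0, 2)) \<le> 3 * (h * l2 (W (1, 2)) + k * l2 (W (0, 3)))"
      using P[of 0 0] P[of 1 0] P[of 0 1] P[of 2 0] P[of 1 1] P[of 0 2] unfolding One_nat_def two by simp_all
    note A = interpolation_arithmetic[OF hk l2_nonneg l2_nonneg l2_nonneg l2_nonneg P']
    have N: "N 3 0 = l2 (W (3, 0))" "N 2 1 = l2 (W (2, 1))" "N 1 2 = l2 (W (1, 2))" "N 0 3 = l2 (W (0, 3))"
      by (rule N3, simp)+
    have "e \<in> sobolev_H 2 Om" by (rule sobolev_HI[OF ve, of _ f F]) (use D fF in blast)
    moreover have EE: "E e 0 0 \<le> 2 * (l2 (W (0, 0)) + I (0, 0))" "E e 1 0 \<le> 2 * (l2 (W (1, 0)) + I (1, 0))"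
      "E e 0 1 \<le> 2 * (l2 (W (0, 1)) + I (0, 1))" "E e 1 1 \<le> 2 * (l2 (W (1, 1)) + I (1, 1))"
      "E e 0 2 \<le> 2 * (l2 (W (0, 2)) + I (0, 2))" "E e 2 0 \<le> 2 * (l2 (W (2, 0)) + I (2, 0))"
      by (rule Ebound, simp)+
    note double_bound[OF EE(1) B(1) A(1)] double_bound[OF EE(2) B(2) A(2)] double_bound[OF EE(3) B(4) A(3)]
      double_bound[OF EE(4) B(5) A(4)] double_bound[OF EE(5) B(6) A(5)] scaled_double_bound[OF hk(1) EE(6) B(3) A(6)]
    ultimately
    show "e \<in> sobolev_H 2 Om \<and>
      E e 0 0 \<le> 20000 * (h ^ 3 * N 3 0 + h\<^sup>2 * k * N 2 1 + h * k\<^sup>2 * N 1 2 + k ^ 3 * N 0 3) \<and>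
      E e 1 0 \<le> 20000 * (h\<^sup>2 * N 3 0 + h * k * N 2 1 + k\<^sup>2 * N 1 2) \<and>
      E e 0 1 \<le> 20000 * (h\<^sup>2 * N 2 1 + h * k * N 1 2 + k\<^sup>2 * N 0 3) \<and>
      E e 1 1 \<le> 20000 * (h * N 2 1 + k * N 1 2) \<and>
      E e 0 2 \<le> 20000 * (h * N 1 2 + k * N 0 3) \<and>
      h * E e 2 0 \<le> 20000 * (h\<^sup>2 * N 3 0 + h * k * N 2 1 + k\<^sup>2 * N 1 2)"
      unfolding N by (intro conjI)
  qed
qed

end

section \<open>Identification with the interpolation operator of the statement\<close>

context rectangle begin

text \<open>The second sum of the (2, 0) estimate differentiates the chosen representative of u_x.
  By uniqueness its norms are those of third derivatives of u.\<close>

lemma weak_D_weak_D_x: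
  assumes u: "u \<in> sobolev_H 3 Om" and \<alpha>: "mi_order \<alpha> = 2"
  shows "L2_norm_on ({a..b} \<times> {c..d}) (weak_D Om \<alpha> (weak_D Om (1, 0) u)) =
    L2_norm_on ({a..b} \<times> {c..d}) (weak_D Om ((1, 0) + \<alpha>) u)"
proof -
  have m: "mi_order (0, 0) \<le> 3" "mi_order (1, 0) \<le> 3" "mi_order ((1, 0) + \<alpha>) \<le> 3"
    using \<alpha> by (simp_all add: mi_order_def)
  obtain Z0 where "version (weak_D Om (0, 0) u) Z0" by (rule sobolev_H_weak_D[OF u m(1)])
  then have 0: "version u Z0" by (rule sobolev_H_version[OF u])
  obtain Z1 where 1: "has_weak_derivative Om (1, 0) u (weak_D Om (1, 0) u)" "version (weak_D Om (1, 0) u) Z1"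
    by (rule sobolev_H_weak_D[OF u m(2)])
  obtain Z3 where 3: "has_weak_derivative Om ((1, 0) + \<alpha>) u (weak_D Om ((1, 0) + \<alpha>) u)"
      "version (weak_D Om ((1, 0) + \<alpha>) u) Z3"
    by (rule sobolev_H_weak_D[OF u m(3)])
  show ?thesis
    using version_L2_norm[OF weak_D_version(2)[OF weak_derivative_of_x_derivative[OF 0 1(2) 3(2) 1(1) 3(1)] 3(2)]]
      version_L2_norm[OF 3(2)] by simp
qed

lemma closure_Om: "closure Om = {a..b} \<times> {c..d}"
  using ab cd by (simp add: Om_def closure_Times)

text \<open>Both functions are continuous on the closed rectangle and agree with u almost
  everywhere.\<close>

lemma C1_representative_eq:
  assumes v: "C1_on ({a..b} \<times> {c..d}) v" "AE p in lborel. p \<in> Om \<longrightarrow> u p = v p" and p: "p \<in> {a..b} \<times> {c..d}"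
  shows "C1_representative ({a..b} \<times> {c..d}) u p = v p"
proof -
  let ?M = "{a..b} \<times> {c..d}" and ?r = "C1_representative ({a..b} \<times> {c..d}) u"
  have M: "?M \<in> sets lebesgue"
    using borel_closed[OF closed_Times, of "{a..b}" "{c..d}"] by simp
  have "AE p in lborel. p \<in> ?M \<longrightarrow> v p = u p"
    using v(2) Om_frontier by eventually_elim auto
  then have "AE p in lebesgue_on ?M. v p = u p"
    using M by (simp add: AE_restrict_space_iff AE_completion)
  with v(1) have *: "C1_on ?M ?r \<and> (AE p in lebesgue_on ?M. ?r p = u p)"
    unfolding C1_representative_def by (intro someI[where P = "\<lambda>v. C1_on ?M v \<and> (AE p in lebesgue_on ?M. v p = u p)"] conjI)
  then have "AE p in lebesgue. p \<in> ?M \<longrightarrow> ?r p = u p"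
    using M by (simp add: AE_restrict_space_iff)
  moreover have "AE p in lebesgue. p \<in> Om \<longrightarrow> u p = v p" using v(2) by (rule AE_completion)
  ultimately have ae: "AE p in lebesgue. p \<in> Om \<longrightarrow> ?r p = v p"
    by eventually_elim (use Om_subset in auto)
  show ?thesis
  proof (rule AE_eq_imp_eq_closure[OF _ _ _ ae])
    show "open Om" by (simp add: Om_def open_Times)
    show "continuous_on (closure Om) ?r" "continuous_on (closure Om) v" "p \<in> closure Om"
      unfolding closure_Om using * v(1) p C1_on_continuous by blast+
  qed
qed

lemma ref_coord_inverse: "l < r \<Longrightarrow> (l + r) / 2 + (r - l) / 2 * ref_coord l r x = x"
proof -
  assume "l < r"
  then have "(r - l) * ref_coord l r x = 2 * x - l - r" by (simp add: ref_coord_def)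
  then show ?thesis by (simp add: field_simps)
qed

text \<open>The data of the pulled back representative are those of \<open>node_data\<close>: values
  through the affine map, one-sided derivatives through the chain rule, which yields the factor (d -
  c) / 2.\<close>

lemma interp_y_eq:
  assumes v: "C1_on ({a..b} \<times> {c..d}) v" "AE p in lborel. p \<in> Om \<longrightarrow> u p = v p"
    and vy: "\<And>x y. x \<in> {a..b} \<Longrightarrow> y \<in> {c..d} \<Longrightarrow> ((\<lambda>y. v (x, y)) has_real_derivative vy (x, y)) (at y within {c..d})"
    and p: "p \<in> Om"
  shows "interp_y ((a + b) / 2, (c + d) / 2) (b - a, d - c) u p = interpolant (node_data v vy) (0, 0) p"
proof -
  let ?M = "{a..b} \<times> {c..d}" and ?F = "rect_map ((a + b) / 2, (c + d) / 2) (b - a, d - c)"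
  define R where "R = C1_representative ?M u \<circ> ?F"
  obtain x y where xy: "p = (x, y)" "x \<in> {a..b}" "y \<in> {c..d}" using p by (auto simp: Om_def)
  have rect: "rect ((a + b) / 2, (c + d) / 2) (b - a, d - c) = ?M"
    by (simp add: rect_def field_simps)
  have inj: "inj_on ?F ({-1..1} \<times> {-1..1})"
    using ab cd by (auto simp: inj_on_def rect_map_def)
  have ref: "ref_coord a b x \<in> {-1..1}" "ref_coord c d y \<in> {-1..1}"
    by (rule ref_coord_mem[OF ab xy(2)] ref_coord_mem[OF cd xy(3)])+
  have "?F (ref_coord a b x, ref_coord c d y) = p"
    using ref_coord_inverse[OF ab, of x] ref_coord_inverse[OF cd, of y] by (simp add: rect_map_def xy(1))
  then have inv: "inv_into ({-1..1} \<times> {-1..1}) ?F p = (ref_coord a b x, ref_coord c d y)"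
    using ref by (intro inv_into_f_eq[OF inj]) auto
  define g where "g t = (c + d) / 2 + (d - c) / 2 * t" for t
  have g: "g 1 = d" "g (-1) = c" by (simp_all add: g_def field_simps)
  have gm: "g t \<in> {c..d}" if "t \<in> {-1..1}" for t
  proof -
    have "0 \<le> (d - c) / 2 * (t + 1)" "0 \<le> (d - c) / 2 * (1 - t)"
      using that cd by (intro mult_nonneg_nonneg; simp)+
    then show ?thesis by (simp add: g_def field_simps)
  qed
  have r: "R (real i - 1, t) = v (node i, g t)" if "i < 3" "t \<in> {-1..1}" for i t
  proof -
    have "?F (real i - 1, t) = (node i, g t)" by (simp add: rect_map_def node_def g_def)
    moreover have "(node i, g t) \<in> ?M" using node_mem[OF that(1)] gm[OF that(2)] by blast
    ultimately show ?thesis using C1_representative_eq[OF v] by (simp add: R_def)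
  qed
  have D: "vector_derivative (\<lambda>t. R (real i - 1, t)) (at j within {-1..1}) = (d - c) / 2 * vy (node i, g j)"
    if i: "i < 3" and j: "j \<in> {-1..1}" for i j
  proof -
    \<comment> \<open>The derivative is restricted to the image of the reference interval, so that
      the chain rule also covers the one-sided derivatives at its ends.\<close>
    have "((\<lambda>y. v (node i, y)) has_real_derivative vy (node i, g j)) (at (g j) within g ` {-1..1})"
      by (rule DERIV_subset[OF vy[OF node_mem[OF i] gm[OF j]]]) (use gm in blast)
    moreover have "(g has_real_derivative (d - c) / 2) (at j within {-1..1})"
      unfolding g_def by (auto intro!: derivative_eq_intros)
    ultimately have "((\<lambda>y. v (node i, y)) \<circ> g has_real_derivative vy (node i, g j) * ((d - c) / 2)) (at j within {-1..1})"
      by (rule DERIV_image_chain)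
    then have "((\<lambda>t. R (real i - 1, t)) has_real_derivative vy (node i, g j) * ((d - c) / 2)) (at j within {-1..1})"
      by (rule has_field_derivative_transform_within[OF _ zero_less_one j]) (simp only: r[OF i] o_apply)
    then show ?thesis
      unfolding has_real_derivative_iff_has_vector_derivative
      by (subst vector_derivative_within_closed_interval[OF _ j]) (auto simp: mult.commute)
  qed
  have "interp_hat R (ref_coord a b x, ref_coord c d y) =
      interp_ref (node_data v vy) 0 0 (ref_coord a b x) (ref_coord c d y)"
    unfolding interp_hat_eq[OF ref(2)] interp_ref_def node_data_def
    by (intro sum.cong refl arg_cong2[where f = "(*)"]) (use D r g in simp)
  then show ?thesis
    unfolding interp_y_def rect interpolant_def by (simp add: inv[unfolded xy(1)] xy(1) R_def)
qed

proposition interpolation_estimate: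
  assumes ctr: "m = ((a + b) / 2, (c + d) / 2)" and size: "h = b - a" "k = d - c"
  shows "let H = (h, k); M = rect m H; D = weak_D (interior M); e = (\<lambda>p. u p - interp_y m H u p)
      in u \<in> sobolev_H 3 (interior M) \<longrightarrow>
           e \<in> sobolev_H 2 (interior M) \<and>
           (\<forall>\<gamma>. mi_order \<gamma> \<le> 2 \<and> \<gamma> \<noteq> (2, 0) \<longrightarrow>
              L2_norm_on M (D \<gamma> e)
                \<le> 20000 * (\<Sum>\<alpha> | mi_order \<alpha> = 3 - mi_order \<gamma>.
                         mi_power H \<alpha> * L2_norm_on M (D (\<alpha> + \<gamma>) u))) \<and>
           L2_norm_on M (D (2, 0) e)
             \<le> 20000 * ((\<Sum>\<alpha> | mi_order \<alpha> = 1.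
                        mi_power H \<alpha> * L2_norm_on M (D \<alpha> (D (2, 0) u))) +
                    (\<Sum>\<alpha> | mi_order \<alpha> = 2.
                        mi_power H \<alpha> / h * L2_norm_on M (D \<alpha> (D (1, 0) u))))"
proof -
  have hk: "0 < h" "0 < k" using ab cd by (simp_all add: size)
  have M: "rect m (h, k) = {a..b} \<times> {c..d}" by (simp add: rect_def ctr size field_simps)
  have int: "interior ({a..b} \<times> {c..d}) = Om" by (simp add: interior_Times Om_def)
  let ?N = "\<lambda>f. L2_norm_on ({a..b} \<times> {c..d}) f"
  let ?e = "\<lambda>p. u p - interp_y m (h, k) u p"
  have "?e \<in> sobolev_H 2 Om \<and>
      (\<forall>\<gamma>. mi_order \<gamma> \<le> 2 \<and> \<gamma> \<noteq> (2, 0) \<longrightarrow> ?N (weak_D Om \<gamma> ?e)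
         \<le> 20000 * (\<Sum>\<alpha> | mi_order \<alpha> = 3 - mi_order \<gamma>. mi_power (h, k) \<alpha> * ?N (weak_D Om (\<alpha> + \<gamma>) u))) \<and>
      ?N (weak_D Om (2, 0) ?e)
         \<le> 20000 * ((\<Sum>\<alpha> | mi_order \<alpha> = 1. mi_power (h, k) \<alpha> * ?N (weak_D Om \<alpha> (weak_D Om (2, 0) u))) +
             (\<Sum>\<alpha> | mi_order \<alpha> = 2. mi_power (h, k) \<alpha> / h * ?N (weak_D Om \<alpha> (weak_D Om (1, 0) u))))"
    if u: "u \<in> sobolev_H 3 Om"
  proof (rule interpolation_error[OF u, folded size])
    fix v vy
    assume v: "C1_on ({a..b} \<times> {c..d}) v" "AE p in lborel. p \<in> Om \<longrightarrow> u p = v p"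
      and vy: "\<And>x y. x \<in> {a..b} \<Longrightarrow> y \<in> {c..d} \<Longrightarrow> ((\<lambda>y. v (x, y)) has_real_derivative vy (x, y)) (at y within {c..d})"
      and B: "\<And>e. (\<And>p. p \<in> Om \<Longrightarrow> e p = u p - interpolant (node_data v vy) (0, 0) p) \<Longrightarrow> e \<in> sobolev_H 2 Om \<and>
        ?N (weak_D Om (0, 0) e) \<le> 20000 * (h ^ 3 * ?N (weak_D Om (3, 0) u) + h\<^sup>2 * k * ?N (weak_D Om (2, 1) u) +
          h * k\<^sup>2 * ?N (weak_D Om (1, 2) u) + k ^ 3 * ?N (weak_D Om (0, 3) u)) \<and>
        ?N (weak_D Om (1, 0) e) \<le> 20000 * (h\<^sup>2 * ?N (weak_D Om (3, 0) u) + h * k * ?N (weak_D Om (2, 1) u) +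
          k\<^sup>2 * ?N (weak_D Om (1, 2) u)) \<and>
        ?N (weak_D Om (0, 1) e) \<le> 20000 * (h\<^sup>2 * ?N (weak_D Om (2, 1) u) + h * k * ?N (weak_D Om (1, 2) u) +
          k\<^sup>2 * ?N (weak_D Om (0, 3) u)) \<and>
        ?N (weak_D Om (1, 1) e) \<le> 20000 * (h * ?N (weak_D Om (2, 1) u) + k * ?N (weak_D Om (1, 2) u)) \<and>
        ?N (weak_D Om (0, 2) e) \<le> 20000 * (h * ?N (weak_D Om (1, 2) u) + k * ?N (weak_D Om (0, 3) u)) \<and>
        h * ?N (weak_D Om (2, 0) e) \<le> 20000 * (h\<^sup>2 * ?N (weak_D Om (3, 0) u) + h * k * ?N (weak_D Om (2, 1) u) +
          k\<^sup>2 * ?N (weak_D Om (1, 2) u))"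
    have "?e p = u p - interpolant (node_data v vy) (0, 0) p" if "p \<in> Om" for p
      unfolding ctr size using interp_y_eq[OF v vy that] by simp
    note E = B[OF this]
    show ?thesis
    proof (intro conjI allI impI)
      show "?e \<in> sobolev_H 2 Om" using E by blast
      fix \<gamma> assume "mi_order \<gamma> \<le> 2 \<and> \<gamma> \<noteq> (2, 0)"
      then have "\<gamma> \<in> {(0, 0), (1, 0), (0, 1), (1, 1), (0, 2)}"
        by (cases \<gamma>) (auto simp: mi_order_def)
      then show "?N (weak_D Om \<gamma> ?e)
         \<le> 20000 * (\<Sum>\<alpha> | mi_order \<alpha> = 3 - mi_order \<gamma>. mi_power (h, k) \<alpha> * ?N (weak_D Om (\<alpha> + \<gamma>) u))"
        using E unfolding sum_mi_order
        by (auto simp: mi_order_def mi_power_def eval_nat_numeral add_ac)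
    next
      have "mi_power (h, k) \<alpha> / h * ?N (weak_D Om \<alpha> (weak_D Om (1, 0) u)) =
          mi_power (h, k) \<alpha> * ?N (weak_D Om ((1, 0) + \<alpha>) u) / h" if "mi_order \<alpha> = 2" for \<alpha>
        using weak_D_weak_D_x[OF u that] by simp
      then have 2: "(\<Sum>\<alpha> | mi_order \<alpha> = 2. mi_power (h, k) \<alpha> / h * ?N (weak_D Om \<alpha> (weak_D Om (1, 0) u))) =
          (\<Sum>\<alpha> | mi_order \<alpha> = 2. mi_power (h, k) \<alpha> * ?N (weak_D Om ((1, 0) + \<alpha>) u)) / h"
        unfolding sum_divide_distrib by (intro sum.cong) auto
      have 1: "0 \<le> (\<Sum>\<alpha> | mi_order \<alpha> = 1. mi_power (h, k) \<alpha> * ?N (weak_D Om \<alpha> (weak_D Om (2, 0) u)))"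
        using hk by (intro sum_nonneg mult_nonneg_nonneg) (auto simp: mi_power_def L2_norm_on_def)
      have 3: "(\<Sum>\<alpha> | mi_order \<alpha> = 2. mi_power (h, k) \<alpha> * ?N (weak_D Om ((1, 0) + \<alpha>) u)) =
          h\<^sup>2 * ?N (weak_D Om (3, 0) u) + h * k * ?N (weak_D Om (2, 1) u) + k\<^sup>2 * ?N (weak_D Om (1, 2) u)"
        unfolding sum_mi_order by (simp add: mi_power_def eval_nat_numeral add_ac)
      have 4: "h * ?N (weak_D Om (2, 0) ?e) \<le> 20000 * (h\<^sup>2 * ?N (weak_D Om (3, 0) u) +
          h * k * ?N (weak_D Om (2, 1) u) + k\<^sup>2 * ?N (weak_D Om (1, 2) u))"
        using E by blast
      \<comment> \<open>Division by h, which produces the factor 1 / h in the second sum; the first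
        sum enters as a nonnegative term.\<close>
      have 5: "x \<le> 20000 * (y + z / h)" if "0 \<le> y" "h * x \<le> 20000 * z" for x y z
      proof -
        have "x \<le> 20000 * (z / h)" using that(2) hk by (simp add: field_simps)
        then show ?thesis using that(1) by simp
      qed
      show "?N (weak_D Om (2, 0) ?e)
         \<le> 20000 * ((\<Sum>\<alpha> | mi_order \<alpha> = 1. mi_power (h, k) \<alpha> * ?N (weak_D Om \<alpha> (weak_D Om (2, 0) u))) +
             (\<Sum>\<alpha> | mi_order \<alpha> = 2. mi_power (h, k) \<alpha> / h * ?N (weak_D Om \<alpha> (weak_D Om (1, 0) u))))"
        unfolding 2 3 by (rule 5[OF 1 4])
    qed
  qed
  then show ?thesis
    unfolding Let_def M int by blast
qed

end

theorem corollary20: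
  "\<exists>C::real. \<forall>(c :: real \<times> real) hx hy (u :: real \<times> real \<Rightarrow> real). hx > 0 \<longrightarrow> hy > 0 \<longrightarrow>
     (let h = (hx, hy); M = rect c h; D = weak_D (interior M);
          e = (\<lambda>p. u p - interp_y c h u p)
      in u \<in> sobolev_H 3 (interior M) \<longrightarrow>
           e \<in> sobolev_H 2 (interior M) \<and>
           (\<forall>\<gamma>. mi_order \<gamma> \<le> 2 \<and> \<gamma> \<noteq> (2, 0) \<longrightarrow>
              L2_norm_on M (D \<gamma> e)
                \<le> C * (\<Sum>\<alpha> | mi_order \<alpha> = 3 - mi_order \<gamma>.
                         mi_power h \<alpha> * L2_norm_on M (D (\<alpha> + \<gamma>) u))) \<and>
           L2_norm_on M (D (2, 0) e)
             \<le> C * ((\<Sum>\<alpha> | mi_order \<alpha> = 1.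
                        mi_power h \<alpha> * L2_norm_on M (D \<alpha> (D (2, 0) u))) +
                    (\<Sum>\<alpha> | mi_order \<alpha> = 2.
                        mi_power h \<alpha> / hx * L2_norm_on M (D \<alpha> (D (1, 0) u)))))"
\<comment> \<open>20000 is 10000 from the iterated Poincare inequalities times 2 from the triangle
  inequality.\<close>
proof (intro exI[of _ 20000] allI impI, goal_cases)
  case (1 m h k u)
  have "rectangle (fst m - h / 2) (fst m + h / 2) (snd m - k / 2) (snd m + k / 2)"
    using 1 by unfold_locales simp_all
  then show ?case
    by (rule rectangle.interpolation_estimate) simp_all
qed

end
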